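(* Let $R$ be a root system of dimension $n$, $R^+$ a system of positive roots, $N=|R^+|$, and $F\subseteq R^+$ the set of simple roots; for $r\in R^+$ write $r=\sum_{f\in F}\gamma_{r,f}f$ with nonnegative integers $\gamma_{r,f}$. Then the function $$\vartheta_R(\tau,z)=\eta(\tau)^{n-N}\prod_{r\in R^+}\vartheta\Bigl(\tau,\sum_{f\in F}\gamma_{r,f}z_f\Bigr)\qquad(\tau\in\mathbb H,\ z=(z_f)_{f\in F}\in\mathbb C^F)$$ is a Jacobi form in $J_{n/2,\underline R}(\varepsilon^{n+2N})$, where $\underline R$ is the lattice $\mathbb Z^F$ with the quadratic form $Q(z)=\frac12\sum_{r\in R^+}\bigl(\sum_f\gamma_{r,f}z_f\bigr)^2$ (i.e. bilinear form $\beta(x,y)=\sum_{r\in R^+}(\sum_f\gamma_{r,f}x_f)(\sum_f\gamma_{r,f}y_f)$).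
   Context: Root systems are reduced crystallographic root systems (finite orthogonal unions of irreducible ones of types $A_n,B_n,C_n,D_n,E_6,E_7,E_8,F_4,G_2$). $e(x)=e^{2\pi ix}$, $q=e(\tau)$, $\eta(\tau)=q^{1/24}\prod_{n\ge1}(1-q^n)$, $\vartheta(\tau,z)=\sum_{r\in\mathbb Z}\left(\frac{-4}{r}\right)q^{r^2/8}e(rz/2)$; $\varepsilon^h(A)=f(A\tau)/f(\tau)$ for a fixed branch $f$ of $\eta^h$. For an integral lattice $\underline L=(L,\beta)$ ($\beta$ nondegenerate symmetric $\mathbb Z$-valued, extended bilinearly, $\beta(x)=\frac12\beta(x,x)$), with shadow $L^\bullet=\{r\in\mathbb Q\otimes L:\beta(x)\equiv\beta(r,x)\bmod\mathbb Z\ \forall x\in L\}$, and rational $k,h$ with $k\equiv h/2\bmod\mathbb Z$, $J_{k,\underline L}(\varepsilon^h)$ is the space of holomorphic $\phi$ on $\mathbb H\times(\mathbb C\otimes L)$ with (i) $\phi(A\tau,\frac z{c\tau+d})=e(\frac{c\beta(z)}{c\tau+d})(c\tau+d)^{k-h/2}\varepsilon^h(A)\phi(\tau,z)$ for all $A=\begin{pmatrix}a&b\\c&d\end{pmatrix}\in SL_2(\mathbb Z)$; (ii) $\phi(\tau,z+x\tau+y)=e(\beta(x+y))e(-\tau\beta(x)-\beta(x,z))\phi(\tau,z)$ for $x,y\in L$; (iii) $\phi=\sum_{n\in\frac h{24}+\mathbb Z}\sum_{r\in L^\bullet,n\ge\beta(r)}c(n,r)q^ne(\beta(r,z))$. 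*)

theory Defs
  imports "HOL-Complex_Analysis.Complex_Analysis"
begin

text \<open>A reduced crystallographic root system, regarded as living in its own linear span (which need
  not be the whole ambient Euclidean space); its dimension is \<open>dim R\<close>.\<close>

definition root_system :: "'a::euclidean_space set \<Rightarrow> bool" where
  "root_system R \<longleftrightarrow>
     finite R \<and> 0 \<notin> R \<and>
     (\<forall>\<alpha>\<in>R. \<forall>\<beta>\<in>R. \<beta> - (2 * (\<beta> \<bullet> \<alpha>) / (\<alpha> \<bullet> \<alpha>)) *\<^sub>R \<alpha> \<in> R) \<and>
     (\<forall>\<alpha>\<in>R. \<forall>\<beta>\<in>R. 2 * (\<beta> \<bullet> \<alpha>) / (\<alpha> \<bullet> \<alpha>) \<in> \<int>) \<and>
     (\<forall>\<alpha>\<in>R. \<forall>t. t *\<^sub>R \<alpha> \<in> R \<longrightarrow> t = 1 \<or> t = -1)"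

definition positive_system :: "'a::euclidean_space set \<Rightarrow> 'a set \<Rightarrow> bool" where
  "positive_system R P \<longleftrightarrow> (\<exists>v. (\<forall>\<alpha>\<in>R. v \<bullet> \<alpha> \<noteq> 0) \<and> P = {\<alpha>\<in>R. v \<bullet> \<alpha> > 0})"

definition simple_roots :: "'a::euclidean_space set \<Rightarrow> 'a set" where
  "simple_roots P = {\<alpha>\<in>P. \<not> (\<exists>\<beta>\<in>P. \<exists>\<gamma>\<in>P. \<alpha> = \<beta> + \<gamma>)}"

definition uhp :: "complex set" where
  "uhp = {\<tau>. Im \<tau> > 0}"

definition ee :: "complex \<Rightarrow> complex" where
  "ee x = exp (2 * of_real pi * \<i> * x)"

definition eta :: "complex \<Rightarrow> complex" where
  "eta \<tau> = ee (\<tau> / 24) * (\<Prod>m. 1 - ee \<tau> ^ (m + 1))"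

definition kronecker_m4 :: "int \<Rightarrow> int" where  \<comment> \<open>the Kronecker symbol \<open>(-4/r)\<close>\<close>
  "kronecker_m4 r = (if r mod 4 = 1 then 1 else if r mod 4 = 3 then -1 else 0)"

definition theta :: "complex \<Rightarrow> complex \<Rightarrow> complex" where
  "theta \<tau> z = (\<Sum>\<^sub>\<infinity>r::int. of_int (kronecker_m4 r) * ee (of_int (r^2) / 8 * \<tau>) * ee (of_int r * z / 2))"

text \<open>A branch of \<open>\<eta>\<^sup>h\<close> is \<open>exp (h log \<eta>)\<close> for a holomorphic logarithm of \<open>\<eta>\<close> on the upper half plane.
  Two branches differ by a constant factor, so \<open>eps\<close> does not depend on the choice. It is a function
  of \<open>\<tau>\<close> as well as of the matrix with rows \<open>(a, b)\<close> and \<open>(c, d)\<close>: it has weight \<open>h/2\<close>.\<close>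

definition eta_power_branch :: "rat \<Rightarrow> (complex \<Rightarrow> complex) \<Rightarrow> bool" where
  "eta_power_branch h f \<longleftrightarrow>
     (\<exists>g. g holomorphic_on uhp \<and> (\<forall>\<tau>\<in>uhp. exp (g \<tau>) = eta \<tau> \<and> f \<tau> = exp (of_rat h * g \<tau>)))"

definition eps :: "rat \<Rightarrow> int \<Rightarrow> int \<Rightarrow> int \<Rightarrow> int \<Rightarrow> complex \<Rightarrow> complex" where
  "eps h a b c d \<tau> =
     (let f = (SOME f. eta_power_branch h f)
      in f ((of_int a * \<tau> + of_int b) / (of_int c * \<tau> + of_int d)) / f \<tau>)"

text \<open>A lattice is given in coordinates with respect to a basis: the underlying group is \<open>int^'n\<close>,
  with bilinear form \<open>\<beta>\<close>. The rational and complex scalar extensions are \<open>rat^'n\<close> and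
  \<open>complex^'n\<close>, to which \<open>bil \<beta>\<close> extends \<open>\<beta>\<close>.\<close>

definition integral_lattice :: "(int^'n \<Rightarrow> int^'n \<Rightarrow> int) \<Rightarrow> bool" where
  "integral_lattice \<beta> \<longleftrightarrow>
     (\<forall>x y z. \<beta> (x + y) z = \<beta> x z + \<beta> y z) \<and>
     (\<forall>x y. \<beta> x y = \<beta> y x) \<and>
     (\<forall>x. (\<forall>y. \<beta> x y = 0) \<longrightarrow> x = 0)"

definition bil :: "(int^'n \<Rightarrow> int^'n \<Rightarrow> int) \<Rightarrow> 'c::field^'n \<Rightarrow> 'c^'n \<Rightarrow> 'c" where
  "bil \<beta> x y = (\<Sum>i\<in>UNIV. \<Sum>j\<in>UNIV. x $ i * of_int (\<beta> (axis i 1) (axis j 1)) * y $ j)"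

definition quad :: "(int^'n \<Rightarrow> int^'n \<Rightarrow> int) \<Rightarrow> 'c::field^'n \<Rightarrow> 'c" where
  "quad \<beta> x = bil \<beta> x x / 2"

definition vec_of_int :: "int^'n \<Rightarrow> 'c::ring_1^'n" where
  "vec_of_int x = (\<chi> i. of_int (x $ i))"

definition vec_of_rat :: "rat^'n \<Rightarrow> complex^'n" where
  "vec_of_rat x = (\<chi> i. of_rat (x $ i))"

definition shadow :: "(int^'n \<Rightarrow> int^'n \<Rightarrow> int) \<Rightarrow> (rat^'n) set" where
  "shadow \<beta> = {r. \<forall>x. quad \<beta> (vec_of_int x) - bil \<beta> r (vec_of_int x) \<in> \<int>}"

text \<open>Joint holomorphy: Frechet differentiability with complex linear derivative.\<close>

definition holomorphic_uhp_vec :: "(complex \<Rightarrow> complex^'n \<Rightarrow> complex) \<Rightarrow> bool" where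
  "holomorphic_uhp_vec \<phi> \<longleftrightarrow>
     (\<forall>\<tau>\<in>uhp. \<forall>z. \<exists>D. ((\<lambda>(t, w). \<phi> t w) has_derivative D) (at (\<tau>, z)) \<and>
        (\<forall>s t w. D (s * t, s *s w) = s * D (t, w)))"

text \<open>The space of Jacobi forms of weight \<open>k\<close>, lattice \<open>(int^'n, \<beta>)\<close> and character \<open>\<epsilon>\<^sup>h\<close>. It is only
  meaningful for \<open>k \<equiv> h/2\<close> modulo 1, when \<open>k - h/2\<close> equals its floor, and for an integral lattice; both
  are made conditions of membership.\<close>

definition jacobi_forms ::
    "rat \<Rightarrow> (int^'n \<Rightarrow> int^'n \<Rightarrow> int) \<Rightarrow> rat \<Rightarrow> (complex \<Rightarrow> complex^'n \<Rightarrow> complex) set" where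
  "jacobi_forms k \<beta> h = {\<phi>.
     integral_lattice \<beta> \<and> k - h / 2 \<in> \<int> \<and>
     holomorphic_uhp_vec \<phi> \<and>
     (\<forall>a b c d :: int. a * d - b * c = 1 \<longrightarrow> (\<forall>\<tau>\<in>uhp. \<forall>z.
        \<phi> ((of_int a * \<tau> + of_int b) / (of_int c * \<tau> + of_int d))
          ((1 / (of_int c * \<tau> + of_int d)) *s z) =
        ee (of_int c * quad \<beta> z / (of_int c * \<tau> + of_int d)) *
        (of_int c * \<tau> + of_int d) powi \<lfloor>k - h / 2\<rfloor> * eps h a b c d \<tau> * \<phi> \<tau> z)) \<and>
     (\<forall>x y :: int^'n. \<forall>\<tau>\<in>uhp. \<forall>z.
        \<phi> \<tau> (z + \<tau> *s vec_of_int x + vec_of_int y) =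
        ee (quad \<beta> (vec_of_int (x + y))) *
        ee (- \<tau> * quad \<beta> (vec_of_int x) - bil \<beta> (vec_of_int x) z) * \<phi> \<tau> z) \<and>
     (\<exists>coef :: rat \<Rightarrow> rat^'n \<Rightarrow> complex. \<forall>\<tau>\<in>uhp. \<forall>z.
        ((\<lambda>(m, r). coef m r * ee (of_rat m * \<tau>) * ee (bil \<beta> (vec_of_rat r) z)) has_sum \<phi> \<tau> z)
          {(m, r). m - h / 24 \<in> \<int> \<and> r \<in> shadow \<beta> \<and> m \<ge> quad \<beta> r})}"

text \<open>Here \<open>\<gamma> r i\<close> is the coefficient of the \<open>i\<close>-th simple root in the positive root \<open>r\<close>.\<close>

definition theta_root ::
    "nat \<Rightarrow> 'a set \<Rightarrow> ('a \<Rightarrow> 'n \<Rightarrow> nat) \<Rightarrow> complex \<Rightarrow> complex^'n \<Rightarrow> complex" where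
  "theta_root n P \<gamma> \<tau> z =
     eta \<tau> powi (int n - int (card P)) * (\<Prod>r\<in>P. theta \<tau> (\<Sum>i\<in>UNIV. of_nat (\<gamma> r i) * z $ i))"

definition root_form :: "'a set \<Rightarrow> ('a \<Rightarrow> 'n \<Rightarrow> nat) \<Rightarrow> int^'n \<Rightarrow> int^'n \<Rightarrow> int" where
  "root_form P \<gamma> x y =
     (\<Sum>r\<in>P. (\<Sum>i\<in>UNIV. int (\<gamma> r i) * x $ i) * (\<Sum>i\<in>UNIV. int (\<gamma> r i) * y $ i))"

end

theory Submission
  imports Defs "HOL-Library.Nat_Bijection" "HOL-Library.Periodic_Fun"
begin

text \<open>By the Jacobi triple product, \<open>theta \<tau>\<close> has simple zeros exactly at the period lattice and
  derivative \<open>2 \<pi> i \<eta>(\<tau>)\<^sup>3\<close> at \<open>0\<close>. Since an entire elliptic function is constant, its quasi-periods determine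
  \<open>theta \<tau>\<close> up to a factor, which gives the transformation law of \<open>theta / \<eta>\<^sup>3\<close> under all of the modular
  group at once. Multiplying over the positive roots yields the modular and elliptic laws of the
  theta block.

  The condition at infinity is the inequality \<open>\<Sum>\<^bsub>r > 0\<^esub> (s\<^sub>r/2 - l(r))\<^sup>2 \<ge> (N - n)/12\<close> for odd \<open>s\<^sub>r\<close> and
  linear \<open>l\<close>. Here \<open>s\<^sub>r/2 - l(r)\<close> may be replaced by the sawtooth value \<open>v\<^sub>r\<close>, the fractional part of
  \<open>l(r)\<close> minus \<open>1/2\<close>. It is odd in \<open>r\<close>, with \<open>v\<^sub>r + v\<^sub>s + v\<^sub>t = \<plusminus> 1/2\<close> whenever \<open>r + s + t = 0\<close>. Let
  \<open>(r,s)\<^sub>*\<close> be the form dual to \<open>\<Sum>\<^bsub>r\<^esub> r \<otimes> r\<close> (sum over all roots). Root strings express \<open>(r,s)\<^sub>*\<close> by the squared structure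
  constants \<open>c(r,s)\<close>, which are symmetric functions on triples with \<open>r + s + t = 0\<close>. Summing
  \<open>c (v\<^sub>r + v\<^sub>s + v\<^sub>t)\<^sup>2 = c/4\<close> over all triples shows that \<open>\<Sum>\<^bsub>r\<^esub> v\<^sub>r\<^sup>2 - (N - n)/6\<close> is the square length
  \<open>\<Sum>\<^bsub>r,s\<^esub> v\<^sub>r v\<^sub>s (r,s)\<^sub>*\<close>, hence nonnegative; this refines the strange formula of Freudenthal and
  de Vries.\<close>

subsection \<open>Root strings\<close>

text \<open>The power \<eta>^(n - N) has order (n - N)/24 in q, negative as soon as N > n, and the
  theta factors must make up for it. Expand everything and take a term with index k from the power
  of \<eta> and odd indices \<open>s r\<close> from the theta factors. Its order in q minus the norm
  of its lattice vector is k + (n - N)/24 plus half of \<Sum> (s_r/2 - l(r))^2 once the square is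
  completed, which is where the bound (N - n)/12 comes from. A root by itself gives nothing, since
  its sawtooth value may vanish; only the relation inside a triple r, s, -(r + s) keeps the values
  away from 0. The 12 is 3 times 4: three cyclic versions of one sum are added to form a square, and
  that square is (1/2)^2. As \<open>eps\<close> is a quotient of values of \<eta>, comparing
  derivatives at 0 gives the multiplier (\<eta>(\<tau>')/\<eta>(\<tau>))^3 of theta already in the
  form that the definition wants.\<close>

lemma int_mult_less_4:
  fixes m n :: int
  assumes "m * n < 4" "0 < m" "0 < n"
  shows "m \<le> 3" "m = 1 \<or> n = 1"
proof -
  show "m \<le> 3" using assms by (smt (verit, best) mult_le_cancel_left1)
  show "m = 1 \<or> n = 1"
  proof (rule ccontr)
    assume "\<not> (m = 1 \<or> n = 1)"
    then have "2 \<le> m" "2 \<le> n" using assms by auto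
    then have "2 * 2 \<le> m * n" by (intro mult_mono) auto
    then show False using assms by simp
  qed
qed

locale root_sys =
  fixes R :: "'a::euclidean_space set"
  assumes root_system: "root_system R"
begin

section \<open>Cartan integers and pairs of independent roots\<close>

definition cartan :: "'a \<Rightarrow> 'a \<Rightarrow> real" where
  "cartan s r = 2 * (s \<bullet> r) / (r \<bullet> r)"

lemma finite_R [simp]: "finite R"
  and zero_notin [simp]: "0 \<notin> R"
  and reflect: "r \<in> R \<Longrightarrow> s \<in> R \<Longrightarrow> s - cartan s r *\<^sub>R r \<in> R"
  and cartan_Ints: "r \<in> R \<Longrightarrow> s \<in> R \<Longrightarrow> cartan s r \<in> \<int>"
  and reduced: "r \<in> R \<Longrightarrow> t *\<^sub>R r \<in> R \<Longrightarrow> t = 1 \<or> t = -1"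
  using root_system unfolding root_system_def cartan_def by blast+

lemma nonzero: "r \<in> R \<Longrightarrow> r \<noteq> 0"
  using zero_notin by blast

lemma norm_pos: "r \<in> R \<Longrightarrow> 0 < r \<bullet> r"
  using nonzero by simp

lemma uminus_closed: "r \<in> R \<Longrightarrow> - r \<in> R"
  using reflect[of r r] norm_pos[of r] by (simp add: cartan_def scaleR_2)

lemma uminus_iff: "- r \<in> R \<longleftrightarrow> r \<in> R"
  using uminus_closed by fastforce

text \<open>As \<open>R\<close> is reduced, this is linear independence of two roots
  (\<open>indep_not_multiple\<close>). It persists along an r-string (\<open>indep_shift\<close>),
  which keeps multiples of r out of every string below.\<close>

definition indep :: "'a \<Rightarrow> 'a \<Rightarrow> bool" where
  "indep r s \<longleftrightarrow> r \<in> R \<and> s \<in> R \<and> s \<noteq> r \<and> s \<noteq> - r"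

lemma indep_sym: "indep r s \<Longrightarrow> indep s r"
  by (auto simp: indep_def)

lemma indep_uminus [simp]: "indep r (- s) \<longleftrightarrow> indep r s"
  by (auto simp: indep_def uminus_iff minus_equation_iff)

lemma indep_uminus_left [simp]: "indep (- r) s \<longleftrightarrow> indep r s"
  by (auto simp: indep_def uminus_iff)

lemma indep_not_multiple: "indep r s \<Longrightarrow> s \<noteq> t *\<^sub>R r"
  using reduced[of r t] by (auto simp: indep_def)

lemma indep_shift: "indep r s \<Longrightarrow> s + t *\<^sub>R r \<in> R \<Longrightarrow> indep r (s + t *\<^sub>R r)"
  using indep_not_multiple[of r s "1 - t"] indep_not_multiple[of r s "-1 - t"]
  by (auto simp: indep_def algebra_simps)

lemma indep_add: "indep r s \<Longrightarrow> s + r \<in> R \<Longrightarrow> indep r (s + r)"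
  using indep_shift[of r s 1] by simp

lemma cartan_mult_less_4:
  assumes "indep r s"
  shows "cartan s r * cartan r s < 4"
proof -
  have r: "r \<in> R" "s \<in> R" using assms by (auto simp: indep_def)
  note pos = norm_pos[OF r(1)] norm_pos[OF r(2)]
  \<comment> \<open>The component of s orthogonal to r, nonzero by independence; its positive square
    length is the strict Cauchy-Schwarz inequality.\<close>
  define u where "u = s - ((s \<bullet> r) / (r \<bullet> r)) *\<^sub>R r"
  have "u \<noteq> 0" using indep_not_multiple[OF assms] by (auto simp: u_def)
  then have "0 < u \<bullet> u" by simp
  also have "u \<bullet> u = s \<bullet> s - (s \<bullet> r)\<^sup>2 / (r \<bullet> r)"
    using pos by (simp add: u_def inner_diff_left inner_diff_right inner_commute power2_eq_square field_simps)
  finally have "(s \<bullet> r)\<^sup>2 < (s \<bullet> s) * (r \<bullet> r)" using pos by (simp add: field_simps)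
  then show ?thesis using pos by (simp add: cartan_def inner_commute power2_eq_square field_simps)
qed

lemma cartan_pos_cases:
  assumes "indep r s" "0 < r \<bullet> s"
  shows "cartan s r \<le> 3" "cartan s r = 1 \<or> cartan r s = 1"
proof -
  have r: "r \<in> R" "s \<in> R" using assms by (auto simp: indep_def)
  obtain m n where mn: "cartan s r = of_int m" "cartan r s = of_int n"
    using cartan_Ints r by (metis Ints_cases)
  have "0 < cartan s r" "0 < cartan r s"
    using norm_pos r assms(2) by (simp_all add: cartan_def inner_commute)
  then have "0 < m" "0 < n" using mn by auto
  moreover have "m * n < 4" using cartan_mult_less_4[OF assms(1)] unfolding mn by (metis of_int_less_numeral_iff of_int_mult)
  ultimately have "m \<le> 3" "m = 1 \<or> n = 1" using int_mult_less_4[of m n] by auto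
  then show "cartan s r \<le> 3" "cartan s r = 1 \<or> cartan r s = 1" unfolding mn by auto
qed

text \<open>One of the two Cartan integers is 1, so the corresponding reflection subtracts exactly
  one root and yields s - r or r - s.\<close>

lemma diff_in_R:
  assumes "indep r s" "0 < r \<bullet> s"
  shows "s - r \<in> R"
proof -
  have r: "r \<in> R" "s \<in> R" using assms by (auto simp: indep_def)
  from cartan_pos_cases(2)[OF assms] show ?thesis
  proof
    assume "cartan s r = 1" then show ?thesis using reflect[OF r] by simp
  next
    assume "cartan r s = 1"
    then have "r - s \<in> R" using reflect[OF r(2,1)] by simp
    then show ?thesis using uminus_closed[of "r - s"] by simp
  qed
qed

lemma add_in_R: "indep r s \<Longrightarrow> r \<bullet> s < 0 \<Longrightarrow> s + r \<in> R"
  using diff_in_R[of "- r" s] by simp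

text \<open>Since s + r is no root, r \<bullet> s \<ge> 0. A later root of the string would then
  have positive product with r, and \<open>diff_in_R\<close> would lead back down into the
  gap.\<close>

lemma string_unbroken:
  assumes "indep r s" "s + r \<notin> R" "1 \<le> k"
  shows "s + real k *\<^sub>R r \<notin> R"
  using assms(3)
proof (induction k rule: dec_induct)
  case base then show ?case using assms by simp
next
  case (step k)
  have rr: "0 < r \<bullet> r" using assms norm_pos by (auto simp: indep_def)
  have ge: "0 \<le> r \<bullet> s" using add_in_R assms by force
  show ?case
  proof
    assume *: "s + real (Suc k) *\<^sub>R r \<in> R"
    have "0 \<le> real (Suc k) * (r \<bullet> r)" using rr by simp
    moreover have "0 < real (Suc k) * (r \<bullet> r)" using rr by simp
    ultimately have "0 < r \<bullet> (s + real (Suc k) *\<^sub>R r)"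
      using ge unfolding inner_add_right inner_scaleR_right by linarith
    then have "s + real (Suc k) *\<^sub>R r - r \<in> R"
      using diff_in_R indep_shift[OF assms(1) *] by blast
    then show False using step.IH by (simp add: algebra_simps)
  qed
qed

text \<open>As strings have no gaps, this is the distance from s to the upper end of its r-string;
  by negation, \<open>up r (- s)\<close> is the distance to the lower end. Below these are called q
  and p.\<close>

definition up :: "'a \<Rightarrow> 'a \<Rightarrow> nat" where
  "up r s = card {k. 1 \<le> k \<and> s + real k *\<^sub>R r \<in> R}"

lemma finite_string:
  assumes "r \<in> R"
  shows "finite {k. 1 \<le> k \<and> s + real k *\<^sub>R r \<in> R}"
proof (rule finite_imageD)
  show "finite ((\<lambda>k. s + real k *\<^sub>R r) ` {k. 1 \<le> k \<and> s + real k *\<^sub>R r \<in> R})"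
    by (rule finite_subset[OF _ finite_R]) auto
  show "inj_on (\<lambda>k. s + real k *\<^sub>R r) {k. 1 \<le> k \<and> s + real k *\<^sub>R r \<in> R}"
    using nonzero[OF assms] by (auto simp: inj_on_def)
qed

lemma up_add:
  assumes "r \<in> R" "s + r \<in> R"
  shows "up r s = Suc (up r (s + r))"
proof -
  let ?A = "\<lambda>s. {k. 1 \<le> k \<and> s + real k *\<^sub>R r \<in> R}"
  have "?A s = insert 1 (Suc ` ?A (s + r))"
  proof (intro set_eqI iffI)
    fix k assume k: "k \<in> ?A s"
    show "k \<in> insert 1 (Suc ` ?A (s + r))"
    proof (cases "k = 1")
      case False
      then obtain j where "k = Suc j" "1 \<le> j" using k by (cases k) auto
      then show ?thesis using k by (auto simp: algebra_simps)
    qed simp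
  next
    fix k assume "k \<in> insert 1 (Suc ` ?A (s + r))"
    then show "k \<in> ?A s" using assms by (auto simp: algebra_simps)
  qed
  then have "card (?A s) = card (insert 1 (Suc ` ?A (s + r)))" by (rule arg_cong)
  also have "\<dots> = Suc (card (Suc ` ?A (s + r)))"
    using finite_string[OF assms(1), of "s + r"] by (intro card_insert_disjoint) auto
  also have "card (Suc ` ?A (s + r)) = card (?A (s + r))"
    by (rule card_image) simp
  finally show ?thesis unfolding up_def .
qed

lemma up_eq_0:
  assumes "indep r s" "s + r \<notin> R"
  shows "up r s = 0"
proof -
  have "{k. 1 \<le> k \<and> s + real k *\<^sub>R r \<in> R} = {}"
    using string_unbroken[OF assms] by auto
  then show ?thesis unfolding up_def by (metis card.empty)
qed

lemma up_pos_iff: "indep r s \<Longrightarrow> 0 < up r s \<longleftrightarrow> s + r \<in> R"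
  using up_eq_0 up_add by (metis indep_def less_numeral_extra(3) zero_less_Suc)

lemma up_uminus_add:
  assumes "indep r s"
  shows "up r (- (s + r)) = Suc (up r (- s))"
  using assms up_add[of r "- (s + r)"] by (simp add: indep_def uminus_iff)

text \<open>The reflection in r reverses the string, so it carries the top s to the bottom; the
  distance is the Cartan integer.\<close>

lemma up_uminus_top:
  assumes "indep r s" "s + r \<notin> R"
  shows "real (up r (- s)) = cartan s r"
proof -
  have r: "r \<in> R" "s \<in> R" using assms by (auto simp: indep_def)
  have "0 \<le> r \<bullet> s" using add_in_R assms by force
  then have "0 \<le> cartan s r" using norm_pos[OF r(1)] by (simp add: cartan_def inner_commute)
  then obtain m where m: "cartan s r = real m"
    using cartan_Ints[OF r] by (metis Ints_cases of_int_0_le_iff of_int_of_nat_eq zero_le_imp_eq_int)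
  have low: "s - real m *\<^sub>R r \<in> R" using reflect[OF r] m by simp
  \<comment> \<open>A root missing on the way down would, by \<open>string_unbroken\<close> for - r,
    exclude the bottom root \<open>low\<close>.\<close>
  have in_m: "s - real k *\<^sub>R r \<in> R" if "k \<le> m" for k
    using that
  proof (induction k)
    case (Suc k)
    have IH: "s - real k *\<^sub>R r \<in> R" using Suc by simp
    have ind: "indep (- r) (s - real k *\<^sub>R r)"
      using indep_shift[OF assms(1), of "- real k"] IH by simp
    show ?case
    proof (rule ccontr)
      assume "s - real (Suc k) *\<^sub>R r \<notin> R"
      then have "s - real k *\<^sub>R r + (- r) \<notin> R" by (simp add: algebra_simps)
      from string_unbroken[OF ind this, of "m - k"] Suc.prems
      have "s - real k *\<^sub>R r + real (m - k) *\<^sub>R (- r) \<notin> R" by simp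
      moreover have "s - real k *\<^sub>R r + real (m - k) *\<^sub>R (- r) = s - real m *\<^sub>R r"
        using Suc.prems by (simp add: of_nat_diff algebra_simps)
      ultimately show False using low by metis
    qed
  qed (use r in simp)
  have "{k. 1 \<le> k \<and> - s + real k *\<^sub>R r \<in> R} = {1..m}"
  proof (intro set_eqI iffI)
    fix k assume k: "k \<in> {k. 1 \<le> k \<and> - s + real k *\<^sub>R r \<in> R}"
    then have "s - real k *\<^sub>R r \<in> R" using uminus_closed[of "- s + real k *\<^sub>R r"] by simp
    \<comment> \<open>The reflection sends s - k r to s + (k - m) r, which would lie above the top
      if k > m.\<close>
    then have "s - real k *\<^sub>R r - cartan (s - real k *\<^sub>R r) r *\<^sub>R r \<in> R" using reflect r by blast
    moreover have "cartan (s - real k *\<^sub>R r) r = real m - 2 * real k"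
      using norm_pos[OF r(1)] m by (simp add: cartan_def inner_diff_left field_simps)
    moreover have "s - real k *\<^sub>R r - (real m - 2 * real k) *\<^sub>R r = s + (real k - real m) *\<^sub>R r"
    proof -
      have "s - a *\<^sub>R r - b *\<^sub>R r = s + (- a - b) *\<^sub>R r" for a b :: real
        by (simp add: scaleR_left_diff_distrib)
      then show ?thesis by simp
    qed
    ultimately have "s + (real k - real m) *\<^sub>R r \<in> R" by metis
    then have "k \<le> m" using string_unbroken[OF assms, of "k - m"]
      by (metis One_nat_def Suc_leI less_imp_le_nat linorder_not_less of_nat_diff zero_less_diff)
    then show "k \<in> {1..m}" using k by simp
  next
    fix k assume "k \<in> {1..m}"
    then show "k \<in> {k. 1 \<le> k \<and> - s + real k *\<^sub>R r \<in> R}"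
      using uminus_closed[OF in_m[of k]] by (auto simp: algebra_simps)
  qed
  then have "up r (- s) = m" unfolding up_def by simp
  then show ?thesis using m by simp
qed

text \<open>At the top this is \<open>up_uminus_top\<close>. A step up raises p by one, lowers q by
  one and raises the Cartan integer by two.\<close>

lemma up_diff: "indep r s \<Longrightarrow> real (up r (- s)) - real (up r s) = cartan s r"
proof (induction "up r s" arbitrary: s)
  case 0
  then have "s + r \<notin> R" using up_pos_iff[of r s] by simp
  then show ?case using up_uminus_top[of r s] 0 by simp
next
  case (Suc k)
  then have sr: "s + r \<in> R" using up_pos_iff[of r s] by simp
  have r: "r \<in> R" using Suc.prems by (simp add: indep_def)
  have "up r s = Suc (up r (s + r))" using up_add r sr by blast
  moreover from this have "k = up r (s + r)" using Suc.hyps by simp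
  moreover note Suc.hyps(1)[OF this indep_add[OF Suc.prems sr]]
  moreover have "cartan (s + r) r = cartan s r + 2"
    using norm_pos[OF r] by (simp add: cartan_def inner_add_left field_simps)
  ultimately show ?case using up_uminus_add[OF Suc.prems] by simp
qed

text \<open>The length p + q is constant along a string, and at the top it is a Cartan
  integer.\<close>

lemma up_sum_le_3: "indep r s \<Longrightarrow> up r (- s) + up r s \<le> 3"
proof (induction "up r s" arbitrary: s)
  case 0
  then have nin: "s + r \<notin> R" using up_pos_iff[of r s] by simp
  have top: "real (up r (- s)) = cartan s r" using up_uminus_top[OF 0(2) nin] .
  have "cartan s r \<le> 3"
  proof (cases "0 < r \<bullet> s")
    case True then show ?thesis using cartan_pos_cases 0 by blast
  next
    case False
    then have "2 * (s \<bullet> r) / (r \<bullet> r) \<le> 0"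
      by (intro divide_nonpos_nonneg) (auto simp: inner_commute)
    then show ?thesis by (simp add: cartan_def)
  qed
  then show ?case using top 0 by linarith
next
  case (Suc k)
  then have sr: "s + r \<in> R" using up_pos_iff[of r s] by simp
  have r: "r \<in> R" using Suc.prems by (simp add: indep_def)
  have "up r s = Suc (up r (s + r))" using up_add r sr by blast
  moreover from this have "k = up r (s + r)" using Suc.hyps by simp
  moreover note Suc.hyps(1)[OF this indep_add[OF Suc.prems sr]]
  ultimately show ?case using up_uminus_add[OF Suc.prems] by simp
qed

text \<open>Up to normalisation, the squared structure constants of the Lie algebra belonging to \<open>R\<close>.\<close>

definition strc :: "'a \<Rightarrow> 'a \<Rightarrow> real" where
  "strc r s = (r \<bullet> r) * real (up r s) * (real (up r (- s)) + 1) / 2"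

text \<open>With p and q the distances to the two ends, p (q + 1) - q (p + 1) = p - q, which is the
  Cartan integer.\<close>

lemma strc_diff: "indep r s \<Longrightarrow> strc r (- s) - strc r s = r \<bullet> s"
proof -
  assume i: "indep r s"
  then have "r \<bullet> r > 0" using norm_pos by (auto simp: indep_def)
  then have "r \<bullet> s = (r \<bullet> r) * (real (up r (- s)) - real (up r s)) / 2"
    unfolding up_diff[OF i] by (simp add: cartan_def inner_commute)
  then show ?thesis by (simp add: strc_def field_simps)
qed

lemma strc_eq_0: "indep r s \<Longrightarrow> s + r \<notin> R \<Longrightarrow> strc r s = 0"
  using up_pos_iff[of r s] by (simp add: strc_def)

lemma indep_of_sum:
  assumes "r \<in> R" "s \<in> R" "s + r \<in> R"
  shows "indep r s"
proof -
  have "s \<noteq> r" using assms reduced[of r 2] by (auto simp: scaleR_2)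
  moreover have "s \<noteq> - r" using assms by auto
  ultimately show ?thesis using assms by (simp add: indep_def)
qed

text \<open>Passing from s to -(s + r) exchanges the factors q and p + 1.\<close>

lemma strc_third:
  assumes "r \<in> R" "s \<in> R" "s + r \<in> R"
  shows "strc r (- (s + r)) = strc r s"
proof -
  have i: "indep r s" using indep_of_sum assms by blast
  show ?thesis unfolding strc_def up_uminus_add[OF i] up_add[OF assms(1,3)]
    using up_add[OF assms(1,3)] by (simp add: add.commute)
qed

text \<open>Let p, q belong to the r-string through s and p', q' to the s-string through r. Both p =
  0 and p' = 0 say that r - s is no root, and then both sides equal - (r \<bullet> s). Otherwise p,
  q \<ge> 1 and p + q \<le> 3, so the sign of r \<bullet> s determines the pair; hence the two pairs
  agree, and r and s turn out to have the same length.\<close>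

lemma strc_sym:
  assumes "r \<in> R" "s \<in> R" "s + r \<in> R"
  shows "strc r s = strc s r"
proof -
  have i: "indep r s" using indep_of_sum assms by blast
  have i': "indep s r" using i indep_sym by blast
  note pos = norm_pos[OF assms(1)] norm_pos[OF assms(2)]
  define p q p' q' where pq: "p = up r (- s)" "q = up r s" "p' = up s (- r)" "q' = up s r"
  have q: "1 \<le> q" "1 \<le> q'" using up_pos_iff[OF i] up_pos_iff[OF i'] assms
    by (auto simp: pq add.commute Suc_le_eq)
  have le: "p + q \<le> 3" "p' + q' \<le> 3" using up_sum_le_3 i i' by (auto simp: pq)
  have p0: "p = 0 \<longleftrightarrow> p' = 0"
  proof -
    have "0 < p \<longleftrightarrow> - s + r \<in> R" "0 < p' \<longleftrightarrow> - r + s \<in> R"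
      using up_pos_iff[of r "- s"] up_pos_iff[of s "- r"] i i' by (auto simp: pq)
    moreover have "- s + r \<in> R \<longleftrightarrow> - r + s \<in> R" using uminus_iff[of "- s + r"] by simp
    ultimately show ?thesis by auto
  qed
  have e: "(real p - real q) * (r \<bullet> r) = 2 * (r \<bullet> s)" "(real p' - real q') * (s \<bullet> s) = 2 * (r \<bullet> s)"
    using up_diff[OF i] up_diff[OF i'] pos by (simp_all add: pq cartan_def inner_commute field_simps)
  \<comment> \<open>For p = q the relations \<open>e\<close> do not compare the lengths. Instead,
    the Cartan integer of r and s + r lies strictly between 0 and 2, so it is 1.\<close>
  have orth: "r \<bullet> r = s \<bullet> s" if "r \<bullet> s = 0"
  proof -
    let ?u = "s + r"
    obtain k where k: "cartan r ?u = of_int k" using cartan_Ints assms by (metis Ints_cases)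
    have uu: "?u \<bullet> ?u = r \<bullet> r + s \<bullet> s" "r \<bullet> ?u = r \<bullet> r" using that
      by (simp_all add: inner_add_left inner_add_right inner_commute)
    have c: "cartan r ?u * (r \<bullet> r + s \<bullet> s) = 2 * (r \<bullet> r)"
      using pos add_pos_pos[OF pos] unfolding cartan_def uu by simp
    have "0 < cartan r ?u" "cartan r ?u < 2" using pos add_pos_pos[OF pos] unfolding cartan_def uu by (simp_all add: divide_less_eq)
    then have "k = 1" unfolding k by linarith
    then show ?thesis using c k by simp
  qed
  have sgn: "p < q \<longleftrightarrow> p' < q'" "q < p \<longleftrightarrow> q' < p'"
  proof -
    have "real p < real q \<longleftrightarrow> r \<bullet> s < 0" "real q < real p \<longleftrightarrow> 0 < r \<bullet> s"
      using e(1) pos by (smt (verit) mult_less_0_iff zero_less_mult_iff)+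
    moreover have "real p' < real q' \<longleftrightarrow> r \<bullet> s < 0" "real q' < real p' \<longleftrightarrow> 0 < r \<bullet> s"
      using e(2) pos by (smt (verit) mult_less_0_iff zero_less_mult_iff)+
    ultimately show "p < q \<longleftrightarrow> p' < q'" "q < p \<longleftrightarrow> q' < p'" by auto
  qed
  show ?thesis
  proof (cases "p = 0")
    case True
    then show ?thesis using e p0 by (simp add: strc_def pq[symmetric] algebra_simps)
  next
    case False
    have eq: "p = p'" "q = q'" using False p0 q le sgn by auto
    have "r \<bullet> r = s \<bullet> s"
    proof (cases "p = q")
      case True then show ?thesis using orth e by simp
    next
      case False
      then have "real p - real q \<noteq> 0" by simp
      moreover have "(real p - real q) * (r \<bullet> r) = (real p - real q) * (s \<bullet> s)" using e eq by simp
      ultimately show ?thesis by (simp only: mult_cancel_left) simp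
    qed
    then show ?thesis by (simp add: strc_def pq[symmetric] eq)
  qed
qed

section \<open>Sums over the roots independent of a fixed root\<close>

definition others :: "'a \<Rightarrow> 'a set" where
  "others r = {s. indep r s}"

lemma finite_others [simp]: "finite (others r)"
  by (rule finite_subset[of _ R]) (auto simp: others_def indep_def)

lemma bij_uminus_others: "bij_betw uminus (others r) (others r)"
  by (rule bij_betw_byWitness[where f' = uminus]) (auto simp: others_def)

lemma sum_uminus_others: "(\<Sum>s\<in>others r. g (- s)) = (\<Sum>s\<in>others r. g s)"
  by (rule sum.reindex_bij_betw[OF bij_uminus_others])

text \<open>The sum over each \<open>r\<close>-string telescopes: with \<open>p\<close> and \<open>q\<close> the distances of \<open>s\<close> to the two
  ends, \<open>q (q - 1 - 2 p) = F p q - F (p - 1) (q + 1)\<close> for \<open>F p q = (p + 1) q (q - 1)\<close>.\<close>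

lemma sum_strc:
  assumes r: "r \<in> R"
  shows "(\<Sum>s\<in>others r. (r \<bullet> s)\<^sup>2 / (r \<bullet> r)) = (\<Sum>s\<in>others r. strc r s)"
proof -
  define p q where "p = (\<lambda>s. real (up r (- s)))" and "q = (\<lambda>s. real (up r s))"
  have pq_minus: "p (- s) = q s" "q (- s) = p s" for s by (simp_all add: p_def q_def)
  let ?A = "{s \<in> others r. s + r \<in> R}" and ?B = "{s \<in> others r. s - r \<in> R}"
  \<comment> \<open>A step up matches the roots that are not at the top with those not at the
    bottom. Both sums extend to \<open>others r\<close>, as q = 0 at the top and p = 0 at the
    bottom.\<close>
  have bij: "bij_betw (\<lambda>s. s + r) ?A ?B"
    using indep_add[of r] indep_shift[of r _ "-1"]
    by (intro bij_betw_byWitness[where f' = "\<lambda>s. s - r"]) (auto simp: others_def indep_def)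
  have "(\<Sum>s\<in>others r. (p s + 1) * q s * (q s - 1)) = (\<Sum>s\<in>?A. (p s + 1) * q s * (q s - 1))"
    by (intro sum.mono_neutral_right) (auto simp: others_def q_def up_eq_0 finite_others[unfolded others_def])
  also have "\<dots> = (\<Sum>s\<in>?A. p (s + r) * (q (s + r) + 1) * q (s + r))"
  proof (rule sum.cong[OF refl])
    fix s assume s: "s \<in> ?A"
    then have "indep r s" by (simp add: others_def)
    then have "p (s + r) = p s + 1" using up_uminus_add[of r s] by (simp add: p_def)
    moreover have "q s = q (s + r) + 1" using up_add[OF r, of s] s by (simp add: q_def)
    ultimately show "(p s + 1) * q s * (q s - 1) = p (s + r) * (q (s + r) + 1) * q (s + r)" by simp
  qed
  also have "\<dots> = (\<Sum>s\<in>?B. p s * (q s + 1) * q s)"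
    by (rule sum.reindex_bij_betw[OF bij])
  also have "\<dots> = (\<Sum>s\<in>others r. p s * (q s + 1) * q s)"
  proof (intro sum.mono_neutral_left)
    show "\<forall>i\<in>others r - ?B. p i * (q i + 1) * q i = 0"
    proof
      fix s assume s: "s \<in> others r - ?B"
      then have "- s + r \<notin> R" using uminus_iff[of "- s + r"] by simp
      then show "p s * (q s + 1) * q s = 0" using s by (simp add: p_def others_def up_eq_0)
    qed
  qed auto
  finally have tele: "(\<Sum>s\<in>others r. (p s + 1) * q s * (q s - 1)) = (\<Sum>s\<in>others r. p s * (q s + 1) * q s)" .
  have sq: "(\<Sum>s\<in>others r. (p s)\<^sup>2) = (\<Sum>s\<in>others r. (q s)\<^sup>2)"
    using sum_uminus_others[of "\<lambda>s. (p s)\<^sup>2" r] by (simp add: pq_minus)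
  \<comment> \<open>Termwise (p - q)^2 - 2 q (p + 1) = p^2 - q^2 + 2 q (q - 1 - 2 p): the squares
    cancel by \<open>sq\<close>, the rest telescopes by \<open>tele\<close>.\<close>
  have "(\<Sum>s\<in>others r. (p s - q s)\<^sup>2 - 2 * q s * (p s + 1)) =
      (\<Sum>s\<in>others r. (p s)\<^sup>2) - (\<Sum>s\<in>others r. (q s)\<^sup>2) +
      2 * ((\<Sum>s\<in>others r. (p s + 1) * q s * (q s - 1)) - (\<Sum>s\<in>others r. p s * (q s + 1) * q s))"
    unfolding sum_subtractf[symmetric] sum_distrib_left sum.distrib[symmetric]
    by (rule sum.cong) (auto simp: power2_eq_square algebra_simps)
  then have key: "(\<Sum>s\<in>others r. (p s - q s)\<^sup>2 - 2 * q s * (p s + 1)) = 0"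
    using tele sq by simp
  have "(\<Sum>s\<in>others r. (r \<bullet> s)\<^sup>2 / (r \<bullet> r)) - (\<Sum>s\<in>others r. strc r s) =
     (\<Sum>s\<in>others r. (r \<bullet> r) / 4 * ((p s - q s)\<^sup>2 - 2 * q s * (p s + 1)))"
    unfolding sum_subtractf[symmetric]
  proof (rule sum.cong[OF refl])
    fix s assume "s \<in> others r"
    then have "p s - q s = 2 * (r \<bullet> s) / (r \<bullet> r)"
      using up_diff[of r s] by (simp add: p_def q_def others_def cartan_def inner_commute)
    then have "r \<bullet> s = (r \<bullet> r) * (p s - q s) / 2" using norm_pos[OF r] by simp
    then show "(r \<bullet> s)\<^sup>2 / (r \<bullet> r) - strc r s = (r \<bullet> r) / 4 * ((p s - q s)\<^sup>2 - 2 * q s * (p s + 1))"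
    proof -
      have "strc r s = (r \<bullet> r) * q s * (p s + 1) / 2" by (simp add: strc_def p_def q_def)
      moreover have "(r \<bullet> s)\<^sup>2 / (r \<bullet> r) = (r \<bullet> r) * (p s - q s)\<^sup>2 / 4"
        unfolding \<open>r \<bullet> s = _\<close> using norm_pos[OF r] by (simp add: power2_eq_square)
      ultimately show ?thesis by (simp add: algebra_simps)
    qed
  qed
  also have "\<dots> = 0" unfolding sum_distrib_left[symmetric] key by simp
  finally show ?thesis by simp
qed

end

subsection \<open>The strange formula as an inequality\<close>

context root_sys
begin

text \<open>The eigenvalue at r of S x = \<Sum>s\<in>R. (x \<bullet> s) s, as
  \<open>eigval_eigen\<close> confirms; r \<bullet> s / \<open>eigval r\<close> is the dual form of
  the overview.\<close>

definition eigval :: "'a \<Rightarrow> real" where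
  "eigval r = (\<Sum>s\<in>R. (r \<bullet> s)\<^sup>2) / (r \<bullet> r)"

lemma eigval_pos: "r \<in> R \<Longrightarrow> 0 < eigval r"
  unfolding eigval_def using norm_pos[of r] sum_pos2[of R r "\<lambda>s. (r \<bullet> s)\<^sup>2"] by auto

lemma bij_reflect:
  assumes "r \<in> R"
  shows "bij_betw (\<lambda>s. s - cartan s r *\<^sub>R r) R R"
proof -
  have "s - cartan s r *\<^sub>R r - cartan (s - cartan s r *\<^sub>R r) r *\<^sub>R r = s" for s
    using norm_pos[OF assms] by (simp add: cartan_def inner_diff_left)
  then show ?thesis using reflect[OF assms]
    by (intro bij_betw_byWitness[where f' = "\<lambda>s. s - cartan s r *\<^sub>R r"]) auto
qed

text \<open>The operator \<open>x \<mapsto> \<Sum>s\<in>R. (x \<bullet> s) s\<close> commutes with the reflection in \<open>r\<close>, hence has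
  eigenvector \<open>r\<close>.\<close>

lemma eigval_eigen:
  assumes r: "r \<in> R"
  shows "(\<Sum>s\<in>R. (r \<bullet> s) *\<^sub>R s) = eigval r *\<^sub>R r"
proof -
  let ?S = "\<Sum>s\<in>R. (r \<bullet> s) *\<^sub>R s"
  have "?S = (\<Sum>s\<in>R. (r \<bullet> (s - cartan s r *\<^sub>R r)) *\<^sub>R (s - cartan s r *\<^sub>R r))"
    by (rule sum.reindex_bij_betw[OF bij_reflect[OF r], symmetric])
  also have "\<dots> = (\<Sum>s\<in>R. (r \<bullet> s * cartan s r) *\<^sub>R r - (r \<bullet> s) *\<^sub>R s)"
    using norm_pos[OF r] by (intro sum.cong) (auto simp: cartan_def inner_diff_right inner_commute scaleR_right_diff_distrib)
  also have "\<dots> = (\<Sum>s\<in>R. r \<bullet> s * cartan s r) *\<^sub>R r - ?S"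
    by (simp add: sum_subtractf scaleR_left.sum)
  also have "(\<Sum>s\<in>R. r \<bullet> s * cartan s r) = 2 * eigval r"
    by (simp add: eigval_def cartan_def sum_divide_distrib sum_distrib_left power2_eq_square inner_commute mult_ac)
  finally have "2 *\<^sub>R ?S = 2 *\<^sub>R (eigval r *\<^sub>R r)" by (simp add: scaleR_2 algebra_simps)
  then show ?thesis by (simp only: scaleR_cancel_left) simp
qed

text \<open>Eigenvectors of a symmetric operator to different eigenvalues are orthogonal.\<close>

lemma eigval_eq:
  assumes "r \<in> R" "s \<in> R" "r \<bullet> s \<noteq> 0"
  shows "eigval r = eigval s"
proof -
  have "eigval r * (r \<bullet> s) = (\<Sum>u\<in>R. (r \<bullet> u) *\<^sub>R u) \<bullet> s" using eigval_eigen assms by simp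
  also have "\<dots> = r \<bullet> (\<Sum>u\<in>R. (s \<bullet> u) *\<^sub>R u)"
    by (simp add: inner_sum_left inner_sum_right inner_commute mult.commute)
  also have "\<dots> = eigval s * (r \<bullet> s)" using eigval_eigen assms by simp
  finally show ?thesis using assms by simp
qed

text \<open>If r and s are orthogonal, then s + r is orthogonal to neither and links their
  eigenvalues.\<close>

lemma eigval_eq_add:
  assumes "r \<in> R" "s \<in> R" "s + r \<in> R"
  shows "eigval r = eigval s"
proof (cases "r \<bullet> s = 0")
  case True
  then have "r \<bullet> (s + r) \<noteq> 0" "s \<bullet> (s + r) \<noteq> 0"
    using nonzero assms by (auto simp: inner_add_right inner_commute)
  then show ?thesis using eigval_eq[of r "s + r"] eigval_eq[of s "s + r"] assms by simp
qed (use eigval_eq assms in blast)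

text \<open>Dividing each s \<otimes> s by the eigenvalue at s turns S into the identity on the
  span. Its trace is the dimension, and also the sum over the roots.\<close>

lemma trace_eq_dim: "(\<Sum>r\<in>R. (r \<bullet> r) / eigval r) = real (dim R)"
proof -
  obtain B where B: "B \<subseteq> span R" "pairwise orthogonal B" "\<And>x. x \<in> B \<Longrightarrow> norm x = 1"
    "independent B" "card B = dim (span R)" "span B = span R"
    using orthonormal_basis_subspace[of "span R"] by auto
  have fB: "finite B" using B(4) independent_imp_finite by blast
  define T where "T = (\<lambda>x. \<Sum>s\<in>R. ((x \<bullet> s) / eigval s) *\<^sub>R s)"
  have linT: "linear T"
    unfolding T_def by (intro linearI) (simp_all add: inner_add_left add_divide_distrib scaleR_left_distrib sum.distrib scaleR_sum_right)
  have "T r = id r" if "r \<in> R" for r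
  proof -
    \<comment> \<open>Terms with r \<bullet> s = 0 vanish; in the others the eigenvalue at s is the
      one at r.\<close>
    have "T r = (\<Sum>s\<in>R. (1 / eigval r) *\<^sub>R ((r \<bullet> s) *\<^sub>R s))"
      unfolding T_def by (rule sum.cong) (use eigval_eq[OF that] in \<open>force+\<close>)
    also have "\<dots> = r" unfolding scaleR_sum_right[symmetric] eigval_eigen[OF that] using eigval_pos[OF that] by simp
    finally show ?thesis by simp
  qed
  then have T_id: "T x = x" if "x \<in> span R" for x
    using linear_eq_on[OF linT linear_id that] by simp
  have parseval: "(\<Sum>b\<in>B. (b \<bullet> r)\<^sup>2) = r \<bullet> r" if "r \<in> R" for r
  proof -
    have "r \<in> span B" using that B(6) by (simp add: span_base)
    then have "r = (\<Sum>b\<in>B. (b \<bullet> r) *\<^sub>R b)"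
      using orthonormal_basis_expand[of B r] B fB by (simp add: pairwise_def inner_commute)
    then have "r \<bullet> r = r \<bullet> (\<Sum>b\<in>B. (b \<bullet> r) *\<^sub>R b)" by simp
    then show ?thesis by (simp add: inner_sum_right power2_eq_square inner_commute)
  qed
  have "real (dim R) = (\<Sum>b\<in>B. b \<bullet> b)"
    using B(3,5) by (simp add: dot_square_norm)
  also have "\<dots> = (\<Sum>b\<in>B. b \<bullet> T b)" using B(1) T_id by (intro sum.cong) auto
  also have "\<dots> = (\<Sum>b\<in>B. \<Sum>r\<in>R. (b \<bullet> r)\<^sup>2 / eigval r)"
    unfolding T_def by (simp add: inner_sum_right power2_eq_square)
  also have "\<dots> = (\<Sum>r\<in>R. (\<Sum>b\<in>B. (b \<bullet> r)\<^sup>2) / eigval r)"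
    by (subst sum.swap) (simp add: sum_divide_distrib)
  also have "\<dots> = (\<Sum>r\<in>R. (r \<bullet> r) / eigval r)" using parseval by simp
  finally show ?thesis by simp
qed

text \<open>The pair (r, s) stands for the ordered triple r, s, -(s + r) of roots with sum 0.
  \<open>sum_triples_swap\<close> and \<open>sum_triples_third\<close> use two transpositions, which
  generate all permutations of the triple.\<close>

definition triples :: "('a \<times> 'a) set" where
  "triples = {(r, s). r \<in> R \<and> s \<in> R \<and> s + r \<in> R}"

lemma triples_Sigma: "triples = Sigma R (\<lambda>r. {s \<in> others r. s + r \<in> R})"
  using indep_of_sum by (auto simp: triples_def others_def indep_def)

lemma sum_triples:
  "(\<Sum>(r, s)\<in>triples. strc r s / eigval r * g r s) = (\<Sum>r\<in>R. \<Sum>s\<in>others r. strc r s / eigval r * g r s)"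
proof -
  have "(\<Sum>(r, s)\<in>triples. strc r s / eigval r * g r s) =
      (\<Sum>r\<in>R. \<Sum>s\<in>{s \<in> others r. s + r \<in> R}. strc r s / eigval r * g r s)"
    unfolding triples_Sigma by (subst sum.Sigma) auto
  also have "\<dots> = (\<Sum>r\<in>R. \<Sum>s\<in>others r. strc r s / eigval r * g r s)"
    by (rule sum.cong[OF refl], rule sum.mono_neutral_left) (auto simp: others_def strc_eq_0 finite_others[unfolded others_def])
  finally show ?thesis .
qed

lemma sum_triples_swap:
  "(\<Sum>(r, s)\<in>triples. strc r s / eigval r * g r s) = (\<Sum>(r, s)\<in>triples. strc r s / eigval r * g s r)"
proof -
  have bij: "bij_betw (\<lambda>(r, s). (s, r)) triples triples"
    by (rule bij_betw_byWitness[where f' = "\<lambda>(r, s). (s, r)"]) (auto simp: triples_def add.commute)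
  have "(\<Sum>(r, s)\<in>triples. strc r s / eigval r * g r s) = (\<Sum>(r, s)\<in>triples. strc s r / eigval s * g s r)"
    using sum.reindex_bij_betw[OF bij, of "\<lambda>(r, s). strc r s / eigval r * g r s"] by (simp add: case_prod_unfold)
  also have "\<dots> = (\<Sum>(r, s)\<in>triples. strc r s / eigval r * g s r)"
  proof (rule sum.cong[OF refl], clarify)
    fix r s assume "(r, s) \<in> triples"
    then have "strc r s = strc s r" "eigval r = eigval s" using strc_sym eigval_eq_add by (auto simp: triples_def)
    then show "strc s r / eigval s * g s r = strc r s / eigval r * g s r" by simp
  qed
  finally show ?thesis .
qed

lemma sum_triples_third:
  "(\<Sum>(r, s)\<in>triples. strc r s / eigval r * g r s) = (\<Sum>(r, s)\<in>triples. strc r s / eigval r * g r (- (s + r)))"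
proof -
  have uminus_in: "- s - r \<in> R" if "s + r \<in> R" for r s
    using uminus_closed[OF that] by simp
  have bij: "bij_betw (\<lambda>(r, s). (r, - (s + r))) triples triples"
    by (rule bij_betw_byWitness[where f' = "\<lambda>(r, s). (r, - (s + r))"])
      (auto simp: triples_def uminus_iff uminus_in)
  have "(\<Sum>(r, s)\<in>triples. strc r s / eigval r * g r s) =
      (\<Sum>(r, s)\<in>triples. strc r (- (s + r)) / eigval r * g r (- (s + r)))"
    using sum.reindex_bij_betw[OF bij, of "\<lambda>(r, s). strc r s / eigval r * g r s"] by (simp add: case_prod_unfold)
  also have "\<dots> = (\<Sum>(r, s)\<in>triples. strc r s / eigval r * g r (- (s + r)))"
    using strc_third by (intro sum.cong) (auto simp: triples_def)
  finally show ?thesis .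
qed

text \<open>For \<open>v\<close> the vector of sawtooth values of a point this is the strange formula of Freudenthal and
  de Vries in the form of an inequality; equality holds for the points with \<open>u = 0\<close> below.\<close>

lemma strange_inequality:
  fixes v :: "'a \<Rightarrow> real"
  assumes odd: "\<And>r. r \<in> R \<Longrightarrow> v (- r) = - v r"
    and tri: "\<And>r s. r \<in> R \<Longrightarrow> s \<in> R \<Longrightarrow> s + r \<in> R \<Longrightarrow> \<bar>v r + v s + v (- (s + r))\<bar> = 1 / 2"
  shows "(\<Sum>r\<in>R. (v r)\<^sup>2) \<ge> (real (card R) - 2 * real (dim R)) / 12"
proof -
  define u where "u = (\<Sum>s\<in>R. (v s / eigval s) *\<^sub>R s)"
  define c where "c = (\<lambda>r s. strc r s / eigval r)"
  have split: "(\<Sum>s\<in>R. g s) = g r + g (- r) + (\<Sum>s\<in>others r. g s)" if "r \<in> R" for r and g :: "'a \<Rightarrow> real"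
  proof -
    have R: "R = insert r (insert (- r) (others r))"
      using that uminus_closed by (auto simp: others_def indep_def)
    have "r \<noteq> - r" using nonzero[OF that] by (metis add_eq_0_iff2 scaleR_2 scaleR_eq_0_iff zero_neq_numeral)
    then show ?thesis by (subst R) (auto simp: others_def indep_def)
  qed
  \<comment> \<open>The square length in the dual form: \<open>u\<close> solves S u = \<Sum> v_s s,
    and the double sum is u \<bullet> S u, a sum of squares.\<close>
  have pos: "0 \<le> (\<Sum>r\<in>R. \<Sum>s\<in>R. v r * v s * (r \<bullet> s) / eigval r)"
  proof -
    have "(\<Sum>r\<in>R. \<Sum>s\<in>R. v r * v s * (r \<bullet> s) / eigval r) = u \<bullet> (\<Sum>s\<in>R. v s *\<^sub>R s)"
      by (subst sum.swap) (simp add: u_def inner_sum_left inner_sum_right sum_distrib_left sum_distrib_right mult_ac)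
    also have "(\<Sum>s\<in>R. v s *\<^sub>R s) = (\<Sum>s\<in>R. (v s / eigval s) *\<^sub>R (\<Sum>r\<in>R. (s \<bullet> r) *\<^sub>R r))"
    proof (rule sum.cong[OF refl])
      fix s assume s: "s \<in> R"
      show "v s *\<^sub>R s = (v s / eigval s) *\<^sub>R (\<Sum>r\<in>R. (s \<bullet> r) *\<^sub>R r)"
        unfolding eigval_eigen[OF s] using eigval_pos[OF s] by simp
    qed
    also have "\<dots> = (\<Sum>r\<in>R. (u \<bullet> r) *\<^sub>R r)"
      unfolding u_def by (simp add: inner_sum_left scaleR_sum_right scaleR_left.sum)
        (rule sum.swap)
    also have "u \<bullet> \<dots> = (\<Sum>r\<in>R. (u \<bullet> r)\<^sup>2)"
      by (simp add: inner_sum_right power2_eq_square)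
    finally show ?thesis by (simp add: sum_nonneg)
  qed
  have self: "(\<Sum>s\<in>R. (r \<bullet> s)\<^sup>2 / (r \<bullet> r)) / eigval r = 1" if "r \<in> R" for r
    proof -
    have "(\<Sum>s\<in>R. (r \<bullet> s)\<^sup>2 / (r \<bullet> r)) = eigval r" by (simp add: eigval_def sum_divide_distrib)
    then show ?thesis using eigval_pos[OF that] by simp
  qed
  \<comment> \<open>The definition of \<open>eigval\<close> normalised to 1: r and - r give the
    first term, and \<open>sum_strc\<close> rewrites the rest in structure constants.\<close>
  have one: "1 = 2 * ((r \<bullet> r) / eigval r) + (\<Sum>s\<in>others r. c r s)" if "r \<in> R" for r
  proof -
    have "1 = (\<Sum>s\<in>R. (r \<bullet> s)\<^sup>2 / (r \<bullet> r)) / eigval r" using self[OF that] by simp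
    also have "\<dots> = 2 * ((r \<bullet> r) / eigval r) + (\<Sum>s\<in>others r. (r \<bullet> s)\<^sup>2 / (r \<bullet> r)) / eigval r"
      unfolding split[OF that] using norm_pos[OF that] by (simp add: power2_eq_square add_divide_distrib)
    finally show ?thesis unfolding sum_strc[OF that] c_def sum_divide_distrib .
  qed
  \<comment> \<open>Summed over all r, the diagonal terms of \<open>one\<close> give twice the
    dimension.\<close>
  have "real (card R) = (\<Sum>r\<in>R. 1)" by simp
  also have "\<dots> = (\<Sum>r\<in>R. 2 * ((r \<bullet> r) / eigval r) + (\<Sum>s\<in>others r. c r s))"
    by (rule sum.cong[OF refl one])
  finally have count: "(\<Sum>r\<in>R. \<Sum>s\<in>others r. c r s * 1) = real (card R) - 2 * real (dim R)"
    unfolding sum.distrib sum_distrib_left[symmetric] trace_eq_dim by simp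
  \<comment> \<open>For independent roots r \<bullet> s is the difference of
    \<open>strc r (- s)\<close> and \<open>strc r s\<close>; as v is odd, both parts contribute the
    same after s \<mapsto> - s.\<close>
  have inner: "(\<Sum>s\<in>R. v r * v s * (r \<bullet> s) / eigval r) =
      2 * ((r \<bullet> r) / eigval r) * (v r)\<^sup>2 - 2 * (\<Sum>s\<in>others r. c r s * (v r * v s))" if r: "r \<in> R" for r
  proof -
    have "(\<Sum>s\<in>others r. v r * v s * (r \<bullet> s) / eigval r) =
        (\<Sum>s\<in>others r. strc r (- s) / eigval r * (v r * v s)) - (\<Sum>s\<in>others r. c r s * (v r * v s))"
      unfolding sum_subtractf[symmetric]
    proof (rule sum.cong[OF refl])
      fix s assume "s \<in> others r"
      then have "r \<bullet> s = strc r (- s) - strc r s" using strc_diff by (simp add: others_def)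
      then show "v r * v s * (r \<bullet> s) / eigval r = strc r (- s) / eigval r * (v r * v s) - c r s * (v r * v s)"
        by (simp only: c_def) (simp add: diff_divide_distrib algebra_simps)
    qed
    also have "(\<Sum>s\<in>others r. strc r (- s) / eigval r * (v r * v s)) = (\<Sum>s\<in>others r. - (c r (- s) * (v r * v (- s))))"
      by (rule sum.cong) (auto simp: c_def odd others_def indep_def)
    also have "\<dots> = - (\<Sum>s\<in>others r. c r s * (v r * v s))"
      unfolding sum_negf sum_uminus_others[of "\<lambda>s. c r s * (v r * v s)"] ..
    finally show ?thesis unfolding split[OF r] using odd[OF r] by (simp add: power2_eq_square)
  qed
  \<comment> \<open>Multiplying \<open>one\<close> by the square of v r produces the diagonal term
    that cancels the one in \<open>inner\<close>.\<close>
  have "(v r)\<^sup>2 - (\<Sum>s\<in>R. v r * v s * (r \<bullet> s) / eigval r) =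
      (\<Sum>s\<in>others r. c r s * ((v r)\<^sup>2 + 2 * (v r * v s)))" if r: "r \<in> R" for r
  proof -
    have "(v r)\<^sup>2 = (v r)\<^sup>2 * 1" by simp
    also have "\<dots> = 2 * ((r \<bullet> r) / eigval r) * (v r)\<^sup>2 + (\<Sum>s\<in>others r. c r s * (v r)\<^sup>2)"
      by (subst one[OF r]) (simp add: distrib_left sum_distrib_left sum_distrib_right mult_ac)
    finally show ?thesis unfolding inner[OF r]
      by (simp add: sum.distrib sum_distrib_left distrib_left mult_ac)
  qed
  then have "(\<Sum>r\<in>R. (v r)\<^sup>2) - (\<Sum>r\<in>R. \<Sum>s\<in>R. v r * v s * (r \<bullet> s) / eigval r) =
      (\<Sum>r\<in>R. \<Sum>s\<in>others r. c r s * ((v r)\<^sup>2 + 2 * (v r * v s)))"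
    unfolding sum_subtractf[symmetric] by (intro sum.cong) auto
  also have "\<dots> = (\<Sum>(r, s)\<in>triples. c r s * ((v r)\<^sup>2 + 2 * (v r * v s)))" (is "_ = ?E")
    unfolding c_def by (rule sum_triples[symmetric])
  also have "\<dots> = (\<Sum>r\<in>R. \<Sum>s\<in>others r. c r s * 1) / 12"
  proof -
    let ?t = "\<lambda>r s. - (s + r)"
    let ?g = "\<lambda>r s. (v r)\<^sup>2 + 2 * (v r * v s)"
    \<comment> \<open>The weight is symmetric in the triple r, s, t, so (s, t) or (t, r) may replace
      (r, s) in the summand; the three versions add up to c (v_r + v_s + v_t)^2.\<close>
    have sym: "?E = (\<Sum>(r, s)\<in>triples. c r s * ?g s (?t r s))" "?E = (\<Sum>(r, s)\<in>triples. c r s * ?g (?t r s) r)"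
    proof -
      have "?E = (\<Sum>(r, s)\<in>triples. c r s * ?g r (?t r s))"
        unfolding c_def by (rule sum_triples_third[of ?g])
      also have "\<dots> = (\<Sum>(r, s)\<in>triples. c r s * ?g s (?t r s))"
        unfolding c_def by (subst sum_triples_swap) (simp add: add.commute)
      finally show "?E = \<dots>" .
      have "?E = (\<Sum>(r, s)\<in>triples. c r s * ?g s r)"
        unfolding c_def by (rule sum_triples_swap[of ?g])
      also have "\<dots> = (\<Sum>(r, s)\<in>triples. c r s * ?g (?t r s) r)"
        unfolding c_def by (rule sum_triples_third[of "\<lambda>r s. ?g s r"])
      finally show "?E = \<dots>" .
    qed
    have "3 * ?E = (\<Sum>(r, s)\<in>triples. c r s * (v r + v s + v (?t r s))\<^sup>2)"
    proof -
      have "3 * ?E = ?E + (\<Sum>(r, s)\<in>triples. c r s * ?g s (?t r s)) + (\<Sum>(r, s)\<in>triples. c r s * ?g (?t r s) r)"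
        unfolding sym[symmetric] by simp
      also have "\<dots> = (\<Sum>(r, s)\<in>triples. c r s * (v r + v s + v (?t r s))\<^sup>2)"
        unfolding sum.distrib[symmetric] by (rule sum.cong) (auto simp: power2_eq_square algebra_simps)
      finally show ?thesis .
    qed
    also have "\<dots> = (\<Sum>(r, s)\<in>triples. c r s * (1 / 4))"
    proof (rule sum.cong[OF refl], clarify)
      fix r s assume "(r, s) \<in> triples"
      then have "\<bar>v r + v s + v (?t r s)\<bar> = 1 / 2"
        by (intro tri) (auto simp: triples_def)
      then have "(v r + v s + v (?t r s))\<^sup>2 = (1 / 2)\<^sup>2" by (metis power2_abs)
      then show "c r s * (v r + v s + v (?t r s))\<^sup>2 = c r s * (1 / 4)"
        by (simp only:) (simp add: power2_eq_square)
    qed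
    also have "\<dots> = (\<Sum>r\<in>R. \<Sum>s\<in>others r. c r s * (1 / 4))"
      unfolding c_def by (rule sum_triples)
    finally show ?thesis by (simp add: sum_divide_distrib[symmetric])
  qed
  finally show ?thesis using pos count by simp
qed

end

subsection \<open>Positive systems\<close>

text \<open>The half odd integer nearest to a is \<lfloor>a\<rfloor> + 1/2.\<close>

lemma half_odd_dist_ge:
  fixes a :: real and k :: int
  assumes "odd k"
  shows "(of_int k / 2 - a)\<^sup>2 \<ge> (frac a - 1 / 2)\<^sup>2"
proof -
  obtain j where j: "k = 2 * j + 1" using assms by (auto elim: oddE)
  define m where "m = \<lfloor>a\<rfloor> - j"
  have e: "of_int k / 2 - a = - (of_int m + (frac a - 1 / 2))"
    by (simp add: j m_def frac_def field_simps)
  have u: "0 \<le> frac a" "frac a < 1" by (simp_all add: frac_lt_1)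
  have "\<bar>frac a - 1 / 2\<bar> \<le> \<bar>of_int m + (frac a - 1 / 2)\<bar>"
  proof (cases "m = 0")
    case False
    then have "\<bar>of_int m :: real\<bar> \<ge> 1" by linarith
    then show ?thesis using u by linarith
  qed simp
  then show ?thesis unfolding e power2_minus by (simp add: abs_le_square_iff)
qed

locale pos_root_sys = root_sys R for R :: "'a::euclidean_space set" +
  fixes P :: "'a set" and f :: "'n::finite \<Rightarrow> 'a" and \<gamma> :: "'a \<Rightarrow> 'n \<Rightarrow> nat"
  assumes positive_system: "positive_system R P"
    and simple: "bij_betw f UNIV (simple_roots P)"
    and coeffs: "\<And>r. r \<in> P \<Longrightarrow> r = (\<Sum>i\<in>UNIV. real (\<gamma> r i) *\<^sub>R f i)"
begin

section \<open>Positive roots and the basis of simple roots\<close>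

definition height :: 'a where
  "height = (SOME v. (\<forall>\<alpha>\<in>R. v \<bullet> \<alpha> \<noteq> 0) \<and> P = {\<alpha>\<in>R. v \<bullet> \<alpha> > 0})"

lemma height: "\<alpha> \<in> R \<Longrightarrow> height \<bullet> \<alpha> \<noteq> 0" "P = {\<alpha>\<in>R. height \<bullet> \<alpha> > 0}"
  using someI_ex[OF positive_system[unfolded positive_system_def]] unfolding height_def by blast+

lemma P_iff: "r \<in> P \<longleftrightarrow> r \<in> R \<and> 0 < height \<bullet> r"
  using height(2) by blast

lemma P_subset: "P \<subseteq> R"
  using height(2) by blast

lemma finite_P [simp]: "finite P"
  using finite_subset[OF P_subset] by simp

lemma P_pos: "r \<in> P \<Longrightarrow> 0 < height \<bullet> r"
  using height(2) by blast

lemma uminus_P: "r \<in> P \<Longrightarrow> - r \<notin> P"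
  using P_pos[of r] P_pos[of "- r"] by auto

lemma R_cases: "r \<in> R \<Longrightarrow> r \<in> P \<or> - r \<in> P"
  using height(1)[of r] uminus_closed[of r] by (auto simp: P_iff)

lemma R_eq: "R = P \<union> uminus ` P"
proof
  show "R \<subseteq> P \<union> uminus ` P" using R_cases by (force simp: image_iff)
  show "P \<union> uminus ` P \<subseteq> R" using P_subset uminus_closed by auto
qed

lemma disjoint_P: "P \<inter> uminus ` P = {}"
  using uminus_P by fastforce

lemma sum_R: "(\<Sum>r\<in>R. g r) = (\<Sum>r\<in>P. g r + g (- r))"
proof -
  have "(\<Sum>r\<in>R. g r) = (\<Sum>r\<in>P. g r) + (\<Sum>r\<in>uminus ` P. g r)"
    unfolding R_eq by (rule sum.union_disjoint) (use disjoint_P in auto)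
  then show ?thesis by (simp add: sum.distrib sum.reindex)
qed

lemma card_R: "card R = 2 * card P"
  using sum_R[of "\<lambda>_. 1::nat"] by simp

lemma f_in_P: "f i \<in> P"
  using simple by (auto simp: bij_betw_def simple_roots_def)

lemma f_simple: "\<beta> \<in> P \<Longrightarrow> \<delta> \<in> P \<Longrightarrow> f i \<noteq> \<beta> + \<delta>"
proof -
  have "f i \<in> simple_roots P" using simple by (auto simp: bij_betw_def)
  then show "\<beta> \<in> P \<Longrightarrow> \<delta> \<in> P \<Longrightarrow> f i \<noteq> \<beta> + \<delta>" unfolding simple_roots_def by blast
qed

lemma inj_f: "f i = f j \<longleftrightarrow> i = j"
  using simple by (auto simp: bij_betw_def inj_eq)

text \<open>Otherwise the difference of two simple roots would be a root, positive or negative, and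
  one of the two would be decomposable.\<close>

lemma obtuse:
  assumes "i \<noteq> j"
  shows "f i \<bullet> f j \<le> 0"
proof (rule ccontr)
  assume "\<not> f i \<bullet> f j \<le> 0"
  moreover have "indep (f i) (f j)"
    using f_in_P P_subset assms inj_f uminus_P[OF f_in_P[of i]] by (auto simp: indep_def) (metis f_in_P)
  ultimately have "f j - f i \<in> R" using diff_in_R[of "f i" "f j"] by auto
  then have "f j - f i \<in> P \<or> f i - f j \<in> P" using R_cases by fastforce
  then show False
    using f_simple[of "f j - f i" "f i" j] f_simple[of "f i - f j" "f j" i] f_in_P by auto
qed

text \<open>Vectors on one side of a hyperplane with pairwise non-acute angles are independent: the
  positive and the negative part of a relation are the same vector u, the angles force u = 0, and
  \<open>height\<close> is positive on every \<open>f i\<close>.\<close>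

lemma f_independent:
  assumes "(\<Sum>i\<in>UNIV. c i *\<^sub>R f i) = 0"
  shows "c i = 0"
proof -
  define u where "u = (\<Sum>i\<in>UNIV. max (c i) 0 *\<^sub>R f i)"
  have u': "u = (\<Sum>i\<in>UNIV. max (- c i) 0 *\<^sub>R f i)"
  proof -
    have "u - (\<Sum>i\<in>UNIV. max (- c i) 0 *\<^sub>R f i) = (\<Sum>i\<in>UNIV. c i *\<^sub>R f i)"
      unfolding u_def sum_subtractf[symmetric]
      by (rule sum.cong) (auto simp: max_def simp flip: scaleR_left_diff_distrib)
    then show ?thesis using assms by simp
  qed
  \<comment> \<open>One factor is written with positive parts, the other with negative parts, so the
    diagonal terms vanish.\<close>
  have "u \<bullet> u = (\<Sum>i\<in>UNIV. \<Sum>j\<in>UNIV. max (c i) 0 * max (- c j) 0 * (f i \<bullet> f j))"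
    by (subst (2) u', subst u_def) (simp add: inner_sum_left inner_sum_right sum_distrib_left mult_ac, rule sum.swap)
  also have "\<dots> \<le> 0"
  proof (intro sum_nonpos)
    fix i j show "max (c i) 0 * max (- c j) 0 * (f i \<bullet> f j) \<le> 0"
    proof (cases "i = j")
      case True then show ?thesis by (simp add: max_def)
    next
      case False then show ?thesis using obtuse by (intro mult_nonneg_nonpos) auto
    qed
  qed
  finally have "u = 0" by (simp add: inner_gt_zero_iff not_less[symmetric] del: not_less)
  have "max (d i) 0 = 0" if "(\<Sum>i\<in>UNIV. max (d i) 0 *\<^sub>R f i) = 0" for d :: "'n \<Rightarrow> real"
  proof -
    have "(\<Sum>i\<in>UNIV. max (d i) 0 * (height \<bullet> f i)) = height \<bullet> (\<Sum>i\<in>UNIV. max (d i) 0 *\<^sub>R f i)"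
      by (simp add: inner_sum_right)
    then have "(\<Sum>i\<in>UNIV. max (d i) 0 * (height \<bullet> f i)) = 0" using that by simp
    moreover have pos: "0 < height \<bullet> f i" for i using P_pos f_in_P by blast
    moreover have "0 \<le> max (d i) 0 * (height \<bullet> f i)" for i using pos[of i] by simp
    ultimately have "max (d i) 0 * (height \<bullet> f i) = 0" by (simp add: sum_nonneg_eq_0_iff)
    then show ?thesis using pos[of i] by simp
  qed
  from this[of c] this[of "\<lambda>i. - c i"] show ?thesis using \<open>u = 0\<close> u' u_def by (simp add: max_def split: if_splits)
qed

text \<open>\<open>\<gamma>\<close> is known only through the expansion of positive roots;
  independence makes that expansion unique.\<close>

lemma coeff_simple: "\<gamma> (f j) i = (if i = j then 1 else 0)"
proof -
  have "(\<Sum>i\<in>UNIV. (real (\<gamma> (f j) i) - (if i = j then 1 else 0)) *\<^sub>R f i) = 0"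
  proof -
    have "(\<Sum>i\<in>UNIV. (if i = j then 1 else 0) *\<^sub>R f i) = f j"
      by (subst sum.mono_neutral_right[where S = "{j}"]) auto
    then show ?thesis using coeffs[OF f_in_P[of j]] by (simp add: scaleR_left_diff_distrib sum_subtractf)
  qed
  from f_independent[OF this, of i] show ?thesis by (auto split: if_splits)
qed

text \<open>Makes the coordinate expression additive on the whole space, so that its values at three
  roots with sum 0 also have sum 0.\<close>

lemma linear_extension:
  fixes x :: "'n \<Rightarrow> real"
  obtains l :: "'a \<Rightarrow> real" where "linear l" "\<And>r. r \<in> P \<Longrightarrow> l r = (\<Sum>i\<in>UNIV. real (\<gamma> r i) * x i)"
proof -
  have injf: "inj f" using inj_f by (auto simp: inj_def)
  have "independent (range f)"
    unfolding independent_explicit_finite_subsets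
  proof (intro allI impI ballI)
    fix S u v
    assume S: "S \<subseteq> range f" "(\<Sum>v\<in>S. u v *\<^sub>R v) = 0" "finite S" "v \<in> S"
    then obtain i where i: "v = f i" by auto
    have "(\<Sum>i\<in>UNIV. (if f i \<in> S then u (f i) else 0) *\<^sub>R f i) = (\<Sum>v\<in>range f. (if v \<in> S then u v else 0) *\<^sub>R v)"
      by (subst sum.reindex[OF injf]) simp
    also have "\<dots> = (\<Sum>v\<in>S. u v *\<^sub>R v)"
      using S by (intro sum.mono_neutral_cong_right) auto
    finally have "(if f i \<in> S then u (f i) else 0) = 0" using f_independent[of "\<lambda>i. if f i \<in> S then u (f i) else 0"] S(2) by simp
    then show "u v = 0" using S i by simp
  qed
  then obtain l where l: "linear l" "\<forall>v\<in>range f. l v = x (inv f v)"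
    using linear_independent_extend[of "range f" "\<lambda>v. x (inv f v)"] by blast
  have lf: "l (f i) = x i" for i using l injf by simp
  show ?thesis
  proof (rule that[OF l(1)])
    fix r assume "r \<in> P"
    then have "l r = l (\<Sum>i\<in>UNIV. real (\<gamma> r i) *\<^sub>R f i)" using coeffs by simp
    then show "l r = (\<Sum>i\<in>UNIV. real (\<gamma> r i) * x i)"
      using l(1) by (simp add: linear_sum linear_scale lf)
  qed
qed

text \<open>The values \<open>v r\<close> are the limits of \<open>frac (l r) - 1/2\<close> when \<open>l\<close> is perturbed to be positive
  on \<open>P\<close>.\<close>

lemma sum_half_odd_ge:
  fixes x :: "'n \<Rightarrow> real" and k :: "'a \<Rightarrow> int"
  assumes odd: "\<And>r. r \<in> P \<Longrightarrow> odd (k r)"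
  shows "(\<Sum>r\<in>P. (of_int (k r) / 2 - (\<Sum>i\<in>UNIV. real (\<gamma> r i) * x i))\<^sup>2) \<ge>
    (real (card P) - real (dim R)) / 12"
proof -
  obtain l where l: "linear l" "\<And>r. r \<in> P \<Longrightarrow> l r = (\<Sum>i\<in>UNIV. real (\<gamma> r i) * x i)"
    using linear_extension by blast
  \<comment> \<open>On negative roots v is prescribed by oddness, since
    \<open>frac (l r) - 1 / 2\<close> itself is not odd where \<open>l r\<close> is an
    integer.\<close>
  define v where "v = (\<lambda>r. if r \<in> P then frac (l r) - 1 / 2 else 1 / 2 - frac (l (- r)))"
  have v_odd: "v (- r) = - v r" if "r \<in> R" for r
    using R_cases[OF that] uminus_P[of r] uminus_P[of "- r"] by (auto simp: v_def)
  have v_int: "v r + 1 / 2 - l r \<in> \<int>" for r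
  proof -
    have "v r + 1 / 2 - l r = (if r \<in> P then - of_int \<lfloor>l r\<rfloor> else 1 + of_int \<lfloor>l (- r)\<rfloor>)"
      using linear_neg[OF l(1), of r] by (simp add: v_def frac_def)
    then show ?thesis by (auto intro!: Ints_add)
  qed
  have v_range: "- 1 / 2 \<le> v r" "v r \<le> 1 / 2" "r \<in> P \<Longrightarrow> v r < 1 / 2" "r \<notin> P \<Longrightarrow> - 1 / 2 < v r" for r
    using frac_ge_0[of "l r"] frac_lt_1[of "l r"] frac_ge_0[of "l (- r)"] frac_lt_1[of "l (- r)"]
    by (auto simp: v_def)
  have "\<bar>v r + v s + v (- (s + r))\<bar> = 1 / 2" if R: "r \<in> R" "s \<in> R" "s + r \<in> R" for r s
  proof -
    let ?t = "- (s + r)"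
    have "(v r + 1 / 2 - l r) + (v s + 1 / 2 - l s) + (v ?t + 1 / 2 - l ?t) \<in> \<int>"
      using v_int by (intro Ints_add) auto
    also have "l ?t = - l s - l r" by (simp only: linear_neg[OF l(1)] linear_add[OF l(1)] minus_add_distrib)
    finally have "v r + v s + v ?t + 3 / 2 \<in> \<int>" by (simp add: algebra_simps)
    then obtain m :: int where m: "v r + v s + v ?t + 3 / 2 = of_int m" by (metis Ints_cases)
    have "height \<bullet> r + height \<bullet> s + height \<bullet> ?t = 0" by (simp add: inner_add_right inner_diff_right)
    \<comment> \<open>Three roots with sum 0 are neither all positive nor all negative. With the
      half-open ranges of v this keeps the half odd integer v_r + v_s + v_t away from 3/2 and
      -3/2.\<close>
    then have "\<not> (r \<in> P \<and> s \<in> P \<and> ?t \<in> P)" "\<not> (- r \<in> P \<and> - s \<in> P \<and> - ?t \<in> P)"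
      using P_pos[of r] P_pos[of s] P_pos[of ?t] P_pos[of "- r"] P_pos[of "- s"] P_pos[of "- ?t"]
      by (auto simp: inner_add_right)
    moreover have "?t \<in> R" using R uminus_closed by blast
    ultimately have "r \<notin> P \<or> s \<notin> P \<or> ?t \<notin> P" "r \<in> P \<or> s \<in> P \<or> ?t \<in> P"
      using R R_cases by blast+
    then have "0 < v r + v s + v ?t + 3 / 2" "v r + v s + v ?t + 3 / 2 < 3"
      using v_range[of r] v_range[of s] v_range[of ?t] by argo+
    then have "m = 1 \<or> m = 2" unfolding m by linarith
    then show ?thesis using m by (auto simp: field_simps)
  qed
  from strange_inequality[OF v_odd this]
  have "(\<Sum>r\<in>R. (v r)\<^sup>2) \<ge> (real (card R) - 2 * real (dim R)) / 12" by blast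
  moreover have "(\<Sum>r\<in>R. (v r)\<^sup>2) = 2 * (\<Sum>r\<in>P. (v r)\<^sup>2)"
    unfolding sum_R sum_distrib_left using v_odd P_subset by (intro sum.cong) auto
  ultimately have "(\<Sum>r\<in>P. (v r)\<^sup>2) \<ge> (real (card P) - real (dim R)) / 12" by (simp add: card_R field_simps)
  also have "(\<Sum>r\<in>P. (v r)\<^sup>2) \<le> (\<Sum>r\<in>P. (of_int (k r) / 2 - (\<Sum>i\<in>UNIV. real (\<gamma> r i) * x i))\<^sup>2)"
  proof (rule sum_mono)
    fix r assume r: "r \<in> P"
    show "(v r)\<^sup>2 \<le> (of_int (k r) / 2 - (\<Sum>i\<in>UNIV. real (\<gamma> r i) * x i))\<^sup>2"
      using half_odd_dist_ge[OF odd[OF r], of "l r"] r by (simp add: v_def l(2))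
  qed
  finally show ?thesis .
qed

end

subsection \<open>The theta series\<close>

lemma ee_add: "ee (x + y) = ee x * ee y"
  by (simp add: ee_def exp_add[symmetric] algebra_simps)

lemma ee_0 [simp]: "ee 0 = 1"
  by (simp add: ee_def)

lemma ee_nonzero [simp]: "ee x \<noteq> 0"
  by (simp add: ee_def)

lemma ee_minus: "ee (- x) = inverse (ee x)"
  by (simp add: ee_def exp_minus)

lemma ee_diff: "ee (x - y) = ee x / ee y"
  using ee_add[of x "- y"] by (simp add: ee_minus divide_inverse)

lemma ee_of_int [simp]: "ee (of_int n) = 1"
  by (simp add: ee_def exp_eq_1)

lemma ee_of_nat_mult: "ee (of_nat n * x) = ee x ^ n"
  by (simp add: ee_def exp_of_nat_mult[symmetric] algebra_simps)

lemma ee_sum: "ee (\<Sum>i\<in>A. f i) = (\<Prod>i\<in>A. ee (f i))"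
  by (induction A rule: infinite_finite_induct) (simp_all add: ee_add)

lemma ee_half: "ee (1 / 2) = -1"
  by (simp add: ee_def)

lemma norm_ee: "norm (ee x) = exp (- 2 * pi * Im x)"
  by (simp add: ee_def norm_exp_eq_Re)

lemma ee_eq_iff: "ee x = ee y \<longleftrightarrow> (\<exists>n::int. x = y + of_int n)"
proof -
  have "ee x = ee y \<longleftrightarrow> (\<exists>n::int. 2 * of_real pi * \<i> * x = 2 * of_real pi * \<i> * (y + of_int n))"
    unfolding ee_def exp_eq by (intro ex_cong1) (simp add: algebra_simps)
  also have "\<dots> \<longleftrightarrow> (\<exists>n::int. x = y + of_int n)"
    by (subst mult_cancel_left) simp
  finally show ?thesis .
qed

lemma ee_cong: "x - y \<in> \<int> \<Longrightarrow> ee x = ee y"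
  unfolding ee_eq_iff by (auto elim!: Ints_cases simp: algebra_simps)

lemma holomorphic_ee [holomorphic_intros]: "f holomorphic_on S \<Longrightarrow> (\<lambda>x. ee (f x)) holomorphic_on S"
  unfolding ee_def by (intro holomorphic_intros)

lemma has_field_derivative_ee [derivative_intros]:
  "(f has_field_derivative D) (at x within S) \<Longrightarrow>
    ((\<lambda>x. ee (f x)) has_field_derivative (2 * of_real pi * \<i> * ee (f x)) * D) (at x within S)"
  unfolding ee_def by (auto intro!: derivative_eq_intros)

lemma norm_ee_less_1: "\<tau> \<in> uhp \<Longrightarrow> norm (ee \<tau>) < 1"
  by (simp add: norm_ee uhp_def)

section \<open>Convergence, quasi-periods and joint holomorphy of the theta series\<close>

definition theta_term :: "complex \<Rightarrow> complex \<Rightarrow> int \<Rightarrow> complex" where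
  "theta_term \<tau> z r = of_int (kronecker_m4 r) * ee (of_int (r^2) / 8 * \<tau>) * ee (of_int r * z / 2)"

lemma theta_eq: "theta \<tau> z = (\<Sum>\<^sub>\<infinity>r. theta_term \<tau> z r)"
  by (simp add: theta_def theta_term_def)

lemma kronecker_m4_le_1: "\<bar>kronecker_m4 r\<bar> \<le> 1"
  by (simp add: kronecker_m4_def)

lemma kronecker_m4_even: "even r \<Longrightarrow> kronecker_m4 r = 0"
  unfolding kronecker_m4_def by presburger

lemma kronecker_m4_shift: "of_int (kronecker_m4 (r + 2 * k)) = ee (of_int k / 2) * of_int (kronecker_m4 r)"
proof (cases "even k")
  case True
  then obtain m where m: "k = 2 * m" by blast
  have "r + 2 * k = r + 4 * m" by (simp add: m)
  then have "(r + 2 * k) mod 4 = r mod 4" by (simp only: mod_mult_self2)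
  then have "kronecker_m4 (r + 2 * k) = kronecker_m4 r" by (simp add: kronecker_m4_def)
  then show ?thesis by (simp add: m)
next
  case False
  then obtain m where m: "k = 2 * m + 1" by (auto elim: oddE)
  have "r + 2 * k = r + 2 + 4 * m" by (simp add: m)
  then have "(r + 2 * k) mod 4 = (r + 2) mod 4" by (simp only: mod_mult_self2)
  also have "\<dots> = (r mod 4 + 2) mod 4" by (simp only: mod_add_left_eq)
  finally have *: "(r + 2 * k) mod 4 = (r mod 4 + 2) mod 4" .
  have "r mod 4 \<in> {0, 1, 2, 3}" by auto
  then have "kronecker_m4 (r + 2 * k) = - kronecker_m4 r"
    unfolding kronecker_m4_def * by auto
  moreover have "ee (of_int k / 2) = -1"
    using ee_add[of "of_int m" "1 / 2"] by (simp add: m add_divide_distrib ee_half)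
  ultimately show ?thesis by simp
qed

lemma ee_half_odd: "odd r \<Longrightarrow> ee (of_int r * of_int m / 2) = ee (of_int m / 2)"
proof (rule ee_cong)
  assume "odd r"
  then obtain j where j: "r = 2 * j + 1" by (auto elim: oddE)
  have "of_int r * of_int m / 2 - of_int m / 2 = (of_int (j * m) :: complex)"
    by (simp add: j field_simps)
  then show "of_int r * of_int m / 2 - of_int m / 2 \<in> (\<int> :: complex set)" by (simp only: Ints_of_int)
qed

lemma summable_on_exp_abs_int: "(\<lambda>r::int. exp (- \<bar>real_of_int r\<bar>)) summable_on UNIV"
proof -
  have nat: "(\<lambda>n. exp (- real n)) summable_on (UNIV :: nat set)"
  proof (subst summable_on_UNIV_nonneg_real_iff)
    have "(\<lambda>n. exp (- real n)) = (\<lambda>n. exp (- 1) ^ n)"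
      by (simp add: exp_of_nat_mult[symmetric])
    then show "summable (\<lambda>n. exp (- real n))" by (simp add: summable_geometric)
  qed auto
  have "(\<lambda>r::int. exp (- \<bar>real_of_int r\<bar>)) summable_on range int"
    using nat by (subst summable_on_reindex) (auto simp: o_def)
  moreover have "(\<lambda>r::int. exp (- \<bar>real_of_int r\<bar>)) summable_on range (\<lambda>n. - int n)"
    using nat by (subst summable_on_reindex) (auto simp: o_def inj_on_def)
  moreover have "(UNIV :: int set) = range int \<union> range (\<lambda>n. - int n)"
    by (auto simp: image_iff) (metis int_cases2)
  ultimately show ?thesis by (metis summable_on_union)
qed

text \<open>The factor \<open>1 + r\<^sup>2\<close> accounts for what termwise differentiation produces.\<close>

lemma theta_term_bound:
  fixes y Y :: real
  assumes "0 < y"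
  obtains K where "\<And>\<tau> z r. y \<le> Im \<tau> \<Longrightarrow> \<bar>Im z\<bar> \<le> Y \<Longrightarrow>
    (1 + (real_of_int r)\<^sup>2) * norm (theta_term \<tau> z r) \<le> K * exp (- \<bar>real_of_int r\<bar>)"
proof -
  define a where "a = pi * y / 4"
  \<comment> \<open>The term \<pi> Y comes from z. Of the extra 2, one unit pays for 1 + x^2 \<le> 2
    exp x and the other leaves exp (- x) for the summation.\<close>
  define b where "b = pi * Y + 2"
  have a: "0 < a" using assms by (simp add: a_def)
  have "(1 + (real_of_int r)\<^sup>2) * norm (theta_term \<tau> z r) \<le> 2 * exp (b\<^sup>2 / (4 * a)) * exp (- \<bar>real_of_int r\<bar>)"
    if "y \<le> Im \<tau>" "\<bar>Im z\<bar> \<le> Y" for \<tau> z r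
  proof -
    define x where "x = \<bar>real_of_int r\<bar>"
    have x: "0 \<le> x" "x\<^sup>2 = (real_of_int r)\<^sup>2" by (simp_all add: x_def)
    have "norm (theta_term \<tau> z r) \<le> exp (- pi / 4 * x\<^sup>2 * Im \<tau>) * exp (- pi * (r * Im z))"
    proof -
      have "norm (theta_term \<tau> z r) = \<bar>real_of_int (kronecker_m4 r)\<bar> *
          (exp (- pi / 4 * x\<^sup>2 * Im \<tau>) * exp (- pi * (r * Im z)))"
        by (simp add: theta_term_def norm_mult norm_ee x)
      moreover have "\<bar>real_of_int (kronecker_m4 r)\<bar> \<le> 1" using kronecker_m4_le_1[of r] by linarith
      ultimately show ?thesis by (simp add: mult_left_le_one_le)
    qed
    also have "\<dots> = exp (- pi / 4 * x\<^sup>2 * Im \<tau> - pi * (r * Im z))" by (simp flip: exp_add)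
    also have "\<dots> \<le> exp (- a * x\<^sup>2 + pi * (x * Y))"
    proof -
      have "x\<^sup>2 * y \<le> x\<^sup>2 * Im \<tau>" using that by (intro mult_left_mono) auto
      then have "pi * (x\<^sup>2 * y) \<le> pi * (x\<^sup>2 * Im \<tau>)" by (rule mult_left_mono) simp
      moreover have "- (r * Im z) \<le> x * Y"
      proof -
        have "\<bar>r * Im z\<bar> \<le> x * Y" unfolding abs_mult x_def using that by (intro mult_left_mono) auto
        then show ?thesis by linarith
      qed
      then have "pi * - (r * Im z) \<le> pi * (x * Y)" by (rule mult_left_mono) simp
      ultimately have "- (pi * (x\<^sup>2 * Im \<tau>)) / 4 + pi * - (r * Im z) \<le> - (pi * (x\<^sup>2 * y)) / 4 + pi * (x * Y)"
        by linarith
      then show ?thesis by (simp add: a_def mult_ac)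
    qed
    finally have 1: "norm (theta_term \<tau> z r) \<le> exp (- a * x\<^sup>2 + pi * (x * Y))" .
    have "1 + x\<^sup>2 \<le> 2 * exp x"
      using exp_lower_Taylor_quadratic[OF x(1)] x(1) by (simp add: algebra_simps)
    then have "(1 + x\<^sup>2) * norm (theta_term \<tau> z r) \<le> (2 * exp x) * exp (- a * x\<^sup>2 + pi * (x * Y))"
      using 1 by (intro mult_mono) auto
    also have "\<dots> = 2 * exp (b\<^sup>2 / (4 * a) - (a * x - b / 2)\<^sup>2 / a) * exp (- x)"
    proof -
      have "x + (- a * x\<^sup>2 + pi * (x * Y)) = b\<^sup>2 / (4 * a) - (a * x - b / 2)\<^sup>2 / a + (- x)"
        using a by (simp add: power2_eq_square field_simps) (simp add: b_def algebra_simps)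
      then show ?thesis by (simp only: mult.assoc exp_add[symmetric])
    qed
    also have "\<dots> \<le> 2 * exp (b\<^sup>2 / (4 * a)) * exp (- x)"
      using a by (intro mult_right_mono mult_left_mono) auto
    finally show ?thesis using x by (simp add: x_def)
  qed
  then show ?thesis using that by blast
qed

lemma norm_le_poly_mult: "norm (x :: complex) \<le> (1 + (real_of_int r)\<^sup>2) * norm x"
  by (simp add: distrib_right)

lemma theta_term_abs_summable:
  assumes "\<tau> \<in> uhp"
  shows "(\<lambda>r. norm (theta_term \<tau> z r)) summable_on UNIV"
proof -
  obtain K where K: "\<And>\<tau>' z' r. Im \<tau> \<le> Im \<tau>' \<Longrightarrow> \<bar>Im z'\<bar> \<le> \<bar>Im z\<bar> \<Longrightarrow>
    (1 + (real_of_int r)\<^sup>2) * norm (theta_term \<tau>' z' r) \<le> K * exp (- \<bar>real_of_int r\<bar>)"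
    using theta_term_bound[of "Im \<tau>" "\<bar>Im z\<bar>"] assms by (auto simp: uhp_def)
  show ?thesis
  proof (rule Infinite_Sum.abs_summable_on_comparison_test')
    show "(\<lambda>r::int. K * exp (- \<bar>real_of_int r\<bar>)) summable_on UNIV"
      by (rule summable_on_cmult_right[OF summable_on_exp_abs_int])
    show "norm (theta_term \<tau> z r) \<le> K * exp (- \<bar>real_of_int r\<bar>)" for r
      using K[of \<tau> z r] norm_le_poly_mult[of "theta_term \<tau> z r" r] by linarith
  qed
qed

lemma theta_term_has_sum: "\<tau> \<in> uhp \<Longrightarrow> (theta_term \<tau> z has_sum theta \<tau> z) UNIV"
  unfolding theta_eq by (rule has_sum_infsum, rule abs_summable_summable, rule theta_term_abs_summable)

text \<open>Reindexing by r \<mapsto> r + 2 l absorbs the shift by l \<tau>, as (r + 2 l)^2 / 8 =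
  r^2 / 8 + r l / 2 + l^2 / 2. The character contributes the sign (-1)^l, and the shift by m
  contributes (-1)^m because only odd r count.\<close>

lemma theta_shift:
  "theta \<tau> (z + of_int l * \<tau> + of_int m) =
    ee ((of_int l + of_int m) / 2 - (of_int l)\<^sup>2 * \<tau> / 2 - of_int l * z) * theta \<tau> z"
proof -
  let ?c = "ee ((of_int l + of_int m) / 2 - (of_int l)\<^sup>2 * \<tau> / 2 - of_int l * z)"
  have bij: "bij_betw (\<lambda>r::int. r + 2 * l) UNIV UNIV"
    by (rule bij_betw_byWitness[where f' = "\<lambda>r. r - 2 * l"]) auto
  have "theta_term \<tau> (z + of_int l * \<tau> + of_int m) r = ?c * theta_term \<tau> z (r + 2 * l)" for r
  proof (cases "even r")
    case True then show ?thesis by (simp add: theta_term_def kronecker_m4_even)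
  next
    case False
    have "?c * theta_term \<tau> z (r + 2 * l) = of_int (kronecker_m4 r) *
       (ee (of_int l / 2) * ?c * ee (of_int ((r + 2 * l)^2) / 8 * \<tau>) * ee (of_int (r + 2 * l) * z / 2))"
      by (simp only: theta_term_def kronecker_m4_shift) (simp add: mult_ac)
    also have "ee (of_int l / 2) * ?c * ee (of_int ((r + 2 * l)^2) / 8 * \<tau>) * ee (of_int (r + 2 * l) * z / 2) =
      ee (of_int l + of_int m / 2 + (of_int (r^2) / 8 * \<tau> + (of_int r * z / 2 + of_int r * (of_int l * \<tau>) / 2)))"
      unfolding ee_add[symmetric] by (rule arg_cong[where f = ee]) (simp add: power2_eq_square field_simps)
    also have "\<dots> = ee (of_int m / 2) * (ee (of_int (r^2) / 8 * \<tau>) * ee (of_int r * z / 2 + of_int r * (of_int l * \<tau>) / 2))"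
      by (simp add: ee_add)
    also have "ee (of_int m / 2) = ee (of_int r * of_int m / 2)" using ee_half_odd[OF False] by simp
    finally show ?thesis by (simp add: theta_term_def ee_add add_divide_distrib distrib_left mult_ac)
  qed
  then have "theta \<tau> (z + of_int l * \<tau> + of_int m) = (\<Sum>\<^sub>\<infinity>r. ?c * theta_term \<tau> z (r + 2 * l))"
    by (simp add: theta_eq)
  also have "\<dots> = ?c * (\<Sum>\<^sub>\<infinity>r. theta_term \<tau> z (r + 2 * l))"
    by (rule infsum_cmult_right')
  also have "(\<Sum>\<^sub>\<infinity>r. theta_term \<tau> z (r + 2 * l)) = theta \<tau> z"
    unfolding theta_eq by (rule infsum_reindex_bij_betw[OF bij])
  finally show ?thesis .
qed

lemma kronecker_m4_minus: "kronecker_m4 (- r) = - kronecker_m4 r"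
proof -
  have *: "(- r) mod 4 = (- (r mod 4)) mod 4" by (simp only: mod_minus_eq)
  have "r mod 4 \<in> {0, 1, 2, 3}" by auto
  then show ?thesis unfolding kronecker_m4_def * by auto
qed

lemma theta_minus: "theta \<tau> (- z) = - theta \<tau> z"
proof -
  have "theta \<tau> (- z) = (\<Sum>\<^sub>\<infinity>r. - theta_term \<tau> z (- r))"
    unfolding theta_eq by (intro infsum_cong) (simp add: theta_term_def kronecker_m4_minus)
  also have "\<dots> = - theta \<tau> z"
    unfolding theta_eq infsum_uminus
    by (subst infsum_reindex_bij_betw[where g = uminus]) (auto intro: bij_betw_byWitness[where f' = uminus])
  finally show ?thesis .
qed

lemma theta_0 [simp]: "theta \<tau> 0 = 0"
  using theta_minus[of \<tau> 0] by simp

lemma theta_sums: "\<tau> \<in> uhp \<Longrightarrow> (\<lambda>n. theta_term \<tau> z (int_decode n)) sums theta \<tau> z"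
  using theta_term_has_sum[of \<tau> z] has_sum_reindex_bij_betw[OF bij_int_decode, of "theta_term \<tau> z"]
  by (intro has_sum_imp_sums) auto

text \<open>\<open>holomorphic_uhp_vec\<close> asks for joint differentiability, so the series is
  differentiated termwise in both variables at once.\<close>

lemma theta_has_derivative:
  assumes \<tau>: "\<tau> \<in> uhp"
  shows "\<exists>A B. ((\<lambda>(t, w). theta t w) has_derivative (\<lambda>(s, v). A * s + B * v)) (at (\<tau>, z))"
proof -
  define \<rho> where "\<rho> = Im \<tau> / 2"
  define S where "S = ball (\<tau>, z) \<rho>"
  have \<rho>: "0 < \<rho>" using \<tau> by (simp add: \<rho>_def uhp_def)
  have S: "\<rho> \<le> Im t" "\<bar>Im w\<bar> \<le> \<bar>Im z\<bar> + \<rho>" if "(t, w) \<in> S" for t w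
  proof -
    have "dist (\<tau>, z) (t, w) < \<rho>" using that by (simp add: S_def)
    then have "dist \<tau> t < \<rho>" "dist z w < \<rho>"
      using dist_fst_le[of "(\<tau>, z)" "(t, w)"] dist_snd_le[of "(\<tau>, z)" "(t, w)"] by auto
    then have "\<bar>Im (\<tau> - t)\<bar> < \<rho>" "\<bar>Im (z - w)\<bar> < \<rho>"
      using abs_Im_le_cmod[of "\<tau> - t"] abs_Im_le_cmod[of "z - w"] by (simp_all add: dist_norm)
    moreover have "Im \<tau> = 2 * \<rho>" by (simp add: \<rho>_def)
    ultimately show "\<rho> \<le> Im t" "\<bar>Im w\<bar> \<le> \<bar>Im z\<bar> + \<rho>" by auto
  qed
  obtain K where K: "\<And>t w r. \<rho> \<le> Im t \<Longrightarrow> \<bar>Im w\<bar> \<le> \<bar>Im z\<bar> + \<rho> \<Longrightarrow>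
    (1 + (real_of_int r)\<^sup>2) * norm (theta_term t w r) \<le> K * exp (- \<bar>real_of_int r\<bar>)"
    using theta_term_bound[OF \<rho>, of "\<bar>Im z\<bar> + \<rho>"] by blast
  define r where "r = (\<lambda>n. int_decode n)"
  \<comment> \<open>The derivatives \<open>a\<close> and \<open>b\<close> of the exponent have norms
    (\<pi>/4) r^2 and \<pi> |r|, both at most 4 (1 + r^2).\<close>
  define M where "M = (\<lambda>n. 4 * K * exp (- \<bar>real_of_int (r n)\<bar>))"
  have "(\<lambda>n. exp (- \<bar>real_of_int (int_decode n)\<bar>)) summable_on UNIV"
    using summable_on_exp_abs_int summable_on_reindex_bij_betw[OF bij_int_decode, of "\<lambda>r. exp (- \<bar>real_of_int r\<bar>)"] by simp
  then have M: "summable M"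
    unfolding M_def r_def by (intro summable_mult summable_on_imp_summable)
  define a where "a = (\<lambda>n. 2 * of_real pi * \<i> * (of_int ((r n)^2) / 8 :: complex))"
  define b where "b = (\<lambda>n. 2 * of_real pi * \<i> * (of_int (r n) / 2 :: complex))"
  define T where "T = (\<lambda>n (p :: complex \<times> complex). theta_term (fst p) (snd p) (r n))"
  have ab: "norm (T n p * a n) \<le> M n" "norm (T n p * b n) \<le> M n" if "p \<in> S" for n p
  proof -
    let ?x = "real_of_int (r n)"
    have KT: "(1 + ?x\<^sup>2) * norm (T n p) \<le> K * exp (- \<bar>?x\<bar>)"
      unfolding T_def using K[of "fst p" "snd p" "r n"] S[of "fst p" "snd p"] that by simp
    have "\<bar>?x\<bar> \<le> 1 + ?x\<^sup>2"
    proof (cases "\<bar>?x\<bar> \<le> 1")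
      case False
      then have "\<bar>?x\<bar> * 1 \<le> \<bar>?x\<bar> * \<bar>?x\<bar>" by (intro mult_left_mono) auto
      then show ?thesis by (simp add: power2_eq_square)
    qed (use zero_le_power2[of ?x] in linarith)
    then have "norm (b n) \<le> 4 * (1 + ?x\<^sup>2)"
    proof -
      have "norm (b n) = pi * \<bar>?x\<bar>" by (simp add: b_def norm_mult)
      also have "\<dots> \<le> 4 * (1 + ?x\<^sup>2)" using pi_less_4 \<open>\<bar>?x\<bar> \<le> 1 + ?x\<^sup>2\<close> by (intro mult_mono) auto
      finally show ?thesis .
    qed
    moreover have "norm (a n) \<le> 4 * (1 + ?x\<^sup>2)"
    proof -
      have "norm (a n) = (pi / 4) * ?x\<^sup>2" by (simp add: a_def norm_mult norm_power)
      also have "\<dots> \<le> 4 * (1 + ?x\<^sup>2)" using pi_less_4 by (intro mult_mono) auto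
      finally show ?thesis .
    qed
    ultimately have "norm (T n p) * norm (a n) \<le> norm (T n p) * (4 * (1 + ?x\<^sup>2))"
      "norm (T n p) * norm (b n) \<le> norm (T n p) * (4 * (1 + ?x\<^sup>2))" by (intro mult_left_mono; simp)+
    then show "norm (T n p * a n) \<le> M n" "norm (T n p * b n) \<le> M n"
      using KT by (simp_all add: M_def norm_mult algebra_simps)
  qed
  define A where "A = (\<lambda>p. \<Sum>n. T n p * a n)"
  define B where "B = (\<lambda>p. \<Sum>n. T n p * b n)"
  have uA: "uniform_limit S (\<lambda>n p. \<Sum>i<n. T i p * a i) A sequentially"
    unfolding A_def by (rule Weierstrass_m_test[OF ab(1) M])
  have uB: "uniform_limit S (\<lambda>n p. \<Sum>i<n. T i p * b i) B sequentially"
    unfolding B_def by (rule Weierstrass_m_test[OF ab(2) M])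
  have "\<exists>g. \<forall>p\<in>S. (\<lambda>n. T n p) sums g p \<and> (g has_derivative (\<lambda>h. A p * fst h + B p * snd h)) (at p within S)"
  proof (rule has_derivative_series[where f' = "\<lambda>n p h. T n p * a n * fst h + T n p * b n * snd h"])
    show "convex S" unfolding S_def by simp
    show "(\<tau>, z) \<in> S" unfolding S_def using \<rho> by simp
    show "(\<lambda>n. T n (\<tau>, z)) sums theta \<tau> z" unfolding T_def r_def using theta_sums[OF \<tau>] by simp
    show "(T n has_derivative (\<lambda>h. T n p * a n * fst h + T n p * b n * snd h)) (at p within S)" for n p
    proof -
      have "T n = (\<lambda>p. of_int (kronecker_m4 (r n)) * exp (fst p * a n + snd p * b n))"
        by (auto simp: T_def theta_term_def ee_def a_def b_def mult.assoc simp flip: exp_add) (simp_all add: algebra_simps)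
      moreover have "((\<lambda>p. fst p * a n + snd p * b n) has_derivative (\<lambda>h. fst h * a n + snd h * b n)) (at p within S)"
        by (auto intro!: derivative_eq_intros)
      from has_derivative_mult_right[OF has_derivative_compose[OF this DERIV_exp[unfolded has_field_derivative_def]], of "of_int (kronecker_m4 (r n))"]
      have "((\<lambda>p. of_int (kronecker_m4 (r n)) * exp (fst p * a n + snd p * b n)) has_derivative
        (\<lambda>h. of_int (kronecker_m4 (r n)) * exp (fst p * a n + snd p * b n) * a n * fst h +
          of_int (kronecker_m4 (r n)) * exp (fst p * a n + snd p * b n) * b n * snd h)) (at p within S)"
        by (rule has_derivative_eq_rhs) (simp add: fun_eq_iff algebra_simps)
      ultimately show ?thesis by simp
    qed
    fix e :: real assume "0 < e"
    then have "\<forall>\<^sub>F n in sequentially. \<forall>p\<in>S. dist (\<Sum>i<n. T i p * a i) (A p) < e / 2"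
      "\<forall>\<^sub>F n in sequentially. \<forall>p\<in>S. dist (\<Sum>i<n. T i p * b i) (B p) < e / 2"
      using uA uB unfolding uniform_limit_iff by (meson half_gt_zero)+
    then show "\<forall>\<^sub>F n in sequentially. \<forall>p\<in>S. \<forall>h. norm ((\<Sum>i<n. T i p * a i * fst h + T i p * b i * snd h) -
        (A p * fst h + B p * snd h)) \<le> e * norm h"
    proof eventually_elim
      case (elim n)
      show ?case
      proof (intro ballI allI)
        fix p and h :: "complex \<times> complex" assume p: "p \<in> S"
        have "(\<Sum>i<n. T i p * a i * fst h + T i p * b i * snd h) - (A p * fst h + B p * snd h) =
          ((\<Sum>i<n. T i p * a i) - A p) * fst h + ((\<Sum>i<n. T i p * b i) - B p) * snd h"
          by (simp only: sum.distrib sum_distrib_right[symmetric]) (simp add: algebra_simps)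
        also have "norm \<dots> \<le> e / 2 * norm h + e / 2 * norm h"
        proof (rule norm_triangle_le, rule add_mono)
          have h: "norm (fst h) \<le> norm h" "norm (snd h) \<le> norm h"
            using norm_fst_le[of "fst h" "snd h"] norm_snd_le[of "snd h" "fst h"] by simp_all
          have "norm ((\<Sum>i<n. T i p * a i) - A p) \<le> e / 2" "norm ((\<Sum>i<n. T i p * b i) - B p) \<le> e / 2"
            using elim p by (auto simp: dist_norm less_imp_le)
          then show "norm (((\<Sum>i<n. T i p * a i) - A p) * fst h) \<le> e / 2 * norm h"
            "norm (((\<Sum>i<n. T i p * b i) - B p) * snd h) \<le> e / 2 * norm h"
            unfolding norm_mult using h \<open>0 < e\<close> by (intro mult_mono; simp)+
        qed
        finally show "norm ((\<Sum>i<n. T i p * a i * fst h + T i p * b i * snd h) - (A p * fst h + B p * snd h)) \<le> e * norm h"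
          by simp
      qed
    qed
  qed
  then obtain g where "\<forall>p\<in>S. (\<lambda>n. T n p) sums g p \<and>
    (g has_derivative (\<lambda>h. A p * fst h + B p * snd h)) (at p within S)" ..
  then have g: "(\<lambda>n. T n p) sums g p"
    "(g has_derivative (\<lambda>h. A p * fst h + B p * snd h)) (at p within S)" if "p \<in> S" for p
    using that by simp_all
  have p: "(\<tau>, z) \<in> S" unfolding S_def using \<rho> by simp
  have "((\<lambda>(t, w). theta t w) has_derivative (\<lambda>h. A (\<tau>, z) * fst h + B (\<tau>, z) * snd h)) (at (\<tau>, z) within S)"
  proof (rule has_derivative_transform[OF p _ g(2)[OF p]])
    fix x assume x: "x \<in> S"
    obtain t w where tw: "x = (t, w)" by (cases x)
    have "t \<in> uhp" using S[of t w] x \<rho> by (auto simp: tw uhp_def)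
    then have "(\<lambda>n. T n x) sums theta t w" using theta_sums[of t w] by (simp add: T_def r_def tw)
    from sums_unique2[OF this g(1)[OF x]] show "(case x of (t, w) \<Rightarrow> theta t w) = g x" by (simp add: tw)
  qed
  then have "((\<lambda>(t, w). theta t w) has_derivative (\<lambda>h. A (\<tau>, z) * fst h + B (\<tau>, z) * snd h)) (at (\<tau>, z))"
    using p by (subst (asm) at_within_open) (auto simp: S_def)
  then have "((\<lambda>(t, w). theta t w) has_derivative (\<lambda>(s, v). A (\<tau>, z) * s + B (\<tau>, z) * v)) (at (\<tau>, z))"
    by (simp only: case_prod_unfold)
  then show ?thesis by blast
qed

lemma theta_holomorphic: "\<tau> \<in> uhp \<Longrightarrow> theta \<tau> holomorphic_on S"
proof -
  assume \<tau>: "\<tau> \<in> uhp"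
  have "theta \<tau> field_differentiable (at z)" for z
  proof -
    obtain A B where AB: "((\<lambda>(t, w). theta t w) has_derivative (\<lambda>(s, v). A * s + B * v)) (at (\<tau>, z))"
      using theta_has_derivative[OF \<tau>] by blast
    have "((\<lambda>w. (\<tau>, w)) has_derivative (\<lambda>v. (0, v))) (at z)"
      by (intro has_derivative_Pair has_derivative_const has_derivative_ident)
    from diff_chain_at[OF this AB] have "(theta \<tau> has_derivative (\<lambda>v. B * v)) (at z)"
      by (simp add: o_def)
    then show ?thesis unfolding field_differentiable_def has_field_derivative_def by blast
  qed
  then show ?thesis
    unfolding holomorphic_on_def by (auto intro: field_differentiable_at_within)
qed

subsection \<open>The Jacobi triple product\<close>

text \<open>The q-Pochhammer symbol (q; q)_n; \<open>qbinom\<close> is the Gaussian binomial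
  coefficient.\<close>

definition qpoch :: "complex \<Rightarrow> nat \<Rightarrow> complex" where
  "qpoch q n = (\<Prod>k<n. 1 - q ^ (k + 1))"

definition qbinom :: "complex \<Rightarrow> nat \<Rightarrow> nat \<Rightarrow> complex" where
  "qbinom q n j = qpoch q n / (qpoch q j * qpoch q (n - j))"

lemma qpoch_nonzero: "norm q < 1 \<Longrightarrow> qpoch q n \<noteq> 0"
proof -
  assume q: "norm q < 1"
  have "q ^ (k + 1) \<noteq> 1" for k
  proof
    assume "q ^ (k + 1) = 1"
    then have "norm q ^ (k + 1) = 1" by (metis norm_one norm_power)
    then show False using power_Suc_less_one[of "norm q" k] q by (cases "norm q = 0") auto
  qed
  then show ?thesis by (simp add: qpoch_def)
qed

lemma q_binomial_theorem:
  assumes "norm q < 1"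
  shows "(\<Prod>k<n. 1 + x * q ^ k) = (\<Sum>j\<le>n. q ^ (j choose 2) * qbinom q n j * x ^ j)"
proof (induction n)
  case 0 then show ?case by (simp add: qbinom_def qpoch_def numeral_2_eq_2)
next
  case (Suc n)
  note nz = qpoch_nonzero[OF assms]
  \<comment> \<open>The cut-off is needed: for j > n the subtraction n - j gives 0 and
    \<open>qbinom\<close> would not vanish. With it the q-Pascal rule \<open>rec\<close> holds at
    the boundary as well.\<close>
  define F where "F = (\<lambda>n j. if j \<le> n then q ^ (j choose 2) * qbinom q n j else 0)"
  have F0: "F n 0 = 1" for n
    using nz[of n] by (simp add: F_def qbinom_def qpoch_def[of q 0] numeral_2_eq_2)
  have choose2: "Suc j choose 2 = (j choose 2) + j" for j by (simp add: numeral_2_eq_2)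
  have rec: "F (Suc n) (Suc j) = F n (Suc j) + q ^ n * F n j" for j
  proof -
    consider "j < n" | "j = n" | "j > n" by linarith
    then show ?thesis
    proof cases
      case 1
      then obtain m where m: "n = j + Suc m" by (metis less_iff_Suc_add add_Suc_right)
      have s: "qpoch q (Suc k) = qpoch q k * (1 - q ^ Suc k)" for k by (simp add: qpoch_def)
      have nz': "1 - q ^ Suc k \<noteq> 0" for k using nz[of "Suc k"] unfolding s by auto
      have "F (Suc n) (Suc j) = q ^ ((j choose 2) + j) * (qpoch q n * (1 - q ^ Suc n) / (qpoch q j * (1 - q ^ Suc j) * (qpoch q m * (1 - q ^ Suc m))))"
        using m by (simp only: F_def qbinom_def choose2 s) (simp add: s)
      also have "\<dots> = q ^ ((j choose 2) + j) * (qpoch q n / (qpoch q j * (1 - q ^ Suc j) * qpoch q m)) +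
          q ^ n * (q ^ (j choose 2) * (qpoch q n / (qpoch q j * (qpoch q m * (1 - q ^ Suc m)))))"
      proof -
        have e: "(1 - q ^ Suc n) = (1 - q ^ Suc m) + q ^ Suc m * (1 - q ^ Suc j)"
          by (simp add: m power_add algebra_simps)
        have qn: "q ^ n = q ^ j * q ^ Suc m" by (simp add: m power_add)
        show ?thesis unfolding e qn power_add using nz[of j] nz[of m] nz'[of j] nz'[of m]
          by (simp add: divide_simps del: power_Suc) (simp add: algebra_simps)
      qed
      also have "\<dots> = F n (Suc j) + q ^ n * F n j"
        using m by (simp add: F_def qbinom_def choose2 s)
      finally show ?thesis .
    next
      case 2
      have "F k k = q ^ (k choose 2)" for k
        using nz[of k] by (simp add: F_def qbinom_def) (simp add: qpoch_def)
      then have "F (Suc n) (Suc j) = q ^ n * F n j" unfolding 2 by (simp add: choose2 power_add)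
      then show ?thesis using 2 by (simp add: F_def)
    next
      case 3 then show ?thesis by (simp add: F_def)
    qed
  qed
  have E: "(\<Sum>j\<le>n. q ^ (j choose 2) * qbinom q n j * x ^ j) = (\<Sum>j\<le>n. F n j * x ^ j)" for n
    by (rule sum.cong) (auto simp: F_def)
  have ext: "(\<Sum>j\<le>n. F n j * x ^ j) = F n 0 + (\<Sum>j\<le>n. F n (Suc j) * x ^ Suc j)"
  proof -
    have "(\<Sum>j\<le>n. F n j * x ^ j) = (\<Sum>j\<le>Suc n. F n j * x ^ j)" by (simp add: F_def)
    then show ?thesis by (simp only: sum.atMost_Suc_shift) simp
  qed
  have "(\<Prod>k<Suc n. 1 + x * q ^ k) = (\<Sum>j\<le>n. F n j * x ^ j) + (\<Sum>j\<le>n. q ^ n * F n j * x ^ Suc j)"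
  proof -
    have "(\<Prod>k<n. 1 + x * q ^ k) = (\<Sum>j\<le>n. F n j * x ^ j)" using Suc.IH unfolding E .
    then show ?thesis
      by (simp add: distrib_left sum_distrib_left sum_distrib_right sum.distrib mult_ac)
  qed
  also have "\<dots> = F (Suc n) 0 + (\<Sum>j\<le>n. F (Suc n) (Suc j) * x ^ Suc j)"
    unfolding ext rec by (simp add: F0 sum.distrib distrib_right)
  also have "\<dots> = (\<Sum>j\<le>Suc n. F (Suc n) j * x ^ j)"
    by (simp only: sum.atMost_Suc_shift) simp
  finally show ?case unfolding E .
qed

lemma theta_term_odd:
  "theta_term \<tau> z (2 * i - 1) =
    - ee (of_int i / 2 + (2 * of_int i - 1)\<^sup>2 / 8 * \<tau> + (2 * of_int i - 1) * z / 2)"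
  using kronecker_m4_shift[of "-1" i]
  by (simp add: theta_term_def ee_add) (simp add: kronecker_m4_def)

text \<open>A truncated triple product: the q-binomial theorem with 2 n factors, its summation index
  recentred by n.\<close>

lemma finite_triple_product:
  assumes "norm (ee \<tau>) < 1"
  shows "- ee (\<tau> / 8 - z / 2) * ((\<Prod>k<n. 1 - ee (- z) * ee \<tau> ^ (k + 1)) * (\<Prod>k<n. 1 - ee z * ee \<tau> ^ k)) =
    (\<Sum>j\<le>2 * n. qbinom (ee \<tau>) (2 * n) j * theta_term \<tau> z (2 * (int j - int n) - 1))"
proof -
  \<comment> \<open>This is - e(z) q^(-n). The factors 1 + x q^k with k \<ge> n are then the second
    product, and those with k < n carry negative powers of q.\<close>
  define x where "x = ee (1 / 2 + z - of_nat n * \<tau>)"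
  \<comment> \<open>The product of all - e(z) q^(-(k + 1)), which are pulled out to turn 1 - e(z)
    q^(-(k + 1)) into 1 - e(-z) q^(k + 1).\<close>
  define c where "c = ee (of_nat n / 2 + of_nat n * z - \<tau> * (of_nat n * (of_nat n + 1) / 2))"
  have xq: "x * ee \<tau> ^ k = - ee (z + (of_nat k - of_nat n) * \<tau>)" for k
    unfolding x_def ee_of_nat_mult[symmetric]
    using ee_add[of "1 / 2" "z + (of_nat k - of_nat n) * \<tau>"]
    by (simp add: ee_half ee_add[symmetric] algebra_simps)
  have first: "(\<Prod>k<n. 1 + x * ee \<tau> ^ k) = c * (\<Prod>k<n. 1 - ee (- z) * ee \<tau> ^ (k + 1))"
  proof -
    have "(\<Prod>k<n. 1 + x * ee \<tau> ^ k) = (\<Prod>k<n. 1 + x * ee \<tau> ^ (n - Suc k))"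
      by (rule prod.nat_diff_reindex[symmetric])
    also have "\<dots> = (\<Prod>k<n. ee (1 / 2 + z - (of_nat k + 1) * \<tau>) * (1 - ee (- z) * ee \<tau> ^ (k + 1)))"
    proof (rule prod.cong[OF refl])
      fix k assume "k \<in> {..<n}"
      then have "(of_nat (n - Suc k) :: complex) - of_nat n = - (of_nat k + 1)" by (simp add: of_nat_diff)
      then have "z + (of_nat (n - Suc k) - of_nat n) * \<tau> = z - (of_nat k + 1) * \<tau>"
        by (simp only:) (simp add: algebra_simps)
      then have "x * ee \<tau> ^ (n - Suc k) = - ee (z - (of_nat k + 1) * \<tau>)" unfolding xq by (simp only:)
      moreover have "ee (1 / 2 + z - (of_nat k + 1) * \<tau>) = - ee (z - (of_nat k + 1) * \<tau>)"
        using ee_add[of "1 / 2" "z - (of_nat k + 1) * \<tau>"] by (simp add: ee_half add_diff_eq)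
      moreover have "ee (z - (of_nat k + 1) * \<tau>) * (ee (- z) * ee \<tau> ^ (k + 1)) = 1"
        unfolding ee_of_nat_mult[symmetric] ee_add[symmetric] by (simp add: algebra_simps)
      ultimately show "1 + x * ee \<tau> ^ (n - Suc k) =
          ee (1 / 2 + z - (of_nat k + 1) * \<tau>) * (1 - ee (- z) * ee \<tau> ^ (k + 1))"
        by (simp only:) (simp add: algebra_simps)
    qed
    also have "\<dots> = (\<Prod>k<n. ee (1 / 2 + z - (of_nat k + 1) * \<tau>)) * (\<Prod>k<n. 1 - ee (- z) * ee \<tau> ^ (k + 1))"
      by (rule prod.distrib)
    also have "(\<Prod>k<n. ee (1 / 2 + z - (of_nat k + 1) * \<tau>)) = c"
    proof (unfold c_def, induction n)
      case (Suc n)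
      show ?case unfolding prod.lessThan_Suc Suc ee_add[symmetric]
        by (rule arg_cong[where f = ee]) (simp add: field_simps)
    qed simp
    finally show ?thesis .
  qed
  have "(\<Prod>k<2 * n. 1 + x * ee \<tau> ^ k) = (\<Prod>k<n. 1 + x * ee \<tau> ^ k) * (\<Prod>k<n. 1 + x * ee \<tau> ^ (n + k))"
  proof -
    have split: "{..<2 * n} = {..<n} \<union> {n..<n + n}" by auto
    have disj: "{..<n} \<inter> {n..<n + n} = {}" by auto
    have "(\<Prod>k<2 * n. 1 + x * ee \<tau> ^ k) = (\<Prod>k<n. 1 + x * ee \<tau> ^ k) * (\<Prod>k=n..<n + n. 1 + x * ee \<tau> ^ k)"
      unfolding split by (rule prod.union_disjoint[OF _ _ disj]) simp_all
    also have "(\<Prod>k=n..<n + n. 1 + x * ee \<tau> ^ k) = (\<Prod>k<n. 1 + x * ee \<tau> ^ (n + k))"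
      by (rule prod.reindex_bij_witness[where i = "\<lambda>k. n + k" and j = "\<lambda>k. k - n"]) auto
    finally show ?thesis .
  qed
  also have "(\<Prod>k<n. 1 + x * ee \<tau> ^ (n + k)) = (\<Prod>k<n. 1 - ee z * ee \<tau> ^ k)"
    unfolding xq by (simp add: ee_add ee_of_nat_mult)
  finally have "c * ((\<Prod>k<n. 1 - ee (- z) * ee \<tau> ^ (k + 1)) * (\<Prod>k<n. 1 - ee z * ee \<tau> ^ k)) =
      (\<Sum>j\<le>2 * n. ee \<tau> ^ (j choose 2) * qbinom (ee \<tau>) (2 * n) j * x ^ j)"
    unfolding first q_binomial_theorem[OF assms, where n = "2 * n"] by (simp only: mult.assoc)
  then have "- ee (\<tau> / 8 - z / 2) * ((\<Prod>k<n. 1 - ee (- z) * ee \<tau> ^ (k + 1)) * (\<Prod>k<n. 1 - ee z * ee \<tau> ^ k)) =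
      (\<Sum>j\<le>2 * n. - ee (\<tau> / 8 - z / 2) / c * (ee \<tau> ^ (j choose 2) * qbinom (ee \<tau>) (2 * n) j * x ^ j))"
    unfolding sum_distrib_left[symmetric] by (simp add: field_simps c_def)
  also have "\<dots> = (\<Sum>j\<le>2 * n. qbinom (ee \<tau>) (2 * n) j * theta_term \<tau> z (2 * (int j - int n) - 1))"
  proof (rule sum.cong[OF refl])
    fix j
    have ch: "(of_nat (j choose 2) :: complex) = of_nat j * (of_nat j - 1) / 2"
    proof (induction j)
      case (Suc j)
      have "Suc j choose 2 = (j choose 2) + j" by (simp add: numeral_2_eq_2)
      then show ?case using Suc by (simp add: field_simps)
    qed (simp add: numeral_2_eq_2)
    have "ee (\<tau> / 8 - z / 2) / c * (ee \<tau> ^ (j choose 2) * x ^ j) =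
      ee (\<tau> / 8 - z / 2 - (of_nat n / 2 + of_nat n * z - \<tau> * (of_nat n * (of_nat n + 1) / 2)) +
        (of_nat j * (of_nat j - 1) / 2 * \<tau> + of_nat j * (1 / 2 + z - of_nat n * \<tau>)))"
      unfolding x_def c_def ee_of_nat_mult[symmetric] ee_diff[symmetric] ee_add[symmetric] ch ..
    also have "\<dots> = ee (of_int (int j - int n) / 2 + (2 * of_int (int j - int n) - 1)\<^sup>2 / 8 * \<tau> + (2 * of_int (int j - int n) - 1) * z / 2)"
      by (rule arg_cong[where f = ee]) (simp add: power2_eq_square field_simps)
    also have "\<dots> = - theta_term \<tau> z (2 * (int j - int n) - 1)" unfolding theta_term_odd by simp
    finally have e: "ee (\<tau> / 8 - z / 2) / c * (ee \<tau> ^ (j choose 2) * x ^ j) =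
      - theta_term \<tau> z (2 * (int j - int n) - 1)" .
    have "- ee (\<tau> / 8 - z / 2) / c * (ee \<tau> ^ (j choose 2) * qbinom (ee \<tau>) (2 * n) j * x ^ j) =
      - (qbinom (ee \<tau>) (2 * n) j * (ee (\<tau> / 8 - z / 2) / c * (ee \<tau> ^ (j choose 2) * x ^ j)))"
      by (simp add: mult_ac)
    then show "- ee (\<tau> / 8 - z / 2) / c * (ee \<tau> ^ (j choose 2) * qbinom (ee \<tau>) (2 * n) j * x ^ j) =
      qbinom (ee \<tau>) (2 * n) j * theta_term \<tau> z (2 * (int j - int n) - 1)"
      unfolding e by simp
  qed
  finally show ?thesis .
qed

text \<open>The product (x q; q)_\<infinity>. At x = 1 it is \<open>eta\<close> without the factor
  q^(1/24).\<close>

definition euler :: "complex \<Rightarrow> complex \<Rightarrow> complex" where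
  "euler q x = (\<Prod>k. 1 - x * q ^ (k + 1))"

lemma convergent_prod_euler:
  fixes q x :: complex
  shows "norm q < 1 \<Longrightarrow> convergent_prod (\<lambda>k. 1 - x * q ^ (k + 1))"
proof -
  assume "norm q < 1"
  then have "summable (\<lambda>k. norm (x * q) * norm q ^ k)" by (intro summable_mult) (simp add: summable_geometric)
  moreover have "(\<lambda>k. norm (x * q) * norm q ^ k) = (\<lambda>k. norm ((1 - x * q ^ (k + 1)) - 1))"
    by (simp add: fun_eq_iff norm_mult norm_power mult_ac)
  ultimately have "summable (\<lambda>k. norm ((1 - x * q ^ (k + 1)) - 1))" by simp
  then show ?thesis
    by (intro abs_convergent_prod_imp_convergent_prod summable_imp_abs_convergent_prod)
qed

lemma euler_LIMSEQ: "norm q < 1 \<Longrightarrow> (\<lambda>n. \<Prod>k<n. 1 - x * q ^ (k + 1)) \<longlonglongrightarrow> euler q x"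
  unfolding euler_def LIMSEQ_lessThan_iff_atMost
  by (rule convergent_prod_LIMSEQ[OF convergent_prod_euler])

lemma euler_nonzero: "norm q < 1 \<Longrightarrow> (\<And>k. x * q ^ (k + 1) \<noteq> 1) \<Longrightarrow> euler q x \<noteq> 0"
  unfolding euler_def by (rule prodinf_nonzero[OF convergent_prod_euler]) auto

lemma euler_1_nonzero: "norm q < 1 \<Longrightarrow> euler q 1 \<noteq> 0"
  using qpoch_nonzero[of q] by (intro euler_nonzero) (auto simp: qpoch_def)

lemma qpoch_LIMSEQ: "norm q < 1 \<Longrightarrow> qpoch q \<longlonglongrightarrow> euler q 1"
  using euler_LIMSEQ[of q 1] by (simp add: qpoch_def[abs_def])

lemma theta_odd_has_sum:
  assumes "\<tau> \<in> uhp"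
  shows "((\<lambda>i. theta_term \<tau> z (2 * i - 1)) has_sum theta \<tau> z) UNIV"
proof -
  have "(theta_term \<tau> z has_sum theta \<tau> z) (range (\<lambda>i. 2 * i - 1))"
  proof (subst has_sum_cong_neutral[where T = UNIV and g = "theta_term \<tau> z"])
    fix r :: int assume "r \<in> UNIV - range (\<lambda>i. 2 * i - 1)"
    then have "\<And>i. r \<noteq> 2 * i - 1" by auto
    then have "even r" by presburger
    then show "theta_term \<tau> z r = 0" by (simp add: theta_term_def kronecker_m4_even)
  qed (use theta_term_has_sum[OF assms] in auto)
  then show ?thesis by (subst (asm) has_sum_reindex) (auto simp: inj_on_def o_def)
qed

text \<open>The limit of \<open>finite_triple_product\<close>. The Gaussian binomials are uniformly
  bounded and tend to 1 / L for L = \<open>euler q 1\<close>, so Tannery's theorem exchanges limit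
  and sum.\<close>

lemma theta_product:
  assumes \<tau>: "\<tau> \<in> uhp"
  shows "theta \<tau> z = ee (\<tau> / 8) * (ee (z / 2) - ee (- z / 2)) *
    (euler (ee \<tau>) 1 * euler (ee \<tau>) (ee z) * euler (ee \<tau>) (ee (- z)))"
proof -
  define q where "q = ee \<tau>"
  have q: "norm q < 1" using norm_ee_less_1[OF \<tau>] by (simp add: q_def)
  define L where "L = euler q 1"
  have L: "L \<noteq> 0" using euler_1_nonzero[OF q] by (simp add: L_def)
  define i where "i = (\<lambda>k. int_decode k)"
  \<comment> \<open>The coefficients along an enumeration of the integers, extended by 0 outside
    -n..n, so that the index set does not vary with n.\<close>
  define b where "b = (\<lambda>k n. if \<bar>i k\<bar> \<le> int n then qbinom q (2 * n) (nat (i k + int n)) else 0)"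
  obtain B1 where B1: "\<And>n. norm (qpoch q n) \<le> B1"
    using convergent_imp_Bseq[of "qpoch q"] qpoch_LIMSEQ[OF q] by (metis Bseq_def convergentI)
  have inv: "(\<lambda>n. inverse (qpoch q n)) \<longlonglongrightarrow> inverse L"
    unfolding L_def by (rule tendsto_inverse[OF qpoch_LIMSEQ[OF q]]) (use L L_def in simp)
  obtain B2 where B2: "\<And>n. norm (inverse (qpoch q n)) \<le> B2"
    using convergent_imp_Bseq[of "\<lambda>n. inverse (qpoch q n)"] inv by (metis Bseq_def convergentI)
  have B0: "0 \<le> B1" "0 \<le> B2" using B1[of 0] B2[of 0] norm_ge_zero order_trans by blast+
  have b_le: "norm (b k n) \<le> B1 * (B2 * B2)" for k n
  proof -
    have "norm (qbinom q m j) \<le> B1 * (B2 * B2)" for m j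
      unfolding qbinom_def divide_inverse inverse_mult_distrib norm_mult
      using B1 B2 B0 by (intro mult_mono) auto
    then show ?thesis using B0 by (auto simp: b_def)
  qed
  have b_lim: "b k \<longlonglongrightarrow> inverse L" for k
  proof -
    have f1: "filterlim (\<lambda>n. nat (i k + int n)) sequentially sequentially"
      unfolding filterlim_at_top eventually_sequentially
    proof
      fix Z
      show "\<exists>N. \<forall>n\<ge>N. Z \<le> nat (i k + int n)"
        by (rule exI[of _ "Z + nat \<bar>i k\<bar>"]) auto
    qed
    have f2: "filterlim (\<lambda>n. 2 * n - nat (i k + int n)) sequentially sequentially"
      unfolding filterlim_at_top eventually_sequentially
    proof
      fix Z
      show "\<exists>N. \<forall>n\<ge>N. Z \<le> 2 * n - nat (i k + int n)"
        by (rule exI[of _ "Z + nat \<bar>i k\<bar>"]) auto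
    qed
    have f3: "filterlim (\<lambda>n. 2 * n :: nat) sequentially sequentially"
      by (rule filterlim_subseq) (auto simp: strict_mono_def)
    have lim: "(\<lambda>n. qpoch q (2 * n) * (inverse (qpoch q (nat (i k + int n))) * inverse (qpoch q (2 * n - nat (i k + int n)))))
        \<longlonglongrightarrow> L * (inverse L * inverse L)"
      using qpoch_LIMSEQ[OF q] inv f1 f2 f3 unfolding L_def[symmetric]
      by (intro tendsto_mult) (auto intro: filterlim_compose)
    have "\<forall>\<^sub>F n in sequentially. qpoch q (2 * n) * (inverse (qpoch q (nat (i k + int n))) * inverse (qpoch q (2 * n - nat (i k + int n)))) = b k n"
      unfolding eventually_sequentially
      by (rule exI[of _ "nat \<bar>i k\<bar>"]) (auto simp: b_def qbinom_def divide_inverse)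
    from Lim_transform_eventually[OF lim this] have "b k \<longlonglongrightarrow> L * (inverse L * inverse L)" .
    moreover have "L * (inverse L * inverse L) = inverse L" using L by (simp add: mult.assoc[symmetric])
    ultimately show ?thesis by (simp only:)
  qed
  let ?t = "\<lambda>k. theta_term \<tau> z (2 * i k - 1)"
  have ts: "summable (\<lambda>k. norm (?t k))"
  proof -
    have "(\<lambda>j. norm (theta_term \<tau> z (2 * j - 1))) summable_on UNIV"
      using summable_on_reindex[of "\<lambda>j::int. 2 * j - 1" UNIV "\<lambda>r. norm (theta_term \<tau> z r)"]
        summable_on_subset_banach[OF theta_term_abs_summable[OF \<tau>, of z] subset_UNIV]
      by (auto simp: inj_on_def o_def)
    then have "(\<lambda>k. norm (theta_term \<tau> z (2 * int_decode k - 1))) summable_on UNIV"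
      using summable_on_reindex_bij_betw[OF bij_int_decode, of "\<lambda>j. norm (theta_term \<tau> z (2 * j - 1))"] by simp
    then show ?thesis unfolding i_def by (rule summable_on_imp_summable)
  qed
  have "(\<lambda>n. \<Sum>k. b k n * ?t k) \<longlonglongrightarrow> (\<Sum>k. inverse L * ?t k)"
  proof (rule tannerys_theorem[THEN conjunct2, THEN conjunct2])
    show "(\<lambda>n. b k n * ?t k) \<longlonglongrightarrow> inverse L * ?t k" for k
      by (intro tendsto_mult b_lim tendsto_const)
    show "\<forall>\<^sub>F (k, n) in at_top \<times>\<^sub>F sequentially. norm (b k n * ?t k) \<le> B1 * (B2 * B2) * norm (?t k)"
      using b_le by (intro always_eventually) (auto simp: norm_mult intro!: mult_right_mono)
    show "summable (\<lambda>k. B1 * (B2 * B2) * norm (?t k))" by (rule summable_mult[OF ts])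
  qed auto
  also have "(\<Sum>k. inverse L * ?t k) = inverse L * theta \<tau> z"
  proof -
    have "?t sums theta \<tau> z"
      using theta_odd_has_sum[OF \<tau>, of z]
        has_sum_reindex_bij_betw[OF bij_int_decode, of "\<lambda>i. theta_term \<tau> z (2 * i - 1)"]
      unfolding i_def by (intro has_sum_imp_sums) auto
    then show ?thesis by (metis sums_mult sums_unique)
  qed
  finally have lim1: "(\<lambda>n. \<Sum>k. b k n * ?t k) \<longlonglongrightarrow> inverse L * theta \<tau> z" .
  have partial: "(\<Sum>k. b k n * ?t k) = - ee (\<tau> / 8 - z / 2) *
      ((\<Prod>k<n. 1 - ee (- z) * q ^ (k + 1)) * (\<Prod>k<n. 1 - ee z * q ^ k))" for n
  proof -
    define g where "g = (\<lambda>j::int. (if \<bar>j\<bar> \<le> int n then qbinom q (2 * n) (nat (j + int n)) else 0) * theta_term \<tau> z (2 * j - 1))"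
    have "(g has_sum (\<Sum>j\<in>{- int n..int n}. g j)) {- int n..int n}" by (rule has_sum_finite) simp
    then have "(g has_sum (\<Sum>j\<in>{- int n..int n}. g j)) UNIV"
      by (subst (asm) has_sum_cong_neutral[where T = UNIV and g = g]) (auto simp: g_def)
    then have "(\<lambda>k. g (int_decode k)) sums (\<Sum>j\<in>{- int n..int n}. g j)"
      using has_sum_reindex_bij_betw[OF bij_int_decode, of g] by (intro has_sum_imp_sums) auto
    then have "(\<Sum>k. b k n * ?t k) = (\<Sum>j\<in>{- int n..int n}. g j)"
      unfolding b_def g_def i_def by (rule sums_unique[symmetric])
    also have "\<dots> = (\<Sum>j\<le>2 * n. g (int j - int n))"
      by (rule sum.reindex_bij_witness[where i = "\<lambda>j. int j - int n" and j = "\<lambda>j. nat (j + int n)"]) auto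
    also have "\<dots> = (\<Sum>j\<le>2 * n. qbinom q (2 * n) j * theta_term \<tau> z (2 * (int j - int n) - 1))"
      by (rule sum.cong) (auto simp: g_def)
    also have "\<dots> = - ee (\<tau> / 8 - z / 2) *
      ((\<Prod>k<n. 1 - ee (- z) * q ^ (k + 1)) * (\<Prod>k<n. 1 - ee z * q ^ k))"
      using finite_triple_product[of \<tau> z n] q unfolding q_def by simp
    finally show ?thesis .
  qed
  \<comment> \<open>The exponents start at 0 here but at 1 in \<open>euler\<close>: the split-off
    factor 1 - e(z) becomes e(z/2) - e(-z/2) below.\<close>
  have "(\<lambda>n. \<Prod>k<n. 1 - ee z * q ^ k) \<longlonglongrightarrow> (1 - ee z) * euler q (ee z)"
  proof (rule LIMSEQ_imp_Suc)
    show "(\<lambda>n. \<Prod>k<Suc n. 1 - ee z * q ^ k) \<longlonglongrightarrow> (1 - ee z) * euler q (ee z)"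
      using tendsto_mult[OF tendsto_const euler_LIMSEQ[OF q, of "ee z"], of "1 - ee z"]
      by (simp only: prod.lessThan_Suc_shift) simp
  qed
  then have "(\<lambda>n. \<Sum>k. b k n * ?t k) \<longlonglongrightarrow>
      - ee (\<tau> / 8 - z / 2) * (euler q (ee (- z)) * ((1 - ee z) * euler q (ee z)))"
    unfolding partial by (intro tendsto_mult tendsto_const euler_LIMSEQ q)
  from LIMSEQ_unique[OF lim1 this] have "theta \<tau> z =
      L * (- ee (\<tau> / 8 - z / 2) * (euler q (ee (- z)) * ((1 - ee z) * euler q (ee z))))"
    using L by (simp add: field_simps)
  then have "theta \<tau> z = (- ee (\<tau> / 8 - z / 2) * (1 - ee z)) * (L * euler q (ee z) * euler q (ee (- z)))"
    by (simp only: mult_ac)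
  also have "- ee (\<tau> / 8 - z / 2) * (1 - ee z) = ee (\<tau> / 8) * (ee (z / 2) - ee (- z / 2))"
    using ee_add[of "\<tau> / 8" "- z / 2"] ee_add[of "- z / 2" z] by (simp add: algebra_simps)
  finally show ?thesis unfolding L_def q_def .
qed

subsection \<open>Zeros and quasi-periods\<close>

text \<open>Serves for \<open>euler\<close> both as a function of x and as a function of q; a
  geometric majorant is available only locally.\<close>

lemma holomorphic_prodinf:
  fixes f :: "nat \<Rightarrow> complex \<Rightarrow> complex"
  assumes "open S" and hol: "\<And>k. f k holomorphic_on S"
    and bound: "\<And>x. x \<in> S \<Longrightarrow> \<exists>d>0. \<exists>M. cball x d \<subseteq> S \<and> summable M \<and> (\<forall>k. \<forall>y\<in>cball x d. norm (f k y - 1) \<le> M k)"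
  shows "(\<lambda>x. \<Prod>k. f k x) holomorphic_on S"
proof (rule holomorphic_uniform_sequence[OF \<open>open S\<close>])
  show "(\<lambda>x. \<Prod>k<n. f k x) holomorphic_on S" for n
    using hol by (intro holomorphic_intros)
  fix x assume "x \<in> S"
  from bound[OF this] obtain d M where d: "0 < d" "cball x d \<subseteq> S" "summable M"
    and "\<forall>k. \<forall>y\<in>cball x d. norm (f k y - 1) \<le> M k"
    by blast
  then have M: "norm (f k y - 1) \<le> M k" if "y \<in> cball x d" for k y using that by blast
  have "uniformly_convergent_on (cball x d) (\<lambda>N y. \<Sum>n<N. norm (f n y - 1))"
    by (rule Weierstrass_m_test'[OF _ d(3)]) (use M in simp)
  then have "uniformly_convergent_on (cball x d) (\<lambda>N y. \<Prod>n<N. f n y)"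
    using holomorphic_on_imp_continuous_on[OF hol] d(2)
    by (intro uniformly_convergent_on_prod') (auto intro: continuous_on_subset)
  then have "uniform_limit (cball x d) (\<lambda>N y. \<Prod>n<N. f n y) (\<lambda>y. lim (\<lambda>N. \<Prod>n<N. f n y)) sequentially"
    by (simp add: uniformly_convergent_uniform_limit_iff)
  also have "?this \<longleftrightarrow> uniform_limit (cball x d) (\<lambda>N y. \<Prod>n<N. f n y) (\<lambda>y. \<Prod>k. f k y) sequentially"
  proof (rule uniform_limit_cong')
    fix y assume y: "y \<in> cball x d"
    have "summable (\<lambda>k. norm (f k y - 1))"
      using M[OF y] by (intro summable_comparison_test'[OF d(3)]) auto
    then have "convergent_prod (\<lambda>k. f k y)"
      by (intro abs_convergent_prod_imp_convergent_prod summable_imp_abs_convergent_prod)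
    then have "(\<lambda>N. \<Prod>n<N. f n y) \<longlonglongrightarrow> (\<Prod>k. f k y)"
      unfolding LIMSEQ_lessThan_iff_atMost by (rule convergent_prod_LIMSEQ)
    then show "lim (\<lambda>N. \<Prod>n<N. f n y) = (\<Prod>k. f k y)" by (rule limI)
  qed auto
  finally show "\<exists>d>0. cball x d \<subseteq> S \<and> uniform_limit (cball x d) (\<lambda>N y. \<Prod>n<N. f n y) (\<lambda>y. \<Prod>k. f k y) sequentially"
    using d by blast
qed

lemma summable_geometric_Suc: "0 \<le> r \<Longrightarrow> r < 1 \<Longrightarrow> summable (\<lambda>k. B * (r::real) ^ (k + 1))"
  by (intro summable_mult) (simp add: summable_geometric)

lemma euler_holomorphic:
  assumes q: "norm q < 1"
  shows "euler q holomorphic_on UNIV"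
  unfolding euler_def[abs_def]
proof (rule holomorphic_prodinf)
  fix x :: complex
  have "norm (1 - y * q ^ (k + 1) - 1) \<le> (norm x + 1) * norm q ^ (k + 1)" if "y \<in> cball x 1" for k y
  proof -
    have "norm y \<le> norm x + 1" using that norm_triangle_sub[of y x] by (simp add: dist_norm norm_minus_commute)
    then have "norm y * norm q ^ (k + 1) \<le> (norm x + 1) * norm q ^ (k + 1)" by (intro mult_right_mono) auto
    then show ?thesis by (simp add: norm_mult norm_power)
  qed
  then show "\<exists>d>0. \<exists>M. cball x d \<subseteq> UNIV \<and> summable M \<and> (\<forall>k. \<forall>y\<in>cball x d. norm (1 - y * q ^ (k + 1) - 1) \<le> M k)"
    using summable_geometric_Suc[OF norm_ge_zero q] by (intro exI[of _ 1] conjI exI[of _ "\<lambda>k. (norm x + 1) * norm q ^ (k + 1)"]) auto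
qed (auto intro!: holomorphic_intros)

lemma euler_1_holomorphic: "(\<lambda>q. euler q 1) holomorphic_on ball 0 1"
  unfolding euler_def[abs_def]
proof (rule holomorphic_prodinf)
  fix x :: complex assume x: "x \<in> ball 0 1"
  define d where "d = (1 - norm x) / 2"
  define r where "r = norm x + d"
  have d: "0 < d" "0 \<le> r" "r < 1" using x by (auto simp: d_def r_def field_simps)
  have r: "norm y \<le> r" if "y \<in> cball x d" for y
    using that norm_triangle_sub[of y x] by (simp add: r_def dist_norm norm_minus_commute)
  have "cball x d \<subseteq> ball 0 1" using r d by force
  moreover have "norm (1 - 1 * y ^ (k + 1) - 1) \<le> 1 * r ^ (k + 1)" if "y \<in> cball x d" for k y
    using power_mono[OF r[OF that] norm_ge_zero, of "k + 1"] by (simp add: norm_mult norm_power)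
  ultimately show "\<exists>d>0. \<exists>M. cball x d \<subseteq> ball 0 1 \<and> summable M \<and> (\<forall>k. \<forall>y\<in>cball x d. norm (1 - 1 * y ^ (k + 1) - 1) \<le> M k)"
    using summable_geometric_Suc[OF d(2,3), of 1] d(1) by (intro exI[of _ d] conjI exI[of _ "\<lambda>k. 1 * r ^ (k + 1)"]) auto
qed (auto intro!: holomorphic_intros)

section \<open>The eta function, and the zeros of theta\<close>

lemma eta_eq: "eta \<tau> = ee (\<tau> / 24) * euler (ee \<tau>) 1"
  by (simp add: eta_def euler_def)

lemma eta_nonzero: "\<tau> \<in> uhp \<Longrightarrow> eta \<tau> \<noteq> 0"
  by (simp add: eta_eq euler_1_nonzero norm_ee_less_1)

lemma open_uhp: "open uhp"
  unfolding uhp_def by (rule open_halfspace_Im_gt)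

lemma eta_holomorphic: "eta holomorphic_on uhp"
proof -
  have "(\<lambda>q. euler q 1) \<circ> ee holomorphic_on uhp"
    by (rule holomorphic_on_compose_gen[OF _ euler_1_holomorphic])
      (auto intro!: holomorphic_intros simp: norm_ee_less_1)
  then show ?thesis unfolding eta_eq[abs_def] o_def by (intro holomorphic_intros)  auto
qed

text \<open>In the product the factor e(z/2) - e(-z/2) carries the zero, so the other factors enter
  only by their value at 0, the cube of \<open>euler q 1\<close>.\<close>

lemma theta_has_field_derivative_0:
  assumes \<tau>: "\<tau> \<in> uhp"
  shows "(theta \<tau> has_field_derivative 2 * of_real pi * \<i> * eta \<tau> ^ 3) (at 0)"
proof -
  let ?h = "\<lambda>z. euler (ee \<tau>) 1 * euler (ee \<tau>) (ee z) * euler (ee \<tau>) (ee (- z))"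
  have q: "norm (ee \<tau>) < 1" using norm_ee_less_1[OF \<tau>] .
  have "(\<lambda>z. euler (ee \<tau>) (ee (s * z))) holomorphic_on UNIV" for s
    using holomorphic_on_compose_gen[OF _ euler_holomorphic[OF q], of "\<lambda>z. ee (s * z)" UNIV]
    by (auto simp: o_def intro!: holomorphic_intros)
  from this[of 1] this[of "-1"] have "?h holomorphic_on UNIV"
    by (intro holomorphic_intros) auto
  then obtain D where D: "(?h has_field_derivative D) (at 0)"
    using holomorphic_on_imp_differentiable_at[of ?h UNIV 0] by (auto simp: field_differentiable_def)
  have "((\<lambda>z. ee (\<tau> / 8) * (ee (z / 2) - ee (- z / 2))) has_field_derivative (ee (\<tau> / 8) * (2 * of_real pi * \<i>))) (at 0)"
    by (auto intro!: derivative_eq_intros)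
  from DERIV_mult[OF this D]
  have "((\<lambda>z. ee (\<tau> / 8) * (ee (z / 2) - ee (- z / 2)) * ?h z) has_field_derivative
      ee (\<tau> / 8) * (2 * of_real pi * \<i>) * ?h 0) (at 0)"
    by (rule DERIV_cong) simp
  moreover have "ee (\<tau> / 8) = ee (\<tau> / 24) ^ 3" unfolding ee_of_nat_mult[symmetric] by simp
  then have "ee (\<tau> / 8) * (2 * of_real pi * \<i>) * ?h 0 = 2 * of_real pi * \<i> * eta \<tau> ^ 3"
    by (simp add: eta_eq power_mult_distrib power3_eq_cube)
  ultimately show ?thesis using theta_product[OF \<tau>] by (simp only: theta_product[OF \<tau>, abs_def])
qed

text \<open>The three factors of the product that depend on z vanish only at lattice points with l =
  0, l < 0 and l > 0 respectively.\<close>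

lemma theta_eq_0D:
  assumes \<tau>: "\<tau> \<in> uhp" and "theta \<tau> z = 0"
  obtains l m :: int where "z = of_int l * \<tau> + of_int m"
proof -
  have q: "norm (ee \<tau>) < 1" using norm_ee_less_1[OF \<tau>] .
  have "ee (z / 2) = ee (- z / 2) \<or> euler (ee \<tau>) (ee z) = 0 \<or> euler (ee \<tau>) (ee (- z)) = 0"
    using assms(2) euler_1_nonzero[OF q] unfolding theta_product[OF \<tau>] by auto
  then consider "ee (z / 2) = ee (- z / 2)" | k where "ee z * ee \<tau> ^ (k + 1) = 1" | k where "ee (- z) * ee \<tau> ^ (k + 1) = 1"
    using euler_nonzero[OF q, of "ee z"] euler_nonzero[OF q, of "ee (- z)"] by blast
  then show ?thesis
  proof cases
    case 1
    then obtain n :: int where "z / 2 = - z / 2 + of_int n" unfolding ee_eq_iff by blast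
    then have "z = of_int 0 * \<tau> + of_int n" by (simp add: field_simps)
    then show ?thesis by (rule that)
  next
    case 2
    then have "ee (z + of_nat (k + 1) * \<tau>) = ee 0" unfolding ee_add ee_of_nat_mult by simp
    then obtain n :: int where "z + of_nat (k + 1) * \<tau> = 0 + of_int n" unfolding ee_eq_iff by blast
    then have "z = of_int (- int (k + 1)) * \<tau> + of_int n" by (simp add: algebra_simps)
    then show ?thesis by (rule that)
  next
    case 3
    then have "ee (- z + of_nat (k + 1) * \<tau>) = ee 0" unfolding ee_add ee_of_nat_mult by simp
    then obtain n :: int where "- z + of_nat (k + 1) * \<tau> = 0 + of_int n" unfolding ee_eq_iff by blast
    then have "z = of_int (int (k + 1)) * \<tau> + of_int (- n)" by (simp add: algebra_simps)
    then show ?thesis by (rule that)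
  qed
qed

lemma elliptic_entire_constant:
  assumes \<tau>: "\<tau> \<in> uhp" and hol: "h holomorphic_on UNIV"
    and per: "\<And>z. h (z + 1) = h z" "\<And>z. h (z + \<tau>) = h z"
  shows "h z = h 0"
proof -
  interpret p1: periodic_fun_simple h 1 by standard (rule per)
  interpret p2: periodic_fun_simple h \<tau> by standard (rule per)
  define K where "K = (\<lambda>p :: real \<times> real. of_real (fst p) + of_real (snd p) * \<tau>) ` ({0..1} \<times> {0..1})"
  have "compact K"
    unfolding K_def by (intro compact_continuous_image compact_Times continuous_intros) auto
  then have "compact (h ` K)"
    using holomorphic_on_imp_continuous_on[OF hol] by (intro compact_continuous_image) (auto intro: continuous_on_subset)
  moreover have "range h \<subseteq> h ` K"
  proof
    fix y assume "y \<in> range h"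
    then obtain z where y: "y = h z" by blast
    define t where "t = Im z / Im \<tau>"
    define s where "s = Re (z - of_real t * \<tau>)"
    have "z = of_real s + of_real t * \<tau>"
      using \<tau> by (simp add: complex_eq_iff s_def t_def uhp_def)
    also have "\<dots> = of_real (frac s) + of_real (frac t) * \<tau> + of_int \<lfloor>s\<rfloor> * 1 + of_int \<lfloor>t\<rfloor> * \<tau>"
      by (simp add: frac_def algebra_simps)
    finally have "h z = h (of_real (frac s) + of_real (frac t) * \<tau>)"
      by (simp only: p2.plus_of_int p1.plus_of_int)
    moreover have "of_real (frac s) + of_real (frac t) * \<tau> \<in> K"
      unfolding K_def by (rule image_eqI[of _ _ "(frac s, frac t)"]) (auto simp: frac_lt_1 less_imp_le)
    ultimately show "y \<in> h ` K" unfolding y by simp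
  qed
  ultimately have "bounded (range h)" by (meson bounded_subset compact_imp_bounded)
  then have "h constant_on UNIV" by (rule Liouville_theorem[OF hol])
  then show ?thesis by (auto simp: constant_on_def)
qed

text \<open>The quotient of two functions with the quasi-periods of \<open>theta \<tau>\<close> is elliptic, and it has
  no poles as the zeros of \<open>theta \<tau>\<close> are simple and form a single orbit of the period lattice.\<close>

lemma theta_unique:
  assumes \<tau>: "\<tau> \<in> uhp" and hol: "g holomorphic_on UNIV"
    and g0: "g 0 = 0" and g': "(g has_field_derivative D) (at 0)"
    and per: "\<And>z. g (z + 1) = - g z" "\<And>z. g (z + \<tau>) = - ee (- \<tau> / 2 - z) * g z"
  shows "2 * of_real pi * \<i> * eta \<tau> ^ 3 * g z = D * theta \<tau> z"
proof -
  define D0 where "D0 = 2 * of_real pi * \<i> * eta \<tau> ^ 3"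
  have D0: "D0 \<noteq> 0" using eta_nonzero[OF \<tau>] by (simp add: D0_def)
  let ?t = "theta \<tau>"
  have tper: "?t (z + 1) = - ?t z" "?t (z + \<tau>) = - ee (- \<tau> / 2 - z) * ?t z" for z
  proof -
    show "?t (z + 1) = - ?t z" using theta_shift[of \<tau> z 0 1] by (simp add: ee_half)
    have "?t (z + \<tau>) = ee (1 / 2 - \<tau> / 2 - z) * ?t z" using theta_shift[of \<tau> z 1 0] by simp
    also have "1 / 2 - \<tau> / 2 - z = 1 / 2 + (- \<tau> / 2 - z)" by simp
    finally show "?t (z + \<tau>) = - ee (- \<tau> / 2 - z) * ?t z" unfolding ee_add[of "1 / 2"] ee_half by simp
  qed
  have hol_t: "?t holomorphic_on S" for S by (rule theta_holomorphic[OF \<tau>])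
  have t0: "((\<lambda>z. ?t z / z) \<longlongrightarrow> D0) (at 0)" "((\<lambda>z. g z / z) \<longlongrightarrow> D) (at 0)"
    using theta_has_field_derivative_0[OF \<tau>] g' g0 by (simp_all add: has_field_derivative_iff D0_def)
  have ev: "\<forall>\<^sub>F z in at 0. ?t z \<noteq> 0"
    using tendsto_imp_eventually_ne[OF t0(1) D0] by eventually_elim auto
  \<comment> \<open>D / D0 is the limit of the quotient at 0; assigning it at all zeros keeps h
    periodic.\<close>
  define h where "h = (\<lambda>z. if ?t z = 0 then D / D0 else g z / ?t z)"
  have per_h: "h (z + 1) = h z" "h (z + \<tau>) = h z" for z
    by (simp_all add: h_def tper per)
  have lim: "(h \<longlongrightarrow> h 0) (at 0)"
  proof -
    have "((\<lambda>z. (g z / z) / (?t z / z)) \<longlongrightarrow> D / D0) (at 0)"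
      by (intro tendsto_divide t0 D0)
    moreover have "\<forall>\<^sub>F z in at 0. (g z / z) / (?t z / z) = h z"
      using ev eventually_neq_at_within[of 0 0] by eventually_elim (auto simp: h_def)
    ultimately have "(h \<longlongrightarrow> D / D0) (at 0)" by (rule Lim_transform_eventually)
    then show ?thesis by (simp add: h_def)
  qed
  have diff: "h field_differentiable at z" if "?t z \<noteq> 0" for z
  proof -
    have op: "open {z. ?t z \<noteq> 0}"
      using open_vimage[of "- {0}" ?t] holomorphic_on_imp_continuous_on[OF hol_t[of UNIV]]
      by (auto simp: vimage_def open_Compl)
    have "(\<lambda>z. g z / ?t z) holomorphic_on {z. ?t z \<noteq> 0}"
      using hol by (intro holomorphic_intros hol_t) (auto intro: holomorphic_on_subset)
    then have "h holomorphic_on {z. ?t z \<noteq> 0}"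
      by (rule holomorphic_transform) (auto simp: h_def)
    then show ?thesis using holomorphic_on_imp_differentiable_at[OF _ op] that by blast
  qed
  have diff0: "h field_differentiable at 0"
  proof -
    obtain e where e: "0 < e" "\<And>z. z \<in> ball (0 :: complex) e - {0} \<Longrightarrow> ?t z \<noteq> 0"
      using ev unfolding eventually_at by (auto simp: dist_commute)
    have "continuous_on (ball (0 :: complex) e) h"
    proof (rule continuous_at_imp_continuous_on, rule ballI)
      fix z :: complex assume "z \<in> ball 0 e"
      then show "isCont h z"
        using lim field_differentiable_imp_continuous_at[OF diff[of z]] e(2)[of z]
        by (cases "z = 0") (simp_all add: isCont_def)
    qed
    moreover have "h holomorphic_on (ball 0 e - {0})"
      unfolding holomorphic_on_def using diff e(2) by (auto intro: field_differentiable_at_within)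
    ultimately have "h holomorphic_on ball 0 e"
      by (rule no_isolated_singularity) auto
    then show ?thesis using holomorphic_on_imp_differentiable_at e(1) by (metis centre_in_ball open_ball)
  qed
  interpret p1: periodic_fun_simple h 1 by standard (rule per_h)
  interpret p2: periodic_fun_simple h \<tau> by standard (rule per_h)
  have "h field_differentiable at z" for z
  proof (cases "?t z = 0")
    case True
    then obtain l m :: int where z: "z = of_int l * \<tau> + of_int m" using theta_eq_0D[OF \<tau>] by blast
    \<comment> \<open>Every zero is a period, so translation reduces the claim to the removable
      singularity at 0.\<close>
    have "h w = h (w - z)" for w
    proof -
      have "h w = h ((w - z) + of_int m * 1 + of_int l * \<tau>)" by (simp add: z)
      then show ?thesis by (simp only: p1.plus_of_int p2.plus_of_int)
    qed
    then have "h = h \<circ> (\<lambda>w. w - z)" by (simp add: fun_eq_iff)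
    moreover have "(h \<circ> (\<lambda>w. w - z)) field_differentiable at z"
      by (rule field_differentiable_compose) (use diff0 in \<open>auto intro!: derivative_intros\<close>)
    ultimately show ?thesis by simp
  qed (rule diff)
  then have "h holomorphic_on UNIV" by (simp add: holomorphic_on_def field_differentiable_at_within)
  from elliptic_entire_constant[OF \<tau> this per_h] have const: "h z = D / D0" for z by (simp add: h_def)
  \<comment> \<open>At a zero of theta the constancy of h does not speak about g; there g vanishes
    because g 0 = 0 and its zero set is periodic.\<close>
  show ?thesis
  proof (cases "?t z = 0")
    case False
    then show ?thesis using const[of z] D0 by (simp add: h_def D0_def field_simps)
  next
    case True
    then obtain l m :: int where z: "z = of_int l * \<tau> + of_int m" using theta_eq_0D[OF \<tau>] by blast
    have "g z = 0"
    proof -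
      interpret p1': periodic_fun_simple "\<lambda>z. g z = 0" 1 by standard (simp add: per)
      interpret p2': periodic_fun_simple "\<lambda>z. g z = 0" \<tau> by standard (simp add: per)
      have "z = 0 + of_int m * 1 + of_int l * \<tau>" by (simp add: z)
      then show ?thesis using g0 by (simp only: p1'.plus_of_int p2'.plus_of_int)
    qed
    then show ?thesis using True by simp
  qed
qed

subsection \<open>Modular transformation\<close>

definition moebius_den :: "int \<Rightarrow> int \<Rightarrow> complex \<Rightarrow> complex" where
  "moebius_den c d \<tau> = of_int c * \<tau> + of_int d"

definition moebius_act :: "int \<Rightarrow> int \<Rightarrow> int \<Rightarrow> int \<Rightarrow> complex \<Rightarrow> complex" where
  "moebius_act a b c d \<tau> = (of_int a * \<tau> + of_int b) / (of_int c * \<tau> + of_int d)"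

lemma moebius_den_nonzero:
  assumes "a * d - b * c = (1 :: int)" "\<tau> \<in> uhp"
  shows "moebius_den c d \<tau> \<noteq> 0"
proof
  assume 0: "moebius_den c d \<tau> = 0"
  then have "of_int c * Im \<tau> = 0" by (simp add: moebius_den_def complex_eq_iff)
  then have "c = 0" using assms(2) by (auto simp: uhp_def)
  with 0 have "d = 0" by (simp add: moebius_den_def)
  then show False using \<open>c = 0\<close> assms by simp
qed

lemma moebius_act_uhp:
  assumes "a * d - b * c = 1" "\<tau> \<in> uhp"
  shows "moebius_act a b c d \<tau> \<in> uhp"
proof -
  let ?j = "moebius_den c d \<tau>"
  have j: "?j \<noteq> 0" using moebius_den_nonzero[OF assms] .
  have "Im ((of_int a * \<tau> + of_int b) * cnj ?j) = of_int (a * d - b * c) * Im \<tau>"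
    by (simp add: moebius_den_def algebra_simps)
  then have "0 < Im ((of_int a * \<tau> + of_int b) * cnj ?j)" using assms by (simp add: uhp_def)
  then have "0 < Im ((of_int a * \<tau> + of_int b) * cnj ?j) / (norm ?j)\<^sup>2" using j by simp
  also have "\<dots> = Im (moebius_act a b c d \<tau>)"
    unfolding moebius_act_def moebius_den_def[symmetric] by (subst complex_div_cnj) simp
  finally show ?thesis by (simp add: uhp_def)
qed

lemma ee_minus_half_odd: "odd k \<Longrightarrow> ee (of_int k / 2) = -1"
  by (auto elim!: oddE simp: add_divide_distrib ee_add ee_half)

text \<open>No column of a unimodular matrix is even, and a + c + a c = (1 + a)(1 + c) - 1. These
  numbers are the exponents of the signs in \<open>per1\<close> and \<open>per2\<close>
  below.\<close>

lemma odd_unimodular: "a * d - b * c = (1::int) \<Longrightarrow> odd (a + c + a * c) \<and> odd (b + d + b * d)"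
  by (metis even_add even_diff even_mult_iff odd_one)

text \<open>Stripped of its Gaussian factor, theta \<tau>' (z / j) has the quasi-periods of theta
  \<tau>. So \<open>theta_unique\<close> applies, and the constant is the quotient of the
  derivatives at 0.\<close>

lemma theta_modular:
  assumes A: "a * d - b * c = 1" and \<tau>: "\<tau> \<in> uhp"
  defines "\<tau>' \<equiv> moebius_act a b c d \<tau>" and "j \<equiv> moebius_den c d \<tau>"
  shows "theta \<tau>' (z / j) =
    ee (of_int c * (z\<^sup>2 / 2) / j) * inverse j * (eta \<tau>' / eta \<tau>) ^ 3 * theta \<tau> z"
proof -
  have j: "j \<noteq> 0" unfolding j_def by (rule moebius_den_nonzero[OF A \<tau>])
  have \<tau>': "\<tau>' \<in> uhp" unfolding \<tau>'_def by (rule moebius_act_uhp[OF A \<tau>])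
  have \<tau>'_eq: "\<tau>' = (of_int a * \<tau> + of_int b) / j" by (simp add: \<tau>'_def moebius_act_def j_def moebius_den_def)
  have Ac: "of_int a * of_int d - of_int b * of_int c = (1 :: complex)"
    unfolding of_int_mult[symmetric] of_int_diff[symmetric] A by simp
  define g where "g = (\<lambda>z. ee (- of_int c * (z\<^sup>2 / 2) / j) * theta \<tau>' (z / j))"
  have shift: "g (z + w) = ee ((of_int l + of_int m) / 2 - (of_int l)\<^sup>2 * \<tau>' / 2 - of_int l * (z / j) - of_int c * ((2 * z * w + w\<^sup>2) / 2) / j) * g z"
    if w: "w = j * (of_int l * \<tau>' + of_int m)" for z w and l m :: int
  proof -
    have "(z + w) / j = z / j + of_int l * \<tau>' + of_int m" using j by (simp add: w field_simps)
    then have "theta \<tau>' ((z + w) / j) = ee ((of_int l + of_int m) / 2 - (of_int l)\<^sup>2 * \<tau>' / 2 - of_int l * (z / j)) * theta \<tau>' (z / j)"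
      by (simp only: theta_shift)
    then have "g (z + w) = ee (- of_int c * ((z + w)\<^sup>2 / 2) / j + ((of_int l + of_int m) / 2 - (of_int l)\<^sup>2 * \<tau>' / 2 - of_int l * (z / j))) * theta \<tau>' (z / j)"
      by (simp only: g_def ee_add mult.assoc)
    also have "- of_int c * ((z + w)\<^sup>2 / 2) / j + ((of_int l + of_int m) / 2 - (of_int l)\<^sup>2 * \<tau>' / 2 - of_int l * (z / j)) =
      ((of_int l + of_int m) / 2 - (of_int l)\<^sup>2 * \<tau>' / 2 - of_int l * (z / j) - of_int c * ((2 * z * w + w\<^sup>2) / 2) / j) +
       (- of_int c * (z\<^sup>2 / 2) / j)"
      using j by (simp add: field_simps power2_eq_square)
    finally show ?thesis by (simp only: g_def ee_add mult.assoc)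
  qed
  have hol: "g holomorphic_on UNIV"
  proof -
    have "(theta \<tau>' \<circ> (\<lambda>z. z / j)) holomorphic_on UNIV"
      by (intro holomorphic_on_compose theta_holomorphic[OF \<tau>'] holomorphic_intros j)
    then show ?thesis unfolding g_def o_def by (auto intro!: holomorphic_intros simp: j)
  qed
  have g': "(g has_field_derivative 2 * of_real pi * \<i> * eta \<tau>' ^ 3 / j) (at 0)"
  proof -
    have "(theta \<tau>' has_field_derivative 2 * of_real pi * \<i> * eta \<tau>' ^ 3) (at (0 / j))"
      using theta_has_field_derivative_0[OF \<tau>'] by simp
    moreover have "((\<lambda>z. z / j) has_field_derivative 1 / j) (at 0)"
      by (auto intro!: derivative_eq_intros simp: j)
    ultimately have "((\<lambda>z. theta \<tau>' (z / j)) has_field_derivative 2 * of_real pi * \<i> * eta \<tau>' ^ 3 * (1 / j)) (at 0)"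
      by (rule DERIV_chain2)
    moreover have "((\<lambda>z. ee (- of_int c * (z\<^sup>2 / 2) / j)) has_field_derivative 0) (at 0)"
      by (auto intro!: derivative_eq_intros simp: j)
    ultimately show ?thesis unfolding g_def by (auto dest: DERIV_mult)
  qed
  have per1: "g (z + 1) = - g z" for z
  proof -
    \<comment> \<open>The inverse matrix writes the period 1, and \<tau> in \<open>per2\<close>, as
      j times a lattice point of \<tau>'.\<close>
    have "1 = j * (of_int (- c) * \<tau>' + of_int a)"
      unfolding \<tau>'_eq using j Ac by (simp add: field_simps) (simp add: j_def moebius_den_def algebra_simps)
    from shift[OF this, of z]
    have "g (z + 1) = ee ((of_int a - of_int c) / 2 - (of_int c)\<^sup>2 * \<tau>' / 2 + of_int c * (z / j) - of_int c * ((2 * z + 1) / 2) / j) * g z"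
      by simp
    also have "(of_int a - of_int c) / 2 - (of_int c)\<^sup>2 * \<tau>' / 2 + of_int c * (z / j) - of_int c * ((2 * z + 1) / 2) / j =
      of_int (a + c + a * c) / 2 - of_int (c + a * c)"
    proof -
      have "(of_int c)\<^sup>2 * \<tau>' + of_int c / j = of_int (a * c)"
      proof -
        have "of_int c * (of_int a * \<tau> + of_int b) + 1 = of_int a * j"
          using Ac by (simp add: j_def moebius_den_def algebra_simps)
        then have "of_int c * (of_int c * (of_int a * \<tau> + of_int b) + 1) / j = of_int (a * c)" using j by simp
        then show ?thesis unfolding \<tau>'_eq by (simp add: power2_eq_square add_divide_distrib algebra_simps)
      qed
      then have e: "(of_int c)\<^sup>2 * \<tau>' = of_int (a * c) - of_int c / j" by (simp add: algebra_simps)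
      show ?thesis unfolding e using j by (simp add: field_simps)
    qed
    also have "ee (of_int (a + c + a * c) / 2 - of_int (c + a * c)) = -1"
      unfolding ee_diff ee_of_int ee_minus_half_odd[OF conjunct1[OF odd_unimodular[OF A]]] by simp
    finally show ?thesis by simp
  qed
  have per2: "g (z + \<tau>) = - ee (- \<tau> / 2 - z) * g z" for z
  proof -
    have "\<tau> = j * (of_int d * \<tau>' + of_int (- b))"
      unfolding \<tau>'_eq using j Ac by (simp add: field_simps) (simp add: j_def moebius_den_def algebra_simps)
    from shift[OF this, of z]
    have "g (z + \<tau>) = ee ((of_int d - of_int b) / 2 - (of_int d)\<^sup>2 * \<tau>' / 2 - of_int d * (z / j) - of_int c * ((2 * z * \<tau> + \<tau>\<^sup>2) / 2) / j) * g z"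
      by simp
    also have "(of_int d - of_int b) / 2 - (of_int d)\<^sup>2 * \<tau>' / 2 - of_int d * (z / j) - of_int c * ((2 * z * \<tau> + \<tau>\<^sup>2) / 2) / j =
      of_int (b + d + b * d) / 2 - of_int (b + b * d) + (- \<tau> / 2 - z)"
    proof -
      have 1: "of_int d * (z / j) = z - of_int c * z * \<tau> / j"
        using j by (simp add: field_simps) (simp add: j_def moebius_den_def algebra_simps)
      have "(of_int d)\<^sup>2 * (of_int a * \<tau> + of_int b) + of_int c * \<tau>\<^sup>2 = (\<tau> + of_int (b * d)) * j"
      proof -
        have "(of_int d)\<^sup>2 * (of_int a * \<tau> + of_int b) =
            of_int d * ((of_int a * of_int d - of_int b * of_int c) * \<tau> + of_int b * of_int c * \<tau> + of_int b * of_int d)"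
          by (simp add: power2_eq_square algebra_simps)
        then show ?thesis unfolding Ac by (simp add: j_def moebius_den_def power2_eq_square algebra_simps)
      qed
      then have "((of_int d)\<^sup>2 * (of_int a * \<tau> + of_int b) + of_int c * \<tau>\<^sup>2) / j = \<tau> + of_int (b * d)"
        using j by simp
      then have 2: "(of_int d)\<^sup>2 * \<tau>' = \<tau> + of_int (b * d) - of_int c * \<tau>\<^sup>2 / j"
        unfolding \<tau>'_eq by (simp add: add_divide_distrib algebra_simps)
      show ?thesis unfolding 1 2 using j by (simp add: field_simps)
    qed
    also have "ee (of_int (b + d + b * d) / 2 - of_int (b + b * d) + (- \<tau> / 2 - z)) = - ee (- \<tau> / 2 - z)"
      unfolding ee_add[of _ "- \<tau> / 2 - z"] ee_diff[of _ "of_int (b + b * d)"] ee_of_int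
        ee_minus_half_odd[OF conjunct2[OF odd_unimodular[OF A]]] by simp
    finally show ?thesis .
  qed
  have "2 * of_real pi * \<i> * eta \<tau> ^ 3 * g z = 2 * of_real pi * \<i> * eta \<tau>' ^ 3 / j * theta \<tau> z"
    by (rule theta_unique[OF \<tau> hol _ g' per1 per2]) (simp add: g_def)
  then have "g z = inverse j * (eta \<tau>' / eta \<tau>) ^ 3 * theta \<tau> z"
    using eta_nonzero[OF \<tau>] j by (simp add: field_simps)
  moreover have "theta \<tau>' (z / j) = ee (of_int c * (z\<^sup>2 / 2) / j) * g z"
    unfolding g_def by (simp add: ee_minus)
  ultimately show ?thesis by simp
qed

subsection \<open>Rearranging absolutely convergent products\<close>

lemma has_sum_mult_product:
  fixes f :: "'a \<Rightarrow> complex" and g :: "'b \<Rightarrow> complex"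
  assumes f: "(f has_sum S) A" "(\<lambda>x. norm (f x)) summable_on A" "countable A"
    and g: "(g has_sum T) B" "(\<lambda>x. norm (g x)) summable_on B" "countable B"
  shows "((\<lambda>(x, y). f x * g y) has_sum (S * T)) (A \<times> B)"
proof (rule has_sum_SigmaI)
  show "((\<lambda>y. case (x, y) of (x, y) \<Rightarrow> f x * g y) has_sum (f x * T)) B" for x
    using has_sum_cmult_right[OF g(1)] by simp
  show "((\<lambda>x. f x * T) has_sum (S * T)) A" by (rule has_sum_cmult_left[OF f(1)])
  have "Infinite_Set_Sum.abs_summable_on (\<lambda>(x, y). f x * g y) (A \<times> B)"
    using f g by (intro abs_summable_on_product) (simp_all add: abs_summable_equivalent[symmetric])
  then show "(\<lambda>(x, y). f x * g y) summable_on (A \<times> B)"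
    unfolding abs_summable_equivalent[symmetric] by (rule abs_summable_summable)
qed

lemma has_sum_prod_PiE:
  fixes f :: "'a \<Rightarrow> 'b \<Rightarrow> complex"
  assumes A: "finite A" "\<And>x. x \<in> A \<Longrightarrow> countable (B x)"
    and f: "\<And>x. x \<in> A \<Longrightarrow> (\<lambda>y. norm (f x y)) summable_on B x" "\<And>x. x \<in> A \<Longrightarrow> (f x has_sum S x) (B x)"
  shows "((\<lambda>g. \<Prod>x\<in>A. f x (g x)) has_sum (\<Prod>x\<in>A. S x)) (PiE A B)"
    and "(\<lambda>g. norm (\<Prod>x\<in>A. f x (g x))) summable_on (PiE A B)"
proof -
  have "Infinite_Set_Sum.abs_summable_on (\<lambda>g. \<Prod>x\<in>A. f x (g x)) (PiE A B)"
    using A f(1) by (intro abs_summable_on_prod_PiE) (simp_all add: abs_summable_equivalent[symmetric])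
  then show abs: "(\<lambda>g. norm (\<Prod>x\<in>A. f x (g x))) summable_on (PiE A B)"
    unfolding abs_summable_equivalent[symmetric] .
  have "infsum (\<lambda>g. \<Prod>x\<in>A. f x (g x)) (PiE A B) = (\<Prod>x\<in>A. infsum (f x) (B x))"
    using A f(1) by (intro infsum_prod_PiE_abs)
  also have "\<dots> = (\<Prod>x\<in>A. S x)" using f(2) by (intro prod.cong) (auto intro: infsumI)
  finally show "((\<lambda>g. \<Prod>x\<in>A. f x (g x)) has_sum (\<Prod>x\<in>A. S x)) (PiE A B)"
    using has_sum_infsum[OF abs_summable_summable[OF abs]] by simp
qed

text \<open>Many indices i share one monomial M. The coefficients collected over a fibre of
  \<open>\<kappa>\<close> do not mention M, so they will be the same for all \<tau> and z.\<close>

lemma has_sum_group: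
  fixes c :: "'i \<Rightarrow> complex" and M :: "'t \<Rightarrow> complex"
  assumes sum: "((\<lambda>i. c i * M (\<kappa> i)) has_sum S) I" and \<kappa>: "\<kappa> ` I \<subseteq> T"
  shows "((\<lambda>t. (\<Sum>\<^sub>\<infinity>i\<in>{i\<in>I. \<kappa> i = t}. c i) * M t) has_sum S) T"
proof (rule has_sum_SigmaD)
  let ?f = "\<lambda>i. c i * M (\<kappa> i)"
  have "bij_betw snd (Sigma T (\<lambda>t. {i\<in>I. \<kappa> i = t})) I"
    using \<kappa> by (intro bij_betw_byWitness[where f' = "\<lambda>i. (\<kappa> i, i)"]) auto
  from has_sum_reindex_bij_betw[OF this, of ?f] sum
  show "((\<lambda>p. ?f (snd p)) has_sum S) (Sigma T (\<lambda>t. {i\<in>I. \<kappa> i = t}))" by simp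
  fix t
  have "?f summable_on {i\<in>I. \<kappa> i = t}"
    by (rule summable_on_subset_banach[OF has_sum_imp_summable[OF sum]]) blast
  then have "(?f has_sum infsum ?f {i\<in>I. \<kappa> i = t}) {i\<in>I. \<kappa> i = t}" by (rule has_sum_infsum)
  moreover have "infsum ?f {i\<in>I. \<kappa> i = t} = (\<Sum>\<^sub>\<infinity>i\<in>{i\<in>I. \<kappa> i = t}. c i * M t)"
    by (rule infsum_cong) simp
  ultimately show "((\<lambda>i. ?f (snd (t, i))) has_sum ((\<Sum>\<^sub>\<infinity>i\<in>{i\<in>I. \<kappa> i = t}. c i) * M t)) {i\<in>I. \<kappa> i = t}"
    by (simp add: infsum_cmult_left')
qed

text \<open>Euler's product has no zero in the unit disc, so its negative powers have a Taylor
  series there too, with coefficients independent of q.\<close>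

lemma euler_powi_expansion:
  obtains a :: "nat \<Rightarrow> complex"
  where "\<And>q. norm q < 1 \<Longrightarrow> ((\<lambda>k. a k * q ^ k) has_sum (euler q 1 powi e)) UNIV"
    "\<And>q. norm q < 1 \<Longrightarrow> (\<lambda>k. norm (a k * q ^ k)) summable_on UNIV"
proof -
  let ?u = "\<lambda>q. euler q 1 powi e"
  define a where "a = (\<lambda>k. (deriv ^^ k) ?u 0 / fact k)"
  have "?u holomorphic_on ball 0 1"
    using euler_1_nonzero by (intro holomorphic_intros euler_1_holomorphic) auto
  then have sums: "(\<lambda>k. a k * q ^ k) sums ?u q" if "norm q < 1" for q
    using holomorphic_power_series[of ?u 0 1 q] that by (simp add: a_def)
  have abs: "summable (\<lambda>k. norm (a k * q ^ k))" if q: "norm q < 1" for q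
  proof -
    obtain r where r: "norm q < r" "r < 1" using dense[OF q] by blast
    then have "0 \<le> r" using norm_ge_zero[of q] by linarith
    then have "norm (of_real r :: complex) < 1" using r by simp
    then have "summable (\<lambda>k. a k * of_real r ^ k)" using sums sums_summable by blast
    then show ?thesis by (rule powser_insidea) (use r \<open>0 \<le> r\<close> in simp)
  qed
  show ?thesis
  proof (rule that)
    fix q :: complex assume q: "norm q < 1"
    show "((\<lambda>k. a k * q ^ k) has_sum ?u q) UNIV" by (rule norm_summable_imp_has_sum[OF abs sums]) fact+
    show "(\<lambda>k. norm (a k * q ^ k)) summable_on UNIV"
      by (subst summable_on_UNIV_nonneg_real_iff) (use abs[OF q] in auto)
  qed
qed

subsection \<open>Holomorphy of theta blocks\<close>

text \<open>The condition of \<open>holomorphic_uhp_vec\<close> at one point, isolated because it is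
  stable under products.\<close>

definition cdiff :: "(complex \<times> (complex^'n) \<Rightarrow> complex) \<Rightarrow> complex \<times> (complex^'n) \<Rightarrow> bool" where
  "cdiff F p \<longleftrightarrow> (\<exists>D. (F has_derivative D) (at p) \<and> (\<forall>s t w. D (s * t, s *s w) = s * D (t, w)))"

lemma cdiff_mult:
  assumes "cdiff F p" "cdiff G p"
  shows "cdiff (\<lambda>x. F x * G x) p"
proof -
  obtain D E where D: "(F has_derivative D) (at p)" "\<And>s t w. D (s * t, s *s w) = s * D (t, w)"
    and E: "(G has_derivative E) (at p)" "\<And>s t w. E (s * t, s *s w) = s * E (t, w)"
    using assms unfolding cdiff_def by metis
  have "((\<lambda>x. F x * G x) has_derivative (\<lambda>h. F p * E h + D h * G p)) (at p)"
    by (rule has_derivative_mult[OF D(1) E(1)])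
  then show ?thesis unfolding cdiff_def by (intro exI conjI) (assumption, simp add: D(2) E(2) algebra_simps)
qed

lemma cdiff_const: "cdiff (\<lambda>_. c) p"
  unfolding cdiff_def by (intro exI[of _ "\<lambda>_. 0"]) simp

lemma cdiff_prod: "(\<And>i. i \<in> A \<Longrightarrow> cdiff (F i) p) \<Longrightarrow> cdiff (\<lambda>x. \<Prod>i\<in>A. F i x) p"
  by (induction A rule: infinite_finite_induct) (simp_all add: cdiff_const cdiff_mult)

lemma cdiff_fst:
  assumes "u field_differentiable at \<tau>"
  shows "cdiff (\<lambda>x. u (fst x)) (\<tau>, z)"
proof -
  obtain D where D: "(u has_derivative (\<lambda>h. D * h)) (at \<tau>)"
    using assms unfolding field_differentiable_def has_field_derivative_def by blast
  have "((\<lambda>x. u (fst x)) has_derivative (\<lambda>h. D * fst h)) (at (\<tau>, z))"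
    by (rule has_derivative_compose[OF has_derivative_fst[OF has_derivative_ident]]) (simp add: D)
  then show ?thesis unfolding cdiff_def by (intro exI conjI) (assumption, simp add: mult_ac)
qed

lemma cdiff_theta:
  fixes c :: "'n::finite \<Rightarrow> complex"
  assumes "\<tau> \<in> uhp"
  shows "cdiff (\<lambda>x. theta (fst x) (\<Sum>i\<in>UNIV. c i * snd x $ i)) (\<tau>, z)"
proof -
  let ?L = "\<lambda>w :: complex^'n. \<Sum>i\<in>UNIV. c i * w $ i"
  obtain A B where AB: "((\<lambda>(t, w). theta t w) has_derivative (\<lambda>(s, v). A * s + B * v)) (at (\<tau>, ?L z))"
    using theta_has_derivative[OF assms] by blast
  have "bounded_linear ?L"
    by (intro bounded_linear_sum bounded_linear_const_mult bounded_linear_vec_nth)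
  then have "((\<lambda>x. ?L (snd x)) has_derivative (\<lambda>h. ?L (snd h))) (at (\<tau>, z))"
    by (rule bounded_linear.has_derivative) (rule has_derivative_snd[OF has_derivative_ident])
  from has_derivative_Pair[OF has_derivative_fst[OF has_derivative_ident] this]
  have "((\<lambda>x. (fst x, ?L (snd x))) has_derivative (\<lambda>h. (fst h, ?L (snd h)))) (at (\<tau>, z))" .
  then have "((\<lambda>x. case (fst x, ?L (snd x)) of (t, w) \<Rightarrow> theta t w) has_derivative
      (\<lambda>h. case (fst h, ?L (snd h)) of (s, v) \<Rightarrow> A * s + B * v)) (at (\<tau>, z))"
    by (rule has_derivative_compose) (simp only: fst_conv snd_conv AB)
  then have "((\<lambda>x. theta (fst x) (?L (snd x))) has_derivative (\<lambda>h. A * fst h + B * ?L (snd h))) (at (\<tau>, z))"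
    by (simp only: prod.case)
  then show ?thesis unfolding cdiff_def
    by (intro exI conjI) (assumption, simp add: algebra_simps sum_distrib_left)
qed

lemma theta_root_holomorphic:
  fixes \<gamma> :: "'a \<Rightarrow> 'n::finite \<Rightarrow> nat"
  shows "holomorphic_uhp_vec (theta_root n P \<gamma>)"
proof -
  have "cdiff (\<lambda>x. eta (fst x) powi (int n - int (card P)) *
      (\<Prod>r\<in>P. theta (fst x) (\<Sum>i\<in>UNIV. of_nat (\<gamma> r i) * snd x $ i))) (\<tau>, z)"
    if "\<tau> \<in> uhp" for \<tau> and z :: "complex^'n"
  proof (rule cdiff_mult)
    show "cdiff (\<lambda>x. \<Prod>r\<in>P. theta (fst x) (\<Sum>i\<in>UNIV. of_nat (\<gamma> r i) * snd x $ i)) (\<tau>, z)"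
      by (rule cdiff_prod, rule cdiff_theta[OF that])
    have "(\<lambda>t. eta t powi (int n - int (card P))) holomorphic_on uhp"
      using eta_nonzero by (intro holomorphic_intros eta_holomorphic) auto
    then have "(\<lambda>t. eta t powi (int n - int (card P))) field_differentiable at \<tau>"
      using holomorphic_on_imp_differentiable_at open_uhp that by blast
    then show "cdiff (\<lambda>x. eta (fst x) powi (int n - int (card P))) (\<tau>, z)" by (rule cdiff_fst)
  qed
  then show ?thesis
    unfolding holomorphic_uhp_vec_def theta_root_def cdiff_def case_prod_unfold by simp
qed

text \<open>For a natural exponent each branch is the ordinary power. The choice in
  \<open>eps\<close> is meaningful because \<eta> has no zeros on the convex upper half plane and so
  has a logarithm.\<close>

lemma eps_of_nat:
  assumes "moebius_act a b c d \<tau> \<in> uhp" "\<tau> \<in> uhp"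
  shows "eps (of_nat h) a b c d \<tau> = (eta (moebius_act a b c d \<tau>) / eta \<tau>) ^ h"
proof -
  have conv: "convex uhp" unfolding uhp_def by (rule convex_halfspace_Im_gt)
  obtain g where "g holomorphic_on uhp" "\<And>z. z \<in> uhp \<Longrightarrow> eta z = exp (g z)"
    using simply_connected_imp_holomorphic_log[OF eta_holomorphic convex_imp_simply_connected[OF conv]
      convex_imp_locally_path_connected[OF conv]] eta_nonzero by metis
  then have "eta_power_branch (of_nat h) (\<lambda>z. exp (of_rat (of_nat h) * g z))"
    unfolding eta_power_branch_def by (intro exI[of _ g]) auto
  then have "eta_power_branch (of_nat h) (SOME f. eta_power_branch (of_nat h) f)" by (rule someI[of "eta_power_branch (of_nat h)"])
  then have "(SOME f. eta_power_branch (of_nat h) f) z = eta z ^ h" if "z \<in> uhp" for z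
    using that unfolding eta_power_branch_def by (auto simp: exp_of_nat_mult)
  then show ?thesis using assms
    unfolding eps_def moebius_act_def by (simp add: Let_def power_divide)
qed

subsection \<open>Transformation laws of theta blocks\<close>

text \<open>Polymorphic in the scalars: the same form is evaluated on the lattice, on rational dual
  vectors and on complex points.\<close>

definition lform :: "('a \<Rightarrow> 'n::finite \<Rightarrow> nat) \<Rightarrow> 'a \<Rightarrow> 'c::comm_ring_1^'n \<Rightarrow> 'c" where
  "lform \<gamma> r x = (\<Sum>i\<in>UNIV. of_nat (\<gamma> r i) * x $ i)"

lemma lform_add: "lform \<gamma> r (x + y) = lform \<gamma> r x + lform \<gamma> r y"
  by (simp add: lform_def distrib_left sum.distrib)

lemma lform_smult: "lform \<gamma> r (c *s x) = c * lform \<gamma> r x"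
  by (simp add: lform_def sum_distrib_left mult_ac)

lemma lform_vec_of_int: "lform \<gamma> r (vec_of_int x) = of_int (lform \<gamma> r x)"
  by (simp add: lform_def vec_of_int_def)

lemma lform_axis: "lform \<gamma> r (axis i 1) = of_nat (\<gamma> r i)"
proof -
  have "lform \<gamma> r (axis i 1) = (\<Sum>j\<in>UNIV. if j = i then of_nat (\<gamma> r j) else 0)"
    unfolding lform_def by (rule sum.cong) (auto simp: axis_def)
  then show ?thesis by simp
qed

lemma root_form_eq: "root_form P \<gamma> x y = (\<Sum>r\<in>P. lform \<gamma> r x * lform \<gamma> r y)"
  by (simp add: root_form_def lform_def)

lemma theta_root_eq:
  "theta_root n P \<gamma> \<tau> z = eta \<tau> powi (int n - int (card P)) * (\<Prod>r\<in>P. theta \<tau> (lform \<gamma> r z))"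
  by (simp add: theta_root_def lform_def)

lemma bil_root_form:
  fixes x y :: "'c::field^'n::finite"
  shows "bil (root_form P \<gamma>) x y = (\<Sum>r\<in>P. lform \<gamma> r x * lform \<gamma> r y)"
proof -
  have "bil (root_form P \<gamma>) x y =
      (\<Sum>i\<in>UNIV. \<Sum>j\<in>UNIV. \<Sum>r\<in>P. (of_nat (\<gamma> r i) * x $ i) * (of_nat (\<gamma> r j) * y $ j))"
    by (simp add: bil_def root_form_eq lform_axis sum_distrib_left sum_distrib_right mult_ac)
  also have "\<dots> = (\<Sum>i\<in>UNIV. \<Sum>r\<in>P. \<Sum>j\<in>UNIV. (of_nat (\<gamma> r i) * x $ i) * (of_nat (\<gamma> r j) * y $ j))"
    by (rule sum.cong[OF refl], rule sum.swap)
  also have "\<dots> = (\<Sum>r\<in>P. \<Sum>i\<in>UNIV. \<Sum>j\<in>UNIV. (of_nat (\<gamma> r i) * x $ i) * (of_nat (\<gamma> r j) * y $ j))"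
    by (rule sum.swap)
  also have "\<dots> = (\<Sum>r\<in>P. lform \<gamma> r x * lform \<gamma> r y)"
    unfolding lform_def sum_product ..
  finally show ?thesis .
qed

lemma quad_root_form: "quad (root_form P \<gamma>) x = (\<Sum>r\<in>P. (lform \<gamma> r x)\<^sup>2) / 2"
  by (simp add: quad_def bil_root_form power2_eq_square)

text \<open>Reconciles the sign (-1)^k from \<open>theta_shift\<close> with the factor e(k^2/2) of
  the elliptic law: k and its square have the same parity.\<close>

lemma ee_half_square: "ee ((of_int k)\<^sup>2 / 2) = ee (of_int k / 2)"
proof (rule ee_cong)
  have "even (k * (k - 1))" by simp
  then obtain m where m: "k * (k - 1) = 2 * m" by blast
  have "(of_int k)\<^sup>2 / 2 - of_int k / 2 = (of_int (k * (k - 1)) / 2 :: complex)"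
    by (simp add: power2_eq_square field_simps)
  also have "\<dots> = of_int m" unfolding m by simp
  finally show "(of_int k)\<^sup>2 / 2 - of_int k / 2 \<in> (\<int> :: complex set)" by simp
qed

lemma theta_root_elliptic:
  fixes x y :: "int^'n::finite"
  shows "theta_root n P \<gamma> \<tau> (z + \<tau> *s vec_of_int x + vec_of_int y) =
    ee (quad (root_form P \<gamma>) (vec_of_int (x + y))) *
    ee (- \<tau> * quad (root_form P \<gamma>) (vec_of_int x) - bil (root_form P \<gamma>) (vec_of_int x) z) *
    theta_root n P \<gamma> \<tau> z"
proof -
  define k m where "k = (\<lambda>r. lform \<gamma> r x)" and "m = (\<lambda>r. lform \<gamma> r y)"
  define u where "u = (\<lambda>r. lform \<gamma> r z)"
  let ?E = "\<lambda>r. ee ((of_int (k r + m r))\<^sup>2 / 2) * ee (- \<tau> * ((of_int (k r))\<^sup>2 / 2) - of_int (k r) * u r)"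
  have "theta \<tau> (lform \<gamma> r (z + \<tau> *s vec_of_int x + vec_of_int y)) = ?E r * theta \<tau> (u r)" for r
  proof -
    have "lform \<gamma> r (z + \<tau> *s vec_of_int x + vec_of_int y) = u r + of_int (k r) * \<tau> + of_int (m r)"
      by (simp add: lform_add lform_smult lform_vec_of_int k_def m_def u_def mult.commute)
    then have "theta \<tau> (lform \<gamma> r (z + \<tau> *s vec_of_int x + vec_of_int y)) =
        ee ((of_int (k r) + of_int (m r)) / 2 - (of_int (k r))\<^sup>2 * \<tau> / 2 - of_int (k r) * u r) * theta \<tau> (u r)"
      by (simp only: theta_shift)
    also have "(of_int (k r) + of_int (m r)) / 2 - (of_int (k r))\<^sup>2 * \<tau> / 2 - of_int (k r) * u r =
        of_int (k r + m r) / 2 + (- \<tau> * ((of_int (k r))\<^sup>2 / 2) - of_int (k r) * u r)"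
      by (simp add: algebra_simps)
    finally show ?thesis unfolding ee_add ee_half_square .
  qed
  then have "theta_root n P \<gamma> \<tau> (z + \<tau> *s vec_of_int x + vec_of_int y) = (\<Prod>r\<in>P. ?E r) * theta_root n P \<gamma> \<tau> z"
    unfolding theta_root_eq by (simp add: prod.distrib u_def)
  also have "(\<Prod>r\<in>P. ?E r) = ee (quad (root_form P \<gamma>) (vec_of_int (x + y))) *
    ee (- \<tau> * quad (root_form P \<gamma>) (vec_of_int x) - bil (root_form P \<gamma>) (vec_of_int x) z)"
    unfolding prod.distrib ee_sum[symmetric] quad_root_form bil_root_form lform_vec_of_int lform_add
    by (simp add: k_def m_def u_def sum_divide_distrib sum_distrib_left sum_subtractf sum_negf)
  finally show ?thesis .
qed

text \<open>With \<rho> the quotient of the two values of \<eta>, each theta gives \<rho>^3 / j and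
  the power of \<eta> gives \<rho>^(n - N), in total \<rho>^(n + 2 N) j^(-N).\<close>

lemma theta_root_modular:
  assumes A: "a * d - b * c = 1" and \<tau>: "\<tau> \<in> uhp"
  defines "\<tau>' \<equiv> moebius_act a b c d \<tau>" and "j \<equiv> moebius_den c d \<tau>"
  shows "theta_root n P \<gamma> \<tau>' ((1 / j) *s z) =
    ee (of_int c * quad (root_form P \<gamma>) z / j) * j powi (- int (card P)) *
    (eta \<tau>' / eta \<tau>) ^ (n + 2 * card P) * theta_root n P \<gamma> \<tau> z"
proof -
  define N where "N = card P"
  define \<rho> where "\<rho> = eta \<tau>' / eta \<tau>"
  have "\<tau>' \<in> uhp" unfolding \<tau>'_def by (rule moebius_act_uhp[OF A \<tau>])
  then have \<rho>: "\<rho> \<noteq> 0" "eta \<tau>' = \<rho> * eta \<tau>" using eta_nonzero \<tau> by (simp_all add: \<rho>_def)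
  have "theta \<tau>' (lform \<gamma> r ((1 / j) *s z)) =
      ee (of_int c * ((lform \<gamma> r z)\<^sup>2 / 2) / j) * (inverse j * \<rho> ^ 3) * theta \<tau> (lform \<gamma> r z)" for r
    using theta_modular[OF A \<tau>, of "lform \<gamma> r z"]
    by (simp add: lform_smult \<tau>'_def j_def \<rho>_def)
  then have "(\<Prod>r\<in>P. theta \<tau>' (lform \<gamma> r ((1 / j) *s z))) =
      ee (\<Sum>r\<in>P. of_int c * ((lform \<gamma> r z)\<^sup>2 / 2) / j) * (inverse j * \<rho> ^ 3) ^ N *
      (\<Prod>r\<in>P. theta \<tau> (lform \<gamma> r z))"
    by (simp only: prod.distrib prod_constant ee_sum N_def power_mult_distrib)
  also have "(\<Sum>r\<in>P. of_int c * ((lform \<gamma> r z)\<^sup>2 / 2) / j) = of_int c * quad (root_form P \<gamma>) z / j"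
    by (simp add: quad_root_form sum_distrib_left sum_divide_distrib)
  also have "(inverse j * \<rho> ^ 3) ^ N = j powi (- int N) * \<rho> ^ (3 * N)"
    by (simp add: power_mult_distrib power_mult power_int_minus power_inverse)
  finally have "theta_root n P \<gamma> \<tau>' ((1 / j) *s z) = ee (of_int c * quad (root_form P \<gamma>) z / j) * j powi (- int N) *
      ((\<rho> powi (int n - int N) * \<rho> ^ (3 * N)) * (eta \<tau> powi (int n - int N) * (\<Prod>r\<in>P. theta \<tau> (lform \<gamma> r z))))"
    unfolding theta_root_eq \<rho>(2) N_def[symmetric] power_int_mult_distrib by (simp only: mult_ac)
  also have "\<rho> powi (int n - int N) * \<rho> ^ (3 * N) = \<rho> powi ((int n - int N) + int (3 * N))"
    unfolding power_int_of_nat[symmetric] by (rule power_int_add[symmetric]) (simp add: \<rho>(1))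
  also have "(int n - int N) + int (3 * N) = int (n + 2 * N)" by simp
  finally show ?thesis unfolding theta_root_eq N_def[symmetric] \<rho>_def[symmetric] power_int_of_nat
    by (simp only: mult.assoc)
qed

subsection \<open>Fourier expansion\<close>

context pos_root_sys
begin

section \<open>Definiteness of the root form and dual vectors\<close>

lemma lform_f: "lform \<gamma> (f i) x = x $ i"
proof -
  have "lform \<gamma> (f i) x = (\<Sum>j\<in>UNIV. if j = i then x $ j else 0)"
    unfolding lform_def coeff_simple by (rule sum.cong) auto
  then show ?thesis by simp
qed

text \<open>The simple roots alone contribute the squares of all coordinates.\<close>

lemma root_form_definite:
  fixes x :: "'c::linordered_idom^'n"
  assumes "(\<Sum>r\<in>P. lform \<gamma> r x * lform \<gamma> r x) = 0"
  shows "x = 0"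
proof -
  have "lform \<gamma> r x * lform \<gamma> r x = 0" if "r \<in> P" for r
    using assms that by (subst (asm) sum_nonneg_eq_0_iff) auto
  then have "lform \<gamma> (f i) x = 0" for i using f_in_P by simp
  then show ?thesis unfolding lform_f by (simp add: vec_eq_iff)
qed

lemma integral_lattice_root_form: "integral_lattice (root_form P \<gamma>)"
  unfolding integral_lattice_def root_form_eq
proof (intro conjI allI impI)
  show "(\<Sum>r\<in>P. lform \<gamma> r (x + y) * lform \<gamma> r z) =
      (\<Sum>r\<in>P. lform \<gamma> r x * lform \<gamma> r z) + (\<Sum>r\<in>P. lform \<gamma> r y * lform \<gamma> r z)" for x y z :: "int^'n"
    by (simp add: lform_add distrib_right sum.distrib)
  show "(\<Sum>r\<in>P. lform \<gamma> r x * lform \<gamma> r y) = (\<Sum>r\<in>P. lform \<gamma> r y * lform \<gamma> r x)" for x y :: "int^'n"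
    by (simp only: mult.commute)
  show "x = 0" if "\<forall>y. (\<Sum>r\<in>P. lform \<gamma> r x * lform \<gamma> r y) = 0" for x :: "int^'n"
    using that by (intro root_form_definite) blast
qed

text \<open>The exponent (1/2) \<Sum> s_r l_r(z) of an expanded term must be written as \<beta>(v,
  z) with rational v. Definiteness makes the Gram matrix \<open>B\<close> invertible.\<close>

lemma dual_vector_exists:
  fixes s :: "'a \<Rightarrow> int"
  shows "\<exists>v :: rat^'n. \<forall>i. (\<Sum>r\<in>P. lform \<gamma> r v * of_nat (\<gamma> r i)) = (\<Sum>r\<in>P. of_int (s r) * of_nat (\<gamma> r i)) / 2"
proof -
  define B :: "rat^'n^'n" where "B = (\<chi> i j. \<Sum>r\<in>P. of_nat (\<gamma> r i) * of_nat (\<gamma> r j))"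
  have Bv: "(B *v v) $ i = (\<Sum>r\<in>P. lform \<gamma> r v * of_nat (\<gamma> r i))" for v i
    unfolding B_def matrix_vector_mult_def lform_def vec_lambda_beta sum_distrib_right
    by (subst sum.swap) (simp add: mult_ac)
  have "v = 0" if "B *v v = 0" for v
  proof (rule root_form_definite)
    have "(\<Sum>r\<in>P. lform \<gamma> r v * lform \<gamma> r v) = (\<Sum>i\<in>UNIV. (B *v v) $ i * v $ i)"
      unfolding Bv sum_distrib_right by (subst sum.swap) (simp add: lform_def[of \<gamma> _ v] sum_distrib_left mult_ac)
    then show "(\<Sum>r\<in>P. lform \<gamma> r v * lform \<gamma> r v) = 0" using that by simp
  qed
  then have "\<exists>C. C ** B = mat 1" by (intro iffD2[OF matrix_left_invertible_ker] allI impI)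
  then obtain C where "C ** B = mat 1" ..
  then have "B ** C = mat 1" by (rule iffD1[OF matrix_left_right_inverse])
  then have "B *v (C *v w) = w" for w by (simp add: matrix_vector_mul_assoc)
  then have "\<forall>i. (\<Sum>r\<in>P. lform \<gamma> r (C *v w) * of_nat (\<gamma> r i)) = w $ i" for w
    unfolding Bv[symmetric] by simp
  from this[of "\<chi> i. (\<Sum>r\<in>P. of_int (s r) * of_nat (\<gamma> r i)) / 2"] show ?thesis by auto
qed

definition dual_vector :: "('a \<Rightarrow> int) \<Rightarrow> rat^'n" where
  "dual_vector s = (SOME v. \<forall>i. (\<Sum>r\<in>P. lform \<gamma> r v * of_nat (\<gamma> r i)) = (\<Sum>r\<in>P. of_int (s r) * of_nat (\<gamma> r i)) / 2)"

lemma dual_vector: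
  "(\<Sum>r\<in>P. lform \<gamma> r (dual_vector s) * of_nat (\<gamma> r i)) = (\<Sum>r\<in>P. of_int (s r) * of_nat (\<gamma> r i)) / 2"
  using someI_ex[OF dual_vector_exists[of s]] unfolding dual_vector_def by blast

lemma lform_vec_of_rat: "lform \<gamma> r (vec_of_rat v) = of_rat (lform \<gamma> r v)"
  by (simp add: lform_def vec_of_rat_def of_rat_sum of_rat_mult)

lemma bil_dual_vector_rat:
  "bil (root_form P \<gamma>) (dual_vector s) y = (\<Sum>r\<in>P. of_int (s r) * lform \<gamma> r y) / 2"
proof -
  have "bil (root_form P \<gamma>) (dual_vector s) y = (\<Sum>i\<in>UNIV. (\<Sum>r\<in>P. lform \<gamma> r (dual_vector s) * of_nat (\<gamma> r i)) * y $ i)"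
    unfolding bil_root_form sum_distrib_right
    by (subst sum.swap) (simp add: lform_def[of \<gamma> _ y] sum_distrib_left mult_ac)
  also have "\<dots> = (\<Sum>i\<in>UNIV. (\<Sum>r\<in>P. of_int (s r) * of_nat (\<gamma> r i) * y $ i)) / 2"
    unfolding dual_vector by (simp add: sum_distrib_right sum_divide_distrib)
  also have "\<dots> = (\<Sum>r\<in>P. of_int (s r) * lform \<gamma> r y) / 2"
    by (subst sum.swap) (simp add: lform_def sum_distrib_left mult_ac)
  finally show ?thesis .
qed

lemma bil_dual_vector_complex:
  "bil (root_form P \<gamma>) (vec_of_rat (dual_vector s)) z = (\<Sum>r\<in>P. of_int (s r) * lform \<gamma> r z) / 2"
proof -
  have "bil (root_form P \<gamma>) (vec_of_rat (dual_vector s)) z =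
      (\<Sum>i\<in>UNIV. of_rat (\<Sum>r\<in>P. lform \<gamma> r (dual_vector s) * of_nat (\<gamma> r i)) * z $ i)"
    unfolding bil_root_form lform_vec_of_rat of_rat_sum of_rat_mult sum_distrib_right
    by (subst sum.swap) (simp add: lform_def[of \<gamma> _ z] sum_distrib_left mult_ac)
  also have "\<dots> = (\<Sum>i\<in>UNIV. (\<Sum>r\<in>P. of_int (s r) * of_nat (\<gamma> r i) * z $ i)) / 2"
    unfolding dual_vector of_rat_divide of_rat_sum of_rat_mult by (simp add: sum_distrib_right sum_divide_distrib)
  also have "\<dots> = (\<Sum>r\<in>P. of_int (s r) * lform \<gamma> r z) / 2"
    by (subst sum.swap) (simp add: lform_def sum_distrib_left mult_ac)
  finally show ?thesis .
qed

text \<open>Each root contributes l (l - s) / 2 for an integer l and an odd s, and l (l - s) is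
  even.\<close>

lemma dual_vector_in_shadow:
  assumes odd: "\<And>r. r \<in> P \<Longrightarrow> odd (s r)"
  shows "dual_vector s \<in> shadow (root_form P \<gamma>)"
  unfolding shadow_def
proof (rule CollectI, rule allI)
  fix x :: "int^'n"
  have "quad (root_form P \<gamma>) (vec_of_int x) - bil (root_form P \<gamma>) (dual_vector s) (vec_of_int x) =
      (\<Sum>r\<in>P. of_int (lform \<gamma> r x * (lform \<gamma> r x - s r)) / 2)"
    unfolding quad_root_form bil_dual_vector_rat lform_vec_of_int diff_divide_distrib[symmetric] sum_subtractf[symmetric] sum_divide_distrib[symmetric]
    by (simp add: power2_eq_square algebra_simps)
  also have "\<dots> \<in> \<int>"
  proof (rule Ints_sum)
    fix r assume "r \<in> P"
    then have "even (lform \<gamma> r x * (lform \<gamma> r x - s r))" using odd by auto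
    then obtain m where "lform \<gamma> r x * (lform \<gamma> r x - s r) = 2 * m" by blast
    then show "(of_int (lform \<gamma> r x * (lform \<gamma> r x - s r)) / 2 :: rat) \<in> \<int>" by simp
  qed
  finally show "quad (root_form P \<gamma>) (vec_of_int x) - bil (root_form P \<gamma>) (dual_vector s) (vec_of_int x) \<in> (\<int> :: rat set)" .
qed

text \<open>The power of q in an expanded term: k from Euler's product, (n - N)/24 from the
  prefactor of \<eta>, and s^2 / 8 from each theta.\<close>

definition exponent :: "nat \<Rightarrow> ('a \<Rightarrow> int) \<Rightarrow> rat" where
  "exponent k s = of_nat k + (of_nat (dim R) - of_nat (card P)) / 24 + (\<Sum>r\<in>P. (of_int (s r))\<^sup>2) / 8"

text \<open>Odd squares are 1 modulo 8, and (n - N)/24 + N/8 = (n + 2 N)/24.\<close>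

lemma exponent_cong:
  assumes odd: "\<And>r. r \<in> P \<Longrightarrow> odd (s r)"
  shows "exponent k s - of_nat (dim R + 2 * card P) / 24 \<in> \<int>"
proof -
  have "exponent k s - of_nat (dim R + 2 * card P) / 24 = of_nat k + (\<Sum>r\<in>P. ((of_int (s r))\<^sup>2 - 1) / 8)"
    by (simp add: exponent_def sum_subtractf sum_divide_distrib[symmetric] field_simps)
  also have "\<dots> \<in> \<int>"
  proof (intro Ints_add Ints_sum)
    fix r assume "r \<in> P"
    then obtain j where j: "s r = 2 * j + 1" using odd by (auto elim: oddE)
    have "even (j * (j + 1))" by simp
    then obtain m where m: "j * (j + 1) = 2 * m" by blast
    have "((of_int (s r))\<^sup>2 - 1) / 8 = (of_int (j * (j + 1)) / 2 :: rat)"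
      by (simp add: j power2_eq_square field_simps)
    also have "\<dots> = of_int m" unfolding m by simp
    finally show "((of_int (s r))\<^sup>2 - 1) / 8 \<in> (\<int> :: rat set)" by simp
  qed simp
  finally show ?thesis .
qed

text \<open>By completing the square every single term of the expanded product satisfies the condition
  at infinity, so that no cancellation has to be discussed.\<close>

lemma exponent_ge:
  assumes odd: "\<And>r. r \<in> P \<Longrightarrow> odd (s r)"
  shows "quad (root_form P \<gamma>) (dual_vector s) \<le> exponent k s"
proof -
  define L where "L = (\<lambda>r. lform \<gamma> r (dual_vector s))"
  \<comment> \<open>The dual vector paired with itself: the cross term of the square is twice the
    quadratic term.\<close>
  have sL: "(\<Sum>r\<in>P. of_int (s r) * L r) = 2 * (\<Sum>r\<in>P. (L r)\<^sup>2)"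
    using bil_dual_vector_rat[of s "dual_vector s"] unfolding bil_root_form L_def
    by (simp add: power2_eq_square)
  have "real_of_rat ((of_nat (card P) - of_nat (dim R)) / 12) \<le> real_of_rat (\<Sum>r\<in>P. (of_int (s r) / 2 - L r)\<^sup>2)"
    using sum_half_odd_ge[of s "\<lambda>i. real_of_rat (dual_vector s $ i)"] odd
    by (simp add: L_def lform_def of_rat_sum of_rat_mult of_rat_diff of_rat_divide of_rat_power)
  then have "(of_nat (card P) - of_nat (dim R)) / 12 \<le> (\<Sum>r\<in>P. (of_int (s r) / 2 - L r)\<^sup>2)"
    unfolding of_rat_less_eq .
  also have "\<dots> = (\<Sum>r\<in>P. (of_int (s r))\<^sup>2 / 4 - of_int (s r) * L r + (L r)\<^sup>2)"
    by (rule sum.cong) (simp_all add: power2_eq_square field_simps)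
  also have "\<dots> = (\<Sum>r\<in>P. (of_int (s r))\<^sup>2) / 4 - (\<Sum>r\<in>P. (L r)\<^sup>2)"
    by (simp add: sum.distrib sum_subtractf sL sum_divide_distrib)
  finally have ineq: "(of_nat (card P) - of_nat (dim R)) / 12 \<le> (\<Sum>r\<in>P. (of_int (s r))\<^sup>2) / 4 - (\<Sum>r\<in>P. (L r)\<^sup>2)" .
  have quad: "quad (root_form P \<gamma>) (dual_vector s) = (\<Sum>r\<in>P. (L r)\<^sup>2) / 2"
    by (simp add: quad_root_form L_def)
  have lin: "Q / 2 \<le> x + (b - a) / 24 + S / 8" if "(a - b) / 12 \<le> S / 4 - Q" "0 \<le> x" for a b S Q x :: rat
    using that by (simp add: field_simps)
  show ?thesis unfolding exponent_def quad by (rule lin[OF ineq]) simp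
qed

lemma theta_root_expansion:
  "\<exists>coef :: rat \<Rightarrow> rat^'n \<Rightarrow> complex. \<forall>\<tau>\<in>uhp. \<forall>z.
    ((\<lambda>(m, r). coef m r * ee (of_rat m * \<tau>) * ee (bil (root_form P \<gamma>) (vec_of_rat r) z)) has_sum
      theta_root (dim R) P \<gamma> \<tau> z)
    {(m, r). m - of_nat (dim R + 2 * card P) / 24 \<in> \<int> \<and> r \<in> shadow (root_form P \<gamma>) \<and> m \<ge> quad (root_form P \<gamma>) r}"
proof -
  define e where "e = int (dim R) - int (card P)"
  obtain a where a: "\<And>q. norm q < 1 \<Longrightarrow> ((\<lambda>k. a k * q ^ k) has_sum (euler q 1 powi e)) UNIV"
    "\<And>q. norm q < 1 \<Longrightarrow> (\<lambda>k. norm (a k * q ^ k)) summable_on UNIV"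
    using euler_powi_expansion[of e] by blast
  \<comment> \<open>An index consists of a Taylor exponent k and one summand from every theta
    series; even summands are dropped, as their character value is 0.\<close>
  define I where "I = (UNIV :: nat set) \<times> (\<Pi>\<^sub>E r\<in>P. {k :: int. odd k})"
  define \<kappa> where "\<kappa> = (\<lambda>(k, s). (exponent k s, dual_vector s))"
  define c where "c = (\<lambda>(k, s). a k * (\<Prod>r\<in>P. of_int (kronecker_m4 (s r))))"
  let ?T = "{(m, r). m - of_nat (dim R + 2 * card P) / 24 \<in> \<int> \<and> r \<in> shadow (root_form P \<gamma>) \<and> m \<ge> quad (root_form P \<gamma>) r}"
  have \<kappa>: "\<kappa> ` I \<subseteq> ?T"
  proof
    fix p assume "p \<in> \<kappa> ` I"
    then obtain k s where s: "s \<in> (\<Pi>\<^sub>E r\<in>P. {k. odd k})" "p = (exponent k s, dual_vector s)"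
      by (auto simp: I_def \<kappa>_def)
    then have "\<And>r. r \<in> P \<Longrightarrow> odd (s r)" by (auto dest: PiE_mem)
    then show "p \<in> ?T" using s(2) exponent_cong dual_vector_in_shadow exponent_ge by blast
  qed
  have main: "((\<lambda>p. (\<Sum>\<^sub>\<infinity>i\<in>{i\<in>I. \<kappa> i = p}. c i) * (ee (of_rat (fst p) * \<tau>) * ee (bil (root_form P \<gamma>) (vec_of_rat (snd p)) z)))
      has_sum theta_root (dim R) P \<gamma> \<tau> z) ?T" if \<tau>: "\<tau> \<in> uhp" for \<tau> z
  proof (rule has_sum_group[OF _ \<kappa>])
    have q: "norm (ee \<tau>) < 1" by (rule norm_ee_less_1[OF \<tau>])
    have odd_sum: "(theta_term \<tau> u has_sum theta \<tau> u) {k. odd k}" for u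
      by (subst has_sum_cong_neutral[where T = UNIV and g = "theta_term \<tau> u"])
        (use theta_term_has_sum[OF \<tau>] in \<open>auto simp: theta_term_def kronecker_m4_even\<close>)
    have odd_abs: "(\<lambda>k. norm (theta_term \<tau> u k)) summable_on {k. odd k}" for u
      by (rule summable_on_subset_banach[OF theta_term_abs_summable[OF \<tau>]]) simp
    have prod: "((\<lambda>s. \<Prod>r\<in>P. theta_term \<tau> (lform \<gamma> r z) (s r)) has_sum (\<Prod>r\<in>P. theta \<tau> (lform \<gamma> r z))) (\<Pi>\<^sub>E r\<in>P. {k. odd k})"
      "(\<lambda>s. norm (\<Prod>r\<in>P. theta_term \<tau> (lform \<gamma> r z) (s r))) summable_on (\<Pi>\<^sub>E r\<in>P. {k. odd k})"
      using has_sum_prod_PiE[OF finite_P, of "\<lambda>_. {k. odd k}" "\<lambda>r. theta_term \<tau> (lform \<gamma> r z)" "\<lambda>r. theta \<tau> (lform \<gamma> r z)"]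
        odd_sum odd_abs by auto
    have "countable (\<Pi>\<^sub>E r\<in>P. {k :: int. odd k})" by (rule countable_PiE) auto
    from has_sum_mult_product[OF a(1)[OF q] a(2)[OF q] _ prod this]
    have "((\<lambda>(k, s). a k * ee \<tau> ^ k * (\<Prod>r\<in>P. theta_term \<tau> (lform \<gamma> r z) (s r))) has_sum
        (euler (ee \<tau>) 1 powi e * (\<Prod>r\<in>P. theta \<tau> (lform \<gamma> r z)))) I"
      unfolding I_def by auto
    from has_sum_cmult_right[OF this, of "ee (\<tau> / 24) powi e"]
    have "((\<lambda>p. ee (\<tau> / 24) powi e * (case p of (k, s) \<Rightarrow> a k * ee \<tau> ^ k * (\<Prod>r\<in>P. theta_term \<tau> (lform \<gamma> r z) (s r)))) has_sum
        theta_root (dim R) P \<gamma> \<tau> z) I"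
      by (simp add: theta_root_eq eta_eq e_def power_int_mult_distrib mult_ac)
    also have "(\<lambda>p. ee (\<tau> / 24) powi e * (case p of (k, s) \<Rightarrow> a k * ee \<tau> ^ k * (\<Prod>r\<in>P. theta_term \<tau> (lform \<gamma> r z) (s r)))) =
      (\<lambda>i. c i * (ee (of_rat (fst (\<kappa> i)) * \<tau>) * ee (bil (root_form P \<gamma>) (vec_of_rat (snd (\<kappa> i))) z)))"
    proof (rule ext, clarify)
      fix k s
      have pw: "ee (\<tau> / 24) powi e = ee ((of_nat (dim R) - of_nat (card P)) / 24 * \<tau>)"
        unfolding ee_def exp_power_int by (rule arg_cong[where f = exp]) (simp add: e_def field_simps)
      have "(\<Prod>r\<in>P. theta_term \<tau> (lform \<gamma> r z) (s r)) =
          (\<Prod>r\<in>P. of_int (kronecker_m4 (s r))) * ee (\<Sum>r\<in>P. of_int ((s r)\<^sup>2) / 8 * \<tau>) * ee (\<Sum>r\<in>P. of_int (s r) * lform \<gamma> r z / 2)"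
        by (simp only: theta_term_def prod.distrib ee_sum)
      also have "(\<Sum>r\<in>P. of_int (s r) * lform \<gamma> r z / 2) = bil (root_form P \<gamma>) (vec_of_rat (dual_vector s)) z"
        by (simp add: bil_dual_vector_complex sum_divide_distrib)
      finally have t: "(\<Prod>r\<in>P. theta_term \<tau> (lform \<gamma> r z) (s r)) =
          (\<Prod>r\<in>P. of_int (kronecker_m4 (s r))) * ee (\<Sum>r\<in>P. of_int ((s r)\<^sup>2) / 8 * \<tau>) * ee (bil (root_form P \<gamma>) (vec_of_rat (dual_vector s)) z)" .
      have "of_rat (exponent k s) * \<tau> = of_nat k * \<tau> + ((of_nat (dim R) - of_nat (card P)) / 24 * \<tau> + (\<Sum>r\<in>P. of_int ((s r)\<^sup>2) / 8 * \<tau>))"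
        by (simp add: exponent_def of_rat_add of_rat_diff of_rat_divide of_rat_sum of_rat_power sum_divide_distrib sum_distrib_right distrib_right)
      then have x: "ee (of_rat (exponent k s) * \<tau>) = ee \<tau> ^ k * (ee (\<tau> / 24) powi e * ee (\<Sum>r\<in>P. of_int ((s r)\<^sup>2) / 8 * \<tau>))"
        by (simp only: ee_add ee_of_nat_mult pw)
      show "ee (\<tau> / 24) powi e * (a k * ee \<tau> ^ k * (\<Prod>r\<in>P. theta_term \<tau> (lform \<gamma> r z) (s r))) =
        c (k, s) * (ee (of_rat (fst (\<kappa> (k, s))) * \<tau>) * ee (bil (root_form P \<gamma>) (vec_of_rat (snd (\<kappa> (k, s)))) z))"
        unfolding \<kappa>_def c_def prod.case fst_conv snd_conv x t by (simp only: mult_ac)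
    qed
    finally show "((\<lambda>i. c i * (ee (of_rat (fst (\<kappa> i)) * \<tau>) * ee (bil (root_form P \<gamma>) (vec_of_rat (snd (\<kappa> i))) z))) has_sum
        theta_root (dim R) P \<gamma> \<tau> z) I" .
  qed
  show ?thesis
    \<comment> \<open>The coefficient at a monomial sums over its whole fibre and is fixed before
      \<tau> and z, as the quantifiers demand.\<close>
    by (rule exI[of _ "\<lambda>m r. \<Sum>\<^sub>\<infinity>i\<in>{i\<in>I. \<kappa> i = (m, r)}. c i"])
      (use main in \<open>simp add: case_prod_unfold mult.assoc\<close>)
qed

lemma theta_root_jacobi_form:
  "theta_root (dim R) P \<gamma> \<in> jacobi_forms (of_nat (dim R) / 2) (root_form P \<gamma>) (of_nat (dim R + 2 * card P))"
proof -
  \<comment> \<open>Weight minus h/2 is - N, the power of j contributed by the N theta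
    factors.\<close>
  have w: "(of_nat (dim R) / 2 :: rat) - of_nat (dim R + 2 * card P) / 2 = of_int (- int (card P))"
    by (simp add: field_simps)
  have mod: "theta_root (dim R) P \<gamma> ((of_int a * \<tau> + of_int b) / (of_int c * \<tau> + of_int d)) ((1 / (of_int c * \<tau> + of_int d)) *s z) =
      ee (of_int c * quad (root_form P \<gamma>) z / (of_int c * \<tau> + of_int d)) *
      (of_int c * \<tau> + of_int d) powi (- int (card P)) * eps (of_nat (dim R + 2 * card P)) a b c d \<tau> *
      theta_root (dim R) P \<gamma> \<tau> z" if A: "a * d - b * c = 1" and \<tau>: "\<tau> \<in> uhp" for a b c d \<tau> z
    using theta_root_modular[OF A \<tau>, of "dim R" P \<gamma> z] eps_of_nat[OF moebius_act_uhp[OF A \<tau>] \<tau>, of "dim R + 2 * card P"]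
    by (simp only: moebius_act_def moebius_den_def)
  show ?thesis
    unfolding jacobi_forms_def w floor_of_int
    using integral_lattice_root_form theta_root_holomorphic mod theta_root_elliptic theta_root_expansion
    by (intro CollectI conjI) (simp_all only: Ints_of_int, blast+)
qed

end

theorem theorem10p1:
  fixes R P :: "'a::euclidean_space set"
    and f :: "'n::finite \<Rightarrow> 'a"
    and \<gamma> :: "'a \<Rightarrow> 'n \<Rightarrow> nat"
    and n N :: nat
  assumes "root_system R"
    and "n = dim R"
    and "positive_system R P"
    and "N = card P"
    and "bij_betw f UNIV (simple_roots P)"
    and "\<And>r. r \<in> P \<Longrightarrow> r = (\<Sum>i\<in>UNIV. real (\<gamma> r i) *\<^sub>R f i)"
  shows "theta_root n P \<gamma> \<in> jacobi_forms (of_nat n / 2) (root_form P \<gamma>) (of_nat (n + 2 * N))"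
proof -
  interpret pos_root_sys R P f \<gamma>
    using assms by unfold_locales auto
  show ?thesis unfolding assms(2,4) by (rule theta_root_jacobi_form)
qed

end
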